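(* Let $S\subset\mathbb{C}^2$ be a strongly $\mathbb{C}$-convex, simply-connected smooth real hypersurface such that no complex tangent hyperplane of $S$ passes through the origin. Let $X,T$ be the tangential vector fields on $S$ described in the context. Then for every smooth $u\colon S\to\mathbb{C}$ the following conditions are equivalent: (a) $u=f+g$ on $S$, where $f$ is CR and $g$ is dual-CR; (b) $XXTu=0=TTXu$ on $S$.
   Context: All objects are smooth ($C^\infty$); $J$ is the standard complex structure. A smooth real hypersurface $S$ (not necessarily compact) is strongly $\mathbb{C}$-convex if it is locally projectively equivalent to a strongly convex hypersurface, i.e. near each of its points some projective automorphism of $\mathbb{CP}^2\supset\mathbb{C}^2$ maps it to a hypersurface with definite second fundamental form in an affine chart. Put $H_pS=T_pS\cap JT_pS$. The complex tangent hyperplane at $p$ is $p+H_pS$; the assumption that none of these contains $0$ means that $z_1\frac{\partial\rho}{\partial z_1}+z_2\frac{\partial\rho}{\partial z_2}\neq 0$ on $S$, where $\rho$ is any (local) real-valued defining function for $S$ ($S=\{\rho=0\}$, $d\rho\ne0$ on $S$). Set on $S$ $$w_j=\frac{\partial\rho/\partial z_j}{z_1\,\partial\rho/\partial z_1+z_2\,\partial\rho/\partial z_2}\qquad(j=1,2),$$ which does not depend on the choice of $\rho$; then $z_1w_1+z_2w_2=1$ on $S$. A smooth function $f\colon S\to\mathbb{C}$ is CR if $df(Jv)=i\,df(v)$ for all $v\in H_pS$, $p\in S$. The map $\mathscr D_S=(w_1,w_2)\colon S\to\mathbb{C}^2$ is a local diffeomorphism onto a real hypersurface and its derivative carries $H_pS$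 to a complex subspace; set $J^*=(\mathscr D_S'(p))^{-1}\circ J\circ \mathscr D_S'(p)\colon H_pS\to H_pS$. A smooth function $g\colon S\to\mathbb{C}$ is dual-CR if $dg(J^*v)=i\,dg(v)$ for all $v\in H_pS$, $p\in S$. (The CR structure given by $J^*$ is the unique one, with maximal complex subspaces $H_pS$, for which $w_1,w_2$ are CR; it is the projective dual CR structure.) $X$ and $T$ are the (uniquely determined, smooth) complex tangential vector fields on $S$, i.e. sections of $TS\otimes\mathbb{C}$, satisfying $Xz_1=0,\ Xz_2=0,\ Xw_1=z_2,\ Xw_2=-z_1$ and $Tz_1=w_2,\ Tz_2=-w_1,\ Tw_1=0,\ Tw_2=0$. Expressions such as $XXTu$ denote successive application: $X(X(Tu))$. *)

theory Defs
  imports "HOL-Analysis.Analysis"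
begin

type_synonym C2 = "complex \<times> complex"


text \<open>In finite dimension a map is \<open>C\<^sup>k\<^sup>+\<^sup>1\<close> on an open set iff it is differentiable there and all its
  directional derivatives are \<open>C\<^sup>k\<close>; the set \<open>U\<close> is always open where these predicates are used.\<close>

primrec Ck_on :: "nat \<Rightarrow> 'a::euclidean_space set \<Rightarrow> ('a \<Rightarrow> 'b::real_normed_vector) \<Rightarrow> bool" where
  "Ck_on 0 U f \<longleftrightarrow> continuous_on U f"
| "Ck_on (Suc k) U f \<longleftrightarrow>
     (\<forall>x\<in>U. f differentiable (at x)) \<and> (\<forall>v. Ck_on k U (\<lambda>x. frechet_derivative f (at x) v))"

definition smooth_on :: "'a::euclidean_space set \<Rightarrow> ('a \<Rightarrow> 'b::real_normed_vector) \<Rightarrow> bool" where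
  "smooth_on U f \<longleftrightarrow> (\<forall>k. Ck_on k U f)"

definition local_defining_function ::
    "'a::euclidean_space set \<Rightarrow> 'a set \<Rightarrow> ('a \<Rightarrow> real) \<Rightarrow> bool" where
  "local_defining_function S U \<rho> \<longleftrightarrow>
     open U \<and> smooth_on U \<rho> \<and> S \<inter> U = {x \<in> U. \<rho> x = 0} \<and>
     (\<forall>x \<in> S \<inter> U. \<exists>v. frechet_derivative \<rho> (at x) v \<noteq> 0)"

definition smooth_hypersurface :: "'a::euclidean_space set \<Rightarrow> bool" where
  "smooth_hypersurface S \<longleftrightarrow> (\<forall>p\<in>S. \<exists>U \<rho>. p \<in> U \<and> local_defining_function S U \<rho>)"

definition tangent_space :: "'a::euclidean_space set \<Rightarrow> 'a \<Rightarrow> 'a set" where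
  "tangent_space S p =
     {v. \<exists>U \<rho>. p \<in> U \<and> local_defining_function S U \<rho> \<and> frechet_derivative \<rho> (at p) v = 0}"

definition smooth_on_surface :: "'a::euclidean_space set \<Rightarrow> ('a \<Rightarrow> 'b::real_normed_vector) \<Rightarrow> bool" where
  "smooth_on_surface S f \<longleftrightarrow>
     (\<forall>p\<in>S. \<exists>U F. open U \<and> p \<in> U \<and> smooth_on U F \<and> (\<forall>x \<in> S \<inter> U. F x = f x))"

text \<open>The derivative within \<open>S\<close> of a function that is smooth on the hypersurface \<open>S\<close> is unique only
  up to its values in directions transverse to \<open>S\<close>. The differential below is therefore meaningful
  for \<open>v \<in> tangent_space S p\<close>, where it is the usual one, and it is only applied to such \<open>v\<close>.
  It depends only on the values of \<open>f\<close> on \<open>S\<close>.\<close>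

definition surface_diff ::
    "'a::euclidean_space set \<Rightarrow> ('a \<Rightarrow> 'b::real_normed_vector) \<Rightarrow> 'a \<Rightarrow> 'a \<Rightarrow> 'b" where
  "surface_diff S f p v = frechet_derivative f (at p within S) v"


definition gradient :: "('a::euclidean_space \<Rightarrow> real) \<Rightarrow> 'a \<Rightarrow> 'a" where
  "gradient \<rho> x = (\<Sum>b\<in>Basis. frechet_derivative \<rho> (at x) b *\<^sub>R b)"

definition unit_normal :: "('a::euclidean_space \<Rightarrow> real) \<Rightarrow> 'a \<Rightarrow> 'a" where
  "unit_normal \<rho> x = gradient \<rho> x /\<^sub>R norm (gradient \<rho> x)"

text \<open>The second fundamental form, as the derivative of the unit normal (Gauss map). Its sign depends
  on the choice of the defining function, which does not affect definiteness.\<close>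

definition second_fundamental_form :: "('a::euclidean_space \<Rightarrow> real) \<Rightarrow> 'a \<Rightarrow> 'a \<Rightarrow> 'a \<Rightarrow> real" where
  "second_fundamental_form \<rho> p v w = frechet_derivative (unit_normal \<rho>) (at p) v \<bullet> w"

definition strongly_convex_hypersurface :: "'a::euclidean_space set \<Rightarrow> bool" where
  "strongly_convex_hypersurface S \<longleftrightarrow> smooth_hypersurface S \<and>
     (\<forall>p\<in>S. \<forall>U \<rho>. p \<in> U \<longrightarrow> local_defining_function S U \<rho> \<longrightarrow>
        (\<forall>v \<in> tangent_space S p - {0}. second_fundamental_form \<rho> p v v > 0) \<or>
        (\<forall>v \<in> tangent_space S p - {0}. second_fundamental_form \<rho> p v v < 0))"

text \<open>A projective automorphism is given by an invertible matrix \<open>A\<close> acting on the homogeneous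
  coordinates \<open>[1 : z\<^sub>1 : z\<^sub>2]\<close>. Every affine chart of the projective plane is the standard one
  preceded by a projective automorphism, so it suffices to use the standard chart on the target; the
  condition on the first homogeneous coordinate says that the image lies in that chart.\<close>

definition homog_image :: "complex^3^3 \<Rightarrow> C2 \<Rightarrow> complex^3" where
  "homog_image A z = A *v vector [1, fst z, snd z]"

definition projective_map :: "complex^3^3 \<Rightarrow> C2 \<Rightarrow> C2" where
  "projective_map A z =
     (homog_image A z $ 2 / homog_image A z $ 1, homog_image A z $ 3 / homog_image A z $ 1)"

definition strongly_C_convex :: "C2 set \<Rightarrow> bool" where
  "strongly_C_convex S \<longleftrightarrow> smooth_hypersurface S \<and>
     (\<forall>p\<in>S. \<exists>U A. open U \<and> p \<in> U \<and> invertible A \<and>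
        (\<forall>z \<in> S \<inter> U. homog_image A z $ 1 \<noteq> 0) \<and>
        strongly_convex_hypersurface (projective_map A ` (S \<inter> U)))"


definition J :: "C2 \<Rightarrow> C2" where
  "J v = (\<i> * fst v, \<i> * snd v)"

definition complex_tangent_space :: "C2 set \<Rightarrow> C2 \<Rightarrow> C2 set" where
  "complex_tangent_space S p = tangent_space S p \<inter> J ` tangent_space S p"

definition complex_tangent_hyperplane :: "C2 set \<Rightarrow> C2 \<Rightarrow> C2 set" where
  "complex_tangent_hyperplane S p = (\<lambda>v. p + v) ` complex_tangent_space S p"

definition wirtinger1 :: "(C2 \<Rightarrow> real) \<Rightarrow> C2 \<Rightarrow> complex" where
  "wirtinger1 \<rho> p =
     (of_real (frechet_derivative \<rho> (at p) (1, 0)) - \<i> * of_real (frechet_derivative \<rho> (at p) (\<i>, 0))) / 2"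

definition wirtinger2 :: "(C2 \<Rightarrow> real) \<Rightarrow> C2 \<Rightarrow> complex" where
  "wirtinger2 \<rho> p =
     (of_real (frechet_derivative \<rho> (at p) (0, 1)) - \<i> * of_real (frechet_derivative \<rho> (at p) (0, \<i>))) / 2"

text \<open>The map \<open>(w\<^sub>1, w\<^sub>2)\<close>; the value on \<open>S\<close> does not depend on the chosen defining function.\<close>

definition dual_map :: "C2 set \<Rightarrow> C2 \<Rightarrow> C2" where
  "dual_map S p =
     (let \<rho> = (SOME \<rho>. \<exists>U. p \<in> U \<and> local_defining_function S U \<rho>);
          d = fst p * wirtinger1 \<rho> p + snd p * wirtinger2 \<rho> p
      in (wirtinger1 \<rho> p / d, wirtinger2 \<rho> p / d))"

definition Jstar :: "C2 set \<Rightarrow> C2 \<Rightarrow> C2 \<Rightarrow> C2" where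
  "Jstar S p v =
     inv_into (complex_tangent_space S p) (surface_diff S (dual_map S) p)
       (J (surface_diff S (dual_map S) p v))"

definition CR :: "C2 set \<Rightarrow> (C2 \<Rightarrow> complex) \<Rightarrow> bool" where
  "CR S f \<longleftrightarrow> smooth_on_surface S f \<and>
     (\<forall>p\<in>S. \<forall>v \<in> complex_tangent_space S p. surface_diff S f p (J v) = \<i> * surface_diff S f p v)"

definition dual_CR :: "C2 set \<Rightarrow> (C2 \<Rightarrow> complex) \<Rightarrow> bool" where
  "dual_CR S g \<longleftrightarrow> smooth_on_surface S g \<and>
     (\<forall>p\<in>S. \<forall>v \<in> complex_tangent_space S p.
        surface_diff S g p (Jstar S p v) = \<i> * surface_diff S g p v)"

text \<open>An element \<open>a + i b\<close> of the complexified tangent space, with \<open>a\<close> and \<open>b\<close> real tangent vectors,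
  is encoded as the pair \<open>(a, b)\<close>. This formal \<open>i\<close> is unrelated to \<open>J\<close>.\<close>

definition complex_vector_field :: "C2 set \<Rightarrow> (C2 \<Rightarrow> C2 \<times> C2) \<Rightarrow> bool" where
  "complex_vector_field S V \<longleftrightarrow> smooth_on_surface S V \<and>
     (\<forall>p\<in>S. fst (V p) \<in> tangent_space S p \<and> snd (V p) \<in> tangent_space S p)"

definition apply_field ::
    "C2 set \<Rightarrow> (C2 \<Rightarrow> C2 \<times> C2) \<Rightarrow> (C2 \<Rightarrow> complex) \<Rightarrow> C2 \<Rightarrow> complex" where
  "apply_field S V u p = surface_diff S u p (fst (V p)) + \<i> * surface_diff S u p (snd (V p))"

end

theory Submission
  imports Defs
begin

text \<open>The four coordinate functions \<open>z\<^sub>1, z\<^sub>2, w\<^sub>1, w\<^sub>2\<close> of the hypersurface and its projective dual separate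
complex tangent vectors of \<open>S\<close>, so a complex tangential field is known once it is known on them. Applied to
\<open>H = [X,T]\<close> this gives \<open>H z\<^sub>j = - z\<^sub>j\<close>, \<open>H w\<^sub>j = w\<^sub>j\<close>, and then the \<open>sl\<^sub>2\<close> relations
\<open>[H,X] = - 2 X\<close> (lemma \<open>bracket_H_X\<close>) and \<open>[H,T] = 2 T\<close> (lemma \<open>bracket_H_T\<close>); moreover \<open>X, T, H\<close> form a
frame of the complexified tangent bundle (lemma \<open>frame\<close>).

A smooth function \<open>f\<close> is CR iff \<open>X f = 0\<close>, because \<open>X\<close> is a \<open>(0,1)\<close>-vector, and \<open>g\<close> is dual-CR iff
\<open>T g = 0\<close> (lemmas \<open>CR_iff\<close>, \<open>dual_CR_iff\<close>). The second equivalence needs the dual map to be injective on the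
complex tangent spaces. This is where strong \<open>\<complex>\<close>-convexity enters: a kernel vector would make a second
fundamental form vanish in a complex tangential direction (lemma \<open>dual_map_immersive\<close>).

If \<open>u = f + g\<close>, then \<open>T u = T f\<close> and \<open>X T f = H f\<close>, so \<open>X X T u = X H f = H X f + 2 X f = 0\<close>; the other
equation is symmetric. Conversely a CR function \<open>f\<close> with \<open>T f = T u\<close> must satisfy \<open>X f = 0\<close>, \<open>T f = T u\<close>,
\<open>H f = X T u\<close>, which prescribes its differential: with \<open>A = T u\<close> and \<open>B = X T u\<close>,
\<open>df = A (z\<^sub>2 dz\<^sub>1 - z\<^sub>1 dz\<^sub>2) - B (w\<^sub>1 dz\<^sub>1 + w\<^sub>2 dz\<^sub>2)\<close>.
Evaluated on the pairs of the frame, the exterior derivative of the right-hand side is \<open>X A - B = 0\<close>,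
\<open>X B = X X T u\<close> and \<open>T B + 2 A - H A = T T X u\<close>, so the two differential equations say exactly that it is
closed on \<open>S\<close>. On a simply connected hypersurface it is then exact (theorem \<open>closed_form_exact\<close>), and
\<open>g = u - f\<close> satisfies \<open>T g = 0\<close>.

Exactness is obtained by pulling the form back along a smooth parametrization of \<open>S\<close> by a convex open set
(lemma \<open>hypersurface_chart\<close>), where the Poincare lemma applies (theorem \<open>poincare_convex\<close>), and by continuing
the resulting local primitives along paths (theorem \<open>monodromy\<close>).\<close>

section \<open>Calculus of smooth functions\<close>

abbreviation D :: "('a::real_normed_vector \<Rightarrow> 'b::real_normed_vector) \<Rightarrow> 'a \<Rightarrow> 'a \<Rightarrow> 'b" where
  "D f x \<equiv> frechet_derivative f (at x)"

lemma D_eq: "(f has_derivative f') (at x) \<Longrightarrow> D f x = f'"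
  using frechet_derivative_at by metis

lemma D_cong:
  assumes "open U" "x \<in> U" "\<And>y. y \<in> U \<Longrightarrow> f y = g y"
  shows "D f x = D g x"
proof -
  have "(f has_derivative f') (at x) \<longleftrightarrow> (g has_derivative f') (at x)" for f'
    using assms has_derivative_transform_within_open[of f f' x UNIV U g]
      has_derivative_transform_within_open[of g f' x UNIV U f] by auto
  then show ?thesis by (simp add: frechet_derivative_def)
qed

lemma Ck_on_cong:
  assumes "open U" "\<And>x. x \<in> U \<Longrightarrow> f x = g x" "Ck_on k U f"
  shows "Ck_on k U g"
  using assms(2,3)
proof (induction k arbitrary: f g)
  case 0
  then show ?case by (simp cong: continuous_on_cong)
next
  case (Suc k)
  have "g differentiable (at x)" if "x \<in> U" for x
  proof -
    have "(f has_derivative D f x) (at x)" using Suc.prems that frechet_derivative_works by auto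
    then show ?thesis
      using has_derivative_transform_within_open[of f _ x UNIV U g] assms(1) that Suc.prems(1)
      by (auto simp: differentiable_def)
  qed
  moreover have "Ck_on k U (\<lambda>x. D g x v)" for v
    using Suc.IH[of "\<lambda>x. D f x v" "\<lambda>x. D g x v"] Suc.prems D_cong[OF assms(1), of _ f g] by auto
  ultimately show ?case by simp
qed

lemma Ck_on_subset: "Ck_on k U f \<Longrightarrow> V \<subseteq> U \<Longrightarrow> Ck_on k V f"
  by (induction k arbitrary: f) (auto intro: continuous_on_subset)

lemma Ck_on_SucI:
  assumes "open U" "\<And>x. x \<in> U \<Longrightarrow> (f has_derivative f' x) (at x)" "\<And>v. Ck_on k U (\<lambda>x. f' x v)"
  shows "Ck_on (Suc k) U f"
proof -
  have "Ck_on k U (\<lambda>x. D f x v)" for v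
    by (rule Ck_on_cong[OF assms(1) _ assms(3)[of v]]) (use D_eq assms(2) in metis)
  moreover have "f differentiable (at x)" if "x \<in> U" for x
    using assms(2)[OF that] by (rule differentiableI)
  ultimately show ?thesis by simp
qed

lemma Ck_on_Suc_has_derivative: "Ck_on (Suc k) U f \<Longrightarrow> x \<in> U \<Longrightarrow> (f has_derivative D f x) (at x)"
  by (simp add: frechet_derivative_works)

lemma Ck_on_Suc_D: "Ck_on (Suc k) U f \<Longrightarrow> Ck_on k U f"
proof (induction k arbitrary: f)
  case 0
  then have "isCont f x" if "x \<in> U" for x
    using that by (simp add: differentiable_imp_continuous_within)
  then show ?case by (simp add: continuous_at_imp_continuous_on)
next
  case (Suc k)
  have "f differentiable (at x)" if "x \<in> U" for x
    using Suc.prems that by simp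
  moreover have "Ck_on k U (\<lambda>x. D f x v)" for v
  proof (rule Suc.IH)
    show "Ck_on (Suc k) U (\<lambda>x. D f x v)"
      using Suc.prems by (subst (asm) Ck_on.simps(2)) blast
  qed
  ultimately show ?case by simp
qed

lemma Ck_on_const: "Ck_on k U (\<lambda>x. c)"
proof (induction k arbitrary: c)
  case (Suc k) then show ?case by (auto simp: frechet_derivative_const)
qed auto

lemma Ck_on_add:
  "open U \<Longrightarrow> Ck_on k U f \<Longrightarrow> Ck_on k U g \<Longrightarrow> Ck_on k U (\<lambda>x. f x + g x)"
proof (induction k arbitrary: f g)
  case 0 then show ?case by (auto intro: continuous_on_add)
next
  case (Suc k)
  show ?case
    by (rule Ck_on_SucI[where f' = "\<lambda>x v. D f x v + D g x v"])
       (use Suc Ck_on_Suc_has_derivative in \<open>auto intro!: has_derivative_add simp: frechet_derivative_works\<close>)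
qed

lemma Ck_on_sum:
  "finite I \<Longrightarrow> open U \<Longrightarrow> (\<And>i. i \<in> I \<Longrightarrow> Ck_on k U (f i)) \<Longrightarrow> Ck_on k U (\<lambda>x. \<Sum>i\<in>I. f i x)"
  by (induction I rule: finite_induct) (auto intro!: Ck_on_const Ck_on_add)

lemma Ck_on_bounded_linear:
  assumes "open U" "bounded_linear h"
  shows "Ck_on k U f \<Longrightarrow> Ck_on k U (\<lambda>x. h (f x))"
proof (induction k arbitrary: f)
  case 0
  then show ?case using bounded_linear.continuous_on[OF assms(2)] by auto
next
  case (Suc k)
  show ?case
    by (rule Ck_on_SucI[where f' = "\<lambda>x v. h (D f x v)"])
       (use Suc assms in \<open>auto intro!: bounded_linear.has_derivative[OF assms(2)] simp: frechet_derivative_works\<close>)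
qed

lemma (in bounded_bilinear) Ck_on_bilinear:
  "open U \<Longrightarrow> Ck_on k U f \<Longrightarrow> Ck_on k U g \<Longrightarrow> Ck_on k U (\<lambda>x. prod (f x) (g x))"
proof (induction k arbitrary: f g)
  case 0
  then show ?case by (auto intro: continuous_on)
next
  case (Suc k)
  show ?case
  proof (rule Ck_on_SucI[where f' = "\<lambda>x v. prod (f x) (D g x v) + prod (D f x v) (g x)"])
    show "Ck_on k U (\<lambda>x. prod (f x) (D g x v) + prod (D f x v) (g x))" for v
      using Suc.prems by (intro Ck_on_add Suc.IH) (auto intro: Ck_on_Suc_D)
  qed (use Suc.prems in \<open>auto intro!: FDERIV simp: frechet_derivative_works\<close>)
qed

lemma linear_Basis_expansion:
  fixes L :: "'a::euclidean_space \<Rightarrow> 'b::real_vector"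
  assumes "linear L" shows "L v = (\<Sum>b\<in>Basis. (v \<bullet> b) *\<^sub>R L b)"
proof -
  have "L v = L (\<Sum>b\<in>Basis. (v \<bullet> b) *\<^sub>R b)" by (simp add: euclidean_representation)
  then show ?thesis by (simp add: linear_sum[OF assms] linear_cmul[OF assms])
qed

text \<open>The derivative of a composition, expanded in a basis, is a sum of products of functions of one order less;
this is what makes the induction on \<open>k\<close> close without any matrix calculus.\<close>

lemma Ck_on_compose:
  fixes f :: "'a::euclidean_space \<Rightarrow> 'b::euclidean_space" and g :: "'b \<Rightarrow> 'c::real_normed_vector"
  assumes "open U"
  shows "Ck_on k U f \<Longrightarrow> Ck_on k V g \<Longrightarrow> f ` U \<subseteq> V \<Longrightarrow> Ck_on k U (\<lambda>x. g (f x))"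
proof (induction k arbitrary: g)
  case 0
  then show ?case by (auto intro: continuous_on_compose2)
next
  case (Suc k)
  have fd: "(f has_derivative D f x) (at x)" and gd: "(g has_derivative D g (f x)) (at (f x))"
    if "x \<in> U" for x
    using Suc.prems that Ck_on_Suc_has_derivative by blast+
  show ?case
  proof (rule Ck_on_SucI[where f' = "\<lambda>x v. \<Sum>b\<in>Basis. (D f x v \<bullet> b) *\<^sub>R D g (f x) b"])
    fix x assume x: "x \<in> U"
    have "((\<lambda>x. g (f x)) has_derivative (\<lambda>v. D g (f x) (D f x v))) (at x)"
      using diff_chain_at[OF fd[OF x] gd[OF x]] by (simp add: o_def)
    moreover have "(\<lambda>v. \<Sum>b\<in>Basis. (D f x v \<bullet> b) *\<^sub>R D g (f x) b) = (\<lambda>v. D g (f x) (D f x v))"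
      by (rule ext, rule linear_Basis_expansion[symmetric, OF has_derivative_linear[OF gd[OF x]]])
    ultimately show "((\<lambda>x. g (f x)) has_derivative (\<lambda>v. \<Sum>b\<in>Basis. (D f x v \<bullet> b) *\<^sub>R D g (f x) b)) (at x)"
      by simp
  next
    fix v
    show "Ck_on k U (\<lambda>x. \<Sum>b\<in>Basis. (D f x v \<bullet> b) *\<^sub>R D g (f x) b)"
    proof (intro Ck_on_sum bounded_bilinear.Ck_on_bilinear[OF bounded_bilinear_scaleR])
      fix b :: 'b assume "b \<in> Basis"
      show "Ck_on k U (\<lambda>x. D f x v \<bullet> b)"
        by (rule Ck_on_bounded_linear[OF assms bounded_linear_inner_left]) (use Suc.prems in auto)
      show "Ck_on k U (\<lambda>x. D g (f x) b)"
        by (rule Suc.IH) (use Suc.prems in \<open>auto intro: Ck_on_Suc_D\<close>)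
    qed (use assms in auto)
  qed (use assms in auto)
qed

lemma Ck_on_inverse:
  fixes f :: "'a::euclidean_space \<Rightarrow> 'b::real_normed_field"
  assumes "open U" "\<And>x. x \<in> U \<Longrightarrow> f x \<noteq> 0"
  shows "Ck_on k U f \<Longrightarrow> Ck_on k U (\<lambda>x. inverse (f x))"
proof (induction k)
  case 0
  then show ?case using assms(2) by (auto intro: continuous_on_inverse)
next
  case (Suc k)
  show ?case
  proof (rule Ck_on_SucI[where f' = "\<lambda>x v. - (inverse (f x) * D f x v * inverse (f x))"])
    show "((\<lambda>x. inverse (f x)) has_derivative (\<lambda>v. - (inverse (f x) * D f x v * inverse (f x)))) (at x)"
      if "x \<in> U" for x
      using Suc.prems that assms by (intro Deriv.has_derivative_inverse) (auto simp: frechet_derivative_works)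
    show "Ck_on k U (\<lambda>x. - (inverse (f x) * D f x v * inverse (f x)))" for v
      using Suc assms(1)
      by (intro Ck_on_bounded_linear[OF _ bounded_linear_minus[OF bounded_linear_ident]]
          bounded_bilinear.Ck_on_bilinear[OF bounded_bilinear_mult] Suc.IH)
         (auto intro: Ck_on_Suc_D)
  qed (use assms in auto)
qed

lemma smooth_on_cong:
  "open U \<Longrightarrow> (\<And>x. x \<in> U \<Longrightarrow> f x = g x) \<Longrightarrow> smooth_on U f \<Longrightarrow> smooth_on U g"
  using Ck_on_cong unfolding smooth_on_def by blast

lemma smooth_on_subset: "smooth_on U f \<Longrightarrow> V \<subseteq> U \<Longrightarrow> smooth_on V f"
  using Ck_on_subset unfolding smooth_on_def by blast

lemma smooth_on_const: "smooth_on U (\<lambda>x. c)"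
  by (simp add: smooth_on_def Ck_on_const)

lemma smooth_on_add:
  "open U \<Longrightarrow> smooth_on U f \<Longrightarrow> smooth_on U g \<Longrightarrow> smooth_on U (\<lambda>x. f x + g x)"
  by (simp add: smooth_on_def Ck_on_add)

lemma smooth_on_sum:
  "finite I \<Longrightarrow> open U \<Longrightarrow> (\<And>i. i \<in> I \<Longrightarrow> smooth_on U (f i)) \<Longrightarrow> smooth_on U (\<lambda>x. \<Sum>i\<in>I. f i x)"
  by (simp add: smooth_on_def Ck_on_sum)

lemma smooth_on_bounded_linear:
  "open U \<Longrightarrow> bounded_linear h \<Longrightarrow> smooth_on U f \<Longrightarrow> smooth_on U (\<lambda>x. h (f x))"
  by (simp add: smooth_on_def Ck_on_bounded_linear)

lemma smooth_on_minus: "open U \<Longrightarrow> smooth_on U f \<Longrightarrow> smooth_on U (\<lambda>x. - f x)"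
  by (rule smooth_on_bounded_linear[OF _ bounded_linear_minus[OF bounded_linear_ident]])

lemma smooth_on_diff:
  "open U \<Longrightarrow> smooth_on U f \<Longrightarrow> smooth_on U g \<Longrightarrow> smooth_on U (\<lambda>x. f x - g x)"
  using smooth_on_add[of U f "\<lambda>x. - g x"] smooth_on_minus[of U g] by simp

lemma smooth_on_bilinear:
  "bounded_bilinear h \<Longrightarrow> open U \<Longrightarrow> smooth_on U f \<Longrightarrow> smooth_on U g \<Longrightarrow> smooth_on U (\<lambda>x. h (f x) (g x))"
  by (simp add: smooth_on_def bounded_bilinear.Ck_on_bilinear)

lemmas smooth_on_mult = smooth_on_bilinear[OF bounded_bilinear_mult]
lemmas smooth_on_scaleR = smooth_on_bilinear[OF bounded_bilinear_scaleR]
lemmas smooth_on_inner = smooth_on_bilinear[OF bounded_bilinear_inner]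

lemma smooth_on_has_derivative: "smooth_on U f \<Longrightarrow> x \<in> U \<Longrightarrow> (f has_derivative D f x) (at x)"
  unfolding smooth_on_def using Ck_on_Suc_has_derivative by blast

lemma smooth_on_D: "smooth_on U f \<Longrightarrow> smooth_on U (\<lambda>x. D f x v)"
  unfolding smooth_on_def by (metis Ck_on.simps(2))

lemma smooth_onI:
  assumes "open U" "\<And>x. x \<in> U \<Longrightarrow> (f has_derivative f' x) (at x)" "\<And>v. smooth_on U (\<lambda>x. f' x v)"
  shows "smooth_on U f"
  unfolding smooth_on_def
proof
  fix k
  have "Ck_on (Suc k) U f"
    by (rule Ck_on_SucI[OF assms(1,2)]) (use assms(3) in \<open>auto simp: smooth_on_def\<close>)
  then show "Ck_on k U f" by (rule Ck_on_Suc_D)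
qed

lemma smooth_on_imp_continuous_on: "smooth_on U f \<Longrightarrow> continuous_on U f"
  unfolding smooth_on_def by (metis Ck_on.simps(1))

lemma smooth_on_linear: "open U \<Longrightarrow> bounded_linear h \<Longrightarrow> smooth_on U h"
  by (rule smooth_onI[where f' = "\<lambda>_. h"]) (auto intro: bounded_linear_imp_has_derivative smooth_on_const)

lemma smooth_on_ident: "open U \<Longrightarrow> smooth_on U (\<lambda>x. x)"
  by (rule smooth_on_linear) auto

lemma smooth_on_D_dir:
  assumes "open U" "smooth_on U f" "smooth_on U g"
  shows "smooth_on U (\<lambda>x. D f x (g x))"
proof -
  have "smooth_on U (\<lambda>x. \<Sum>b\<in>Basis. (g x \<bullet> b) *\<^sub>R D f x b)"
    using assms by (intro smooth_on_sum smooth_on_scaleR smooth_on_inner smooth_on_D smooth_on_const) auto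
  then show ?thesis
    by (rule smooth_on_cong[OF assms(1), rotated])
      (metis assms(2) has_derivative_linear linear_Basis_expansion smooth_on_has_derivative)
qed

lemma smooth_on_compose:
  fixes f :: "'a::euclidean_space \<Rightarrow> 'b::euclidean_space"
  shows "open U \<Longrightarrow> smooth_on U f \<Longrightarrow> smooth_on V g \<Longrightarrow> f ` U \<subseteq> V \<Longrightarrow> smooth_on U (\<lambda>x. g (f x))"
  unfolding smooth_on_def using Ck_on_compose by blast

lemma smooth_on_inverse:
  fixes f :: "'a::euclidean_space \<Rightarrow> 'b::real_normed_field"
  shows "open U \<Longrightarrow> smooth_on U f \<Longrightarrow> (\<And>x. x \<in> U \<Longrightarrow> f x \<noteq> 0) \<Longrightarrow> smooth_on U (\<lambda>x. inverse (f x))"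
  by (simp add: smooth_on_def Ck_on_inverse)

lemma smooth_on_divide:
  fixes f :: "'a::euclidean_space \<Rightarrow> 'b::real_normed_field"
  shows "open U \<Longrightarrow> smooth_on U f \<Longrightarrow> smooth_on U g \<Longrightarrow> (\<And>x. x \<in> U \<Longrightarrow> g x \<noteq> 0) \<Longrightarrow> smooth_on U (\<lambda>x. f x / g x)"
  using smooth_on_mult[OF _ _ smooth_on_inverse, of U f g] by (simp add: divide_inverse)

lemma smooth_on_Pair:
  assumes "open U" "smooth_on U f" "smooth_on U g"
  shows "smooth_on U (\<lambda>x. (f x, g x))"
proof -
  have "smooth_on U (\<lambda>x. (f x, 0))"
    by (rule smooth_on_bounded_linear[where h = "\<lambda>y. (y, 0)", OF assms(1) _ assms(2)])
      (intro bounded_linear_Pair bounded_linear_ident bounded_linear_zero)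
  moreover have "smooth_on U (\<lambda>x. (0, g x))"
    by (rule smooth_on_bounded_linear[where h = "\<lambda>y. (0, y)", OF assms(1) _ assms(3)])
      (intro bounded_linear_Pair bounded_linear_ident bounded_linear_zero)
  ultimately have "smooth_on U (\<lambda>x. (f x, 0) + (0, g x))"
    using assms(1) by (intro smooth_on_add)
  then show ?thesis by simp
qed

lemma smooth_on_fst: "open U \<Longrightarrow> smooth_on U f \<Longrightarrow> smooth_on U (\<lambda>x. fst (f x))"
  using smooth_on_bounded_linear[where h = fst, OF _ bounded_linear_fst] .

lemma smooth_on_snd: "open U \<Longrightarrow> smooth_on U f \<Longrightarrow> smooth_on U (\<lambda>x. snd (f x))"
  using smooth_on_bounded_linear[where h = snd, OF _ bounded_linear_snd] .

text \<open>The mean value theorem, applied in direction \<open>a\<close> and then in direction \<open>b\<close>, turns the symmetric second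
difference into a mixed second derivative at a nearby point.\<close>

lemma second_difference_mean_value:
  fixes f :: "'a::euclidean_space \<Rightarrow> real"
  assumes "smooth_on U f" "s > 0" and sub: "\<And>r t. 0 \<le> r \<Longrightarrow> r \<le> s \<Longrightarrow> 0 \<le> t \<Longrightarrow> t \<le> s \<Longrightarrow> x + r *\<^sub>R a + t *\<^sub>R b \<in> U"
  obtains r t where "0 < r" "r < s" "0 < t" "t < s"
    "f (x + s *\<^sub>R a + s *\<^sub>R b) - f (x + s *\<^sub>R a) - f (x + s *\<^sub>R b) + f x
       = s * s * D (\<lambda>y. D f y a) (x + r *\<^sub>R a + t *\<^sub>R b) b"
proof -
  have fd: "(f has_derivative D f y) (at y)" and fd2: "((\<lambda>y. D f y a) has_derivative D (\<lambda>y. D f y a) y) (at y)"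
    if "y \<in> U" for y
    using assms(1) that by (auto intro: smooth_on_has_derivative smooth_on_D)
  have line: "((\<lambda>r. g (c + r *\<^sub>R d)) has_real_derivative D g (c + r *\<^sub>R d) d) (at r)"
    if "(g has_derivative D g (c + r *\<^sub>R d)) (at (c + r *\<^sub>R d))" for g :: "'a \<Rightarrow> real" and c d r
  proof -
    have "((\<lambda>r. c + r *\<^sub>R d) has_derivative (\<lambda>h. h *\<^sub>R d)) (at r)"
      by (auto intro!: derivative_eq_intros)
    from diff_chain_at[OF this that]
    have "((\<lambda>r. g (c + r *\<^sub>R d)) has_derivative (\<lambda>h. D g (c + r *\<^sub>R d) (h *\<^sub>R d))) (at r)"
      by (simp add: o_def)
    moreover have "(\<lambda>h. D g (c + r *\<^sub>R d) (h *\<^sub>R d)) = (*) (D g (c + r *\<^sub>R d) d)"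
      using linear_cmul[OF has_derivative_linear[OF that]] by (auto simp: mult.commute)
    ultimately show ?thesis by (simp add: has_field_derivative_def)
  qed
  define \<phi> where "\<phi> r = f ((x + s *\<^sub>R b) + r *\<^sub>R a) - f (x + r *\<^sub>R a)" for r
  have "\<exists>r>0. r < s \<and> \<phi> s - \<phi> 0 = (s - 0) * (D f ((x + s *\<^sub>R b) + r *\<^sub>R a) a - D f (x + r *\<^sub>R a) a)"
    unfolding \<phi>_def
  proof (rule MVT2[OF \<open>s > 0\<close>])
    fix r assume "0 \<le> r" "r \<le> s"
    then have "(x + s *\<^sub>R b) + r *\<^sub>R a \<in> U" "x + r *\<^sub>R a \<in> U"
      using sub[of r s] sub[of r 0] \<open>s > 0\<close> by (auto simp: algebra_simps)
    then show "((\<lambda>r. f ((x + s *\<^sub>R b) + r *\<^sub>R a) - f (x + r *\<^sub>R a)) has_real_derivative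
        (D f ((x + s *\<^sub>R b) + r *\<^sub>R a) a - D f (x + r *\<^sub>R a) a)) (at r)"
      by (intro DERIV_diff line fd)
  qed
  then obtain r where r: "0 < r" "r < s"
    "\<phi> s - \<phi> 0 = s * (D f ((x + s *\<^sub>R b) + r *\<^sub>R a) a - D f (x + r *\<^sub>R a) a)" by auto
  have "\<exists>t>0. t < s \<and> D f ((x + r *\<^sub>R a) + s *\<^sub>R b) a - D f ((x + r *\<^sub>R a) + 0 *\<^sub>R b) a
      = (s - 0) * D (\<lambda>y. D f y a) ((x + r *\<^sub>R a) + t *\<^sub>R b) b"
  proof (rule MVT2[OF \<open>s > 0\<close>])
    fix t assume "0 \<le> t" "t \<le> s"
    then have "(x + r *\<^sub>R a) + t *\<^sub>R b \<in> U" using sub r by auto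
    then show "((\<lambda>t. D f ((x + r *\<^sub>R a) + t *\<^sub>R b) a) has_real_derivative
        D (\<lambda>y. D f y a) ((x + r *\<^sub>R a) + t *\<^sub>R b) b) (at t)"
      by (intro line[where g = "\<lambda>y. D f y a"] fd2)
  qed
  then obtain t where t: "0 < t" "t < s"
    "D f ((x + r *\<^sub>R a) + s *\<^sub>R b) a - D f (x + r *\<^sub>R a) a = s * D (\<lambda>y. D f y a) ((x + r *\<^sub>R a) + t *\<^sub>R b) b"
    by auto
  have "(x + s *\<^sub>R b) + r *\<^sub>R a = (x + r *\<^sub>R a) + s *\<^sub>R b" by (simp add: algebra_simps)
  then have "\<phi> s - \<phi> 0 = s * (s * D (\<lambda>y. D f y a) ((x + r *\<^sub>R a) + t *\<^sub>R b) b)"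
    using r(3) t(3) by metis
  then show ?thesis using that[OF r(1,2) t(1,2)] by (simp add: \<phi>_def algebra_simps)
qed

text \<open>The second difference is symmetric in \<open>a\<close> and \<open>b\<close>, so both mixed derivatives take a common value at points
arbitrarily close to \<open>x\<close>; continuity does the rest.\<close>

lemma second_derivative_symmetric_real:
  fixes f :: "'a::euclidean_space \<Rightarrow> real"
  assumes U: "open U" "smooth_on U f" "x \<in> U"
  shows "D (\<lambda>y. D f y a) x b = D (\<lambda>y. D f y b) x a"
proof -
  let ?g = "\<lambda>y. D (\<lambda>y. D f y a) y b" and ?h = "\<lambda>y. D (\<lambda>y. D f y b) y a"
  have cont: "isCont ?g x" "isCont ?h x"
    using U by (auto intro!: continuous_on_interior[OF smooth_on_imp_continuous_on] smooth_on_D simp: interior_open)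
  obtain e where e: "e > 0" "ball x e \<subseteq> U" using U openE by blast
  \<comment> \<open>the summand \<open>1\<close> keeps \<open>M\<close> positive when both vectors vanish\<close>
  define M where "M = norm a + norm b + 1"
  have "M > 0" by (simp add: M_def add_nonneg_pos)
  have near: "dist x (x + r *\<^sub>R c + t *\<^sub>R d) < \<epsilon>"
    if "0 \<le> r" "r \<le> \<epsilon> / (2*M)" "0 \<le> t" "t \<le> \<epsilon> / (2*M)" "0 < \<epsilon>" "{c,d} = {a,b}" for r t \<epsilon> c d
  proof -
    have "norm c + norm d = norm a + norm b" using that(6) by (auto simp: doubleton_eq_iff)
    then have "norm c + norm d < 2 * M"
      using norm_ge_zero[of a] norm_ge_zero[of b] by (simp add: M_def del: norm_ge_zero)
    have "norm (r *\<^sub>R c + t *\<^sub>R d) \<le> r * norm c + t * norm d"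
      using norm_triangle_ineq[of "r *\<^sub>R c" "t *\<^sub>R d"] that by simp
    also have "\<dots> \<le> \<epsilon> / (2*M) * norm c + \<epsilon> / (2*M) * norm d"
      using that by (intro add_mono mult_right_mono) auto
    also have "\<dots> = \<epsilon> / (2*M) * (norm c + norm d)" by (simp add: distrib_left)
    also have "\<dots> < \<epsilon> / (2*M) * (2*M)"
      using \<open>norm c + norm d < 2 * M\<close> \<open>\<epsilon> > 0\<close> \<open>M > 0\<close> by (intro mult_strict_left_mono) auto
    also have "\<dots> = \<epsilon>" using \<open>M > 0\<close> by simp
    finally show ?thesis by (metis add.assoc add_diff_cancel_left' dist_commute dist_norm)
  qed
  have close: "\<bar>?g x - ?h x\<bar> < 2 * \<eta>" if \<eta>: "\<eta> > 0" for \<eta>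
  proof -
    obtain d1 where d1: "d1 > 0" "\<And>y. dist y x < d1 \<Longrightarrow> \<bar>?g y - ?g x\<bar> < \<eta>"
      using cont(1)[unfolded continuous_at_eps_delta, rule_format, OF \<eta>] by (auto simp: dist_real_def)
    obtain d2 where d2: "d2 > 0" "\<And>y. dist y x < d2 \<Longrightarrow> \<bar>?h y - ?h x\<bar> < \<eta>"
      using cont(2)[unfolded continuous_at_eps_delta, rule_format, OF \<eta>] by (auto simp: dist_real_def)
    define \<epsilon> where "\<epsilon> = min e (min d1 d2)"
    have \<epsilon>: "\<epsilon> > 0" "\<epsilon> \<le> e" "\<epsilon> \<le> d1" "\<epsilon> \<le> d2" using e d1 d2 by (auto simp: \<epsilon>_def)
    define s where "s = \<epsilon> / (2*M)"
    have "s > 0" using \<epsilon> \<open>M > 0\<close> by (simp add: s_def)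
    have inU: "x + r *\<^sub>R c + t *\<^sub>R d \<in> U" if "0 \<le> r" "r \<le> s" "0 \<le> t" "t \<le> s" "{c,d} = {a,b}" for r t c d
      using near[of r \<epsilon> t c d] that \<epsilon> e by (auto simp: s_def subset_iff)
    obtain r t where rt: "0 < r" "r < s" "0 < t" "t < s"
      "f (x + s *\<^sub>R a + s *\<^sub>R b) - f (x + s *\<^sub>R a) - f (x + s *\<^sub>R b) + f x = s * s * ?g (x + r *\<^sub>R a + t *\<^sub>R b)"
      using second_difference_mean_value[OF U(2) \<open>s > 0\<close> inU[where c=a and d=b, OF _ _ _ _ refl]] .
    obtain r' t' where rt': "0 < r'" "r' < s" "0 < t'" "t' < s"
      "f (x + s *\<^sub>R b + s *\<^sub>R a) - f (x + s *\<^sub>R b) - f (x + s *\<^sub>R a) + f x = s * s * ?h (x + r' *\<^sub>R b + t' *\<^sub>R a)"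
      using second_difference_mean_value[OF U(2) \<open>s > 0\<close> inU[where c=b and d=a, OF _ _ _ _ insert_commute]] .
    have eq: "x + s *\<^sub>R b + s *\<^sub>R a = x + s *\<^sub>R a + s *\<^sub>R b" by (simp add: algebra_simps)
    have "s * s * ?g (x + r *\<^sub>R a + t *\<^sub>R b) = s * s * ?h (x + r' *\<^sub>R b + t' *\<^sub>R a)"
      using rt(5) rt'(5)[unfolded eq] by linarith
    then have "?g (x + r *\<^sub>R a + t *\<^sub>R b) = ?h (x + r' *\<^sub>R b + t' *\<^sub>R a)" using \<open>s > 0\<close> by simp
    moreover have "\<bar>?g (x + r *\<^sub>R a + t *\<^sub>R b) - ?g x\<bar> < \<eta>"
      using near[of r \<epsilon> t a b] rt \<epsilon> by (intro d1(2)) (auto simp: s_def dist_commute)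
    moreover have "\<bar>?h (x + r' *\<^sub>R b + t' *\<^sub>R a) - ?h x\<bar> < \<eta>"
      using near[of r' \<epsilon> t' b a, OF _ _ _ _ _ insert_commute] rt' \<epsilon> by (intro d2(2)) (auto simp: s_def dist_commute)
    ultimately show ?thesis by linarith
  qed
  show ?thesis
  proof (rule ccontr)
    assume "?g x \<noteq> ?h x"
    then show False using close[of "\<bar>?g x - ?h x\<bar> / 2"] by simp
  qed
qed

lemma D_bounded_linear_compose:
  assumes "bounded_linear h" "(f has_derivative D f x) (at x)"
  shows "D (\<lambda>y. h (f y)) x = (\<lambda>v. h (D f x v))"
  by (rule D_eq) (rule bounded_linear.has_derivative[OF assms])

lemma second_derivative_symmetric:
  fixes f :: "'a::euclidean_space \<Rightarrow> 'b::euclidean_space"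
  assumes U: "open U" "smooth_on U f" "x \<in> U"
  shows "D (\<lambda>y. D f y a) x b = D (\<lambda>y. D f y b) x a"
proof (rule euclidean_eqI)
  fix i :: 'b assume "i \<in> Basis"
  have 1: "D (\<lambda>y. f y \<bullet> i) y v = D f y v \<bullet> i" if "y \<in> U" for y v
    using D_bounded_linear_compose[OF bounded_linear_inner_left smooth_on_has_derivative[OF U(2) that]] by simp
  have 2: "D (\<lambda>y. D (\<lambda>y. f y \<bullet> i) y v) x w = D (\<lambda>y. D f y v) x w \<bullet> i" for v w
  proof -
    have "D (\<lambda>y. D (\<lambda>y. f y \<bullet> i) y v) x w = D (\<lambda>y. D f y v \<bullet> i) x w"
      using D_cong[OF U(1,3), of "\<lambda>y. D (\<lambda>y. f y \<bullet> i) y v" "\<lambda>y. D f y v \<bullet> i"] 1 by simp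
    then show ?thesis
      using D_bounded_linear_compose[OF bounded_linear_inner_left smooth_on_has_derivative[OF smooth_on_D[OF U(2)] U(3)]]
      by simp
  qed
  have "smooth_on U (\<lambda>y. f y \<bullet> i)" using U by (intro smooth_on_inner smooth_on_const)
  from second_derivative_symmetric_real[OF U(1) this U(3), of a b]
  show "D (\<lambda>y. D f y a) x b \<bullet> i = D (\<lambda>y. D f y b) x a \<bullet> i" by (simp add: 2)
qed

section \<open>Parametrizing a hypersurface and its tangent vectors\<close>

text \<open>Bootstrapping: a solution of a first-order system with smooth coefficients gains one derivative in each step.
An inverse function solves such a system.\<close>

lemma smooth_on_autonomous:
  fixes g :: "'a::euclidean_space \<Rightarrow> 'b::euclidean_space"
  assumes V: "open V" and g: "\<And>y. y \<in> V \<Longrightarrow> (g has_derivative (\<lambda>v. h v (g y))) (at y)"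
    and h: "\<And>v. smooth_on U (h v)" and sub: "g ` V \<subseteq> U"
  shows "smooth_on V g"
  unfolding smooth_on_def
proof
  fix k show "Ck_on k V g"
  proof (induction k)
    case 0
    have "isCont g y" if "y \<in> V" for y using has_derivative_continuous[OF g[OF that]] .
    then show ?case by (simp add: continuous_at_imp_continuous_on)
  next
    case (Suc k)
    show ?case
    proof (rule Ck_on_SucI[OF V g])
      fix v
      have "Ck_on k U (h v)" using h by (simp add: smooth_on_def)
      then show "Ck_on k V (\<lambda>x. h v (g x))" by (rule Ck_on_compose[OF V Suc _ sub])
    qed
  qed
qed

lemma local_defining_functionD:
  assumes "local_defining_function S U \<rho>"
  shows "open U" "smooth_on U \<rho>" "S \<inter> U = {x \<in> U. \<rho> x = 0}"
    "x \<in> S \<Longrightarrow> x \<in> U \<Longrightarrow> \<exists>v. D \<rho> x v \<noteq> 0"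
  using assms by (auto simp: local_defining_function_def)

text \<open>Replacing the coordinate in a direction \<open>e\<close> transverse to \<open>S\<close> by the defining function gives a local
diffeomorphism \<open>\<Phi>\<close> that flattens \<open>S\<close>. Its inverse preceded by the projection along \<open>e\<close> is a map \<open>\<psi>\<close>
from a ball onto a neighbourhood in \<open>S\<close>. Since \<open>\<psi>\<close> has an open convex domain in the ambient space, no second
model space of lower dimension has to be introduced.\<close>

lemma hypersurface_chart:
  fixes S :: "'a::euclidean_space set"
  assumes ld: "local_defining_function S U \<rho>" and p: "p \<in> S" "p \<in> U"
  obtains W V :: "'a set" and \<phi> \<psi> :: "'a \<Rightarrow> 'a" where "open W" "p \<in> W" "W \<subseteq> U" "open V" "convex V"
    "smooth_on W \<phi>" "smooth_on V \<psi>" "\<phi> ` W \<subseteq> V" "\<And>y. y \<in> V \<Longrightarrow> \<psi> y \<in> S \<inter> W"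
    "\<And>x. x \<in> S \<inter> W \<Longrightarrow> \<psi> (\<phi> x) = x"
    "\<And>x v. x \<in> S \<inter> W \<Longrightarrow> D \<rho> x v = 0 \<Longrightarrow> D \<psi> (\<phi> x) (D \<phi> x v) = v"
proof -
  note U = local_defining_functionD[OF ld]
  obtain v0 where v0: "D \<rho> p v0 \<noteq> 0" using U(4)[OF p] by blast
  have dp: "(\<rho> has_derivative D \<rho> x) (at x)" if "x \<in> U" for x
    using smooth_on_has_derivative[OF U(2) that] .
  have lin: "linear (D \<rho> x)" if "x \<in> U" for x using has_derivative_linear[OF dp[OF that]] .
  have "v0 \<noteq> 0" using v0 linear_0[OF lin[OF p(2)]] by auto
  define e where "e = v0 /\<^sub>R norm v0"
  have e: "norm e = 1" "e \<bullet> e = 1" using \<open>v0 \<noteq> 0\<close> by (auto simp: e_def dot_square_norm power2_eq_square)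
  have ep: "D \<rho> p e \<noteq> 0" using v0 \<open>v0 \<noteq> 0\<close> linear_cmul[OF lin[OF p(2)]] by (simp add: e_def)
  define U0 where "U0 = {x \<in> U. D \<rho> x e \<noteq> 0}"
  have "continuous_on U (\<lambda>x. D \<rho> x e)"
    by (intro smooth_on_imp_continuous_on smooth_on_D U)
  then have "open U0"
    using continuous_open_preimage[OF _ U(1), of "\<lambda>x. D \<rho> x e" "- {0}"]
    by (auto simp: U0_def vimage_def Int_def open_delete conj_commute)
  have pU0: "p \<in> U0" using p ep by (simp add: U0_def)
  have U0U: "U0 \<subseteq> U" by (auto simp: U0_def)
  define \<Phi> where "\<Phi> x = x + (\<rho> x - x \<bullet> e) *\<^sub>R e" for x
  define \<Phi>' where "\<Phi>' x v = v + (D \<rho> x v - v \<bullet> e) *\<^sub>R e" for x v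
  \<comment> \<open>\<open>v \<mapsto> h v x\<close> is the inverse of \<open>\<Phi>' x\<close>, smooth in \<open>x\<close>\<close>
  define h where "h v x = v + ((v \<bullet> e - D \<rho> x v) * inverse (D \<rho> x e)) *\<^sub>R e" for v x
  have d\<Phi>: "(\<Phi> has_derivative \<Phi>' x) (at x)" if "x \<in> U" for x
    unfolding \<Phi>_def[abs_def] \<Phi>'_def[abs_def]
    by (rule derivative_eq_intros dp[OF that] | simp)+
  have s\<Phi>: "smooth_on U \<Phi>"
    unfolding \<Phi>_def using U
    by (intro smooth_on_add smooth_on_ident smooth_on_scaleR smooth_on_diff smooth_on_inner smooth_on_const) auto
  have sh: "smooth_on U0 (h v)" for v
    unfolding h_def using \<open>open U0\<close> smooth_on_subset[OF smooth_on_D[OF U(2)] U0U]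
    by (intro smooth_on_add smooth_on_scaleR smooth_on_mult smooth_on_diff smooth_on_inner smooth_on_const
        smooth_on_inverse) (auto simp: U0_def)
  have bl: "bounded_linear (\<Phi>' x)" if "x \<in> U" for x
    using d\<Phi>[OF that] by (rule has_derivative_bounded_linear)
  have h\<Phi>: "h (\<Phi>' x v) x = v" if "x \<in> U0" for x v
  proof -
    have x: "x \<in> U" "D \<rho> x e \<noteq> 0" using that by (auto simp: U0_def)
    have 1: "\<Phi>' x v \<bullet> e = D \<rho> x v" by (simp add: \<Phi>'_def inner_add_left e)
    have "D \<rho> x (\<Phi>' x v) = D \<rho> x v + (D \<rho> x v - v \<bullet> e) * D \<rho> x e"
      using lin[OF x(1)] by (simp add: \<Phi>'_def linear_add linear_cmul)
    then have eq: "(\<Phi>' x v \<bullet> e - D \<rho> x (\<Phi>' x v)) * inverse (D \<rho> x e) = - (D \<rho> x v - v \<bullet> e)"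
      using x(2) 1 by (simp add: field_simps)
    show ?thesis unfolding h_def eq scaleR_minus_left by (simp add: \<Phi>'_def del: minus_diff_eq)
  qed
  have \<Phi>h: "\<Phi>' x (h v x) = v" if "x \<in> U0" for x v
  proof -
    have x: "x \<in> U" "D \<rho> x e \<noteq> 0" using that by (auto simp: U0_def)
    have 1: "D \<rho> x (h v x) = v \<bullet> e"
      using lin[OF x(1)] x(2) by (simp add: h_def linear_add linear_cmul mult.assoc)
    have 2: "h v x \<bullet> e = v \<bullet> e + (v \<bullet> e - D \<rho> x v) * inverse (D \<rho> x e)"
      by (simp add: h_def inner_add_left e)
    have 3: "v + a *\<^sub>R e + (b - (b + a)) *\<^sub>R e = v" for a b by simp
    show ?thesis unfolding \<Phi>'_def 1 2 unfolding h_def by (rule 3)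
  qed
  define F' where "F' x = Blinfun (\<Phi>' x)" for x
  have F': "blinfun_apply (F' x) = \<Phi>' x" if "x \<in> U" for x
    unfolding F'_def using bl[OF that] by (rule bounded_linear_Blinfun_apply)
  have "linear (\<lambda>v. h v p)"
    by (rule linearI) (use lin[OF p(2)] in \<open>auto simp: h_def linear_add linear_cmul inner_add_left algebra_simps scaleR_add_left\<close>)
  then have blh: "bounded_linear (\<lambda>v. h v p)" by (simp add: linear_conv_bounded_linear)
  have contF: "continuous_on U0 F'"
  proof (rule continuous_on_blinfun_componentwise)
    fix i :: 'a
    have "continuous_on U0 (\<lambda>x. \<Phi>' x i)"
      unfolding \<Phi>'_def
      by (intro continuous_intros smooth_on_imp_continuous_on[OF smooth_on_subset[OF smooth_on_D[OF U(2)] U0U]])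
    then show "continuous_on U0 (\<lambda>x. F' x i)"
      by (rule continuous_on_eq) (use U0U F' in auto)
  qed
  obtain W0 V0 g g' where IF: "open W0" "W0 \<subseteq> U0" "p \<in> W0" "open V0" "\<Phi> p \<in> V0" "homeomorphism W0 V0 \<Phi> g"
    "\<And>y. y \<in> V0 \<Longrightarrow> (g has_derivative (g' y)) (at y)"
    "\<And>y. y \<in> V0 \<Longrightarrow> g' y = inv (blinfun_apply (F'(g y)))"
  proof (rule inverse_function_theorem[OF \<open>open U0\<close> _ contF pU0])
    show "(\<Phi> has_derivative blinfun_apply (F' x)) (at x)" if "x \<in> U0" for x
      using that F' d\<Phi> U0U by auto
    show "Blinfun (\<lambda>v. h v p) o\<^sub>L F' p = id_blinfun"
      by (rule blinfun_eqI) (simp add: bounded_linear_Blinfun_apply[OF blh] F' p h\<Phi>[OF pU0])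
  qed blast
  have gU0: "g y \<in> U0" if "y \<in> V0" for y
    using IF(2,6) that by (auto simp: homeomorphism_def)
  have dg: "(g has_derivative (\<lambda>v. h v (g y))) (at y)" if "y \<in> V0" for y
  proof -
    have "inv (\<Phi>' (g y)) = (\<lambda>v. h v (g y))"
      by (rule inv_equality) (simp_all add: h\<Phi> \<Phi>h gU0[OF that])
    then show ?thesis using IF(7,8)[OF that] F' gU0[OF that] U0U by auto
  qed
  have sg: "smooth_on V0 g"
    by (rule smooth_on_autonomous[OF IF(4) dg sh]) (use gU0 in auto)
  obtain r where r: "r > 0" "ball (\<Phi> p) r \<subseteq> V0" using IF(4,5) openE by blast
  define V where "V = ball (\<Phi> p) r"
  \<comment> \<open>\<open>\<Phi> x \<bullet> e = \<rho> x\<close>, so the points with image in the range of \<open>P\<close> are those of \<open>S\<close>\<close>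
  define P where "P y = y - (y \<bullet> e) *\<^sub>R e" for y :: 'a
  define W where "W = {x \<in> W0. \<Phi> x \<in> V}"
  have blP: "bounded_linear P"
    unfolding P_def[abs_def]
    by (intro bounded_linear_sub bounded_linear_ident bounded_linear_scaleR_const bounded_linear_inner_left)
  have \<Phi>e: "\<Phi> x \<bullet> e = \<rho> x" for x by (simp add: \<Phi>_def inner_add_left e)
  have \<Phi>'e: "\<Phi>' x v \<bullet> e = D \<rho> x v" for x v by (simp add: \<Phi>'_def inner_add_left e)
  have PV: "P y \<in> V" if "y \<in> V" for y
  proof -
    have "\<rho> p = 0" using U(3) p by auto
    then have "P (\<Phi> p) = \<Phi> p" by (simp add: P_def \<Phi>e)
    then have "\<Phi> p - P y = P (\<Phi> p - y)" by (simp add: P_def algebra_simps inner_diff_left)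
    moreover have "norm (P z) \<le> norm z" for z
    proof -
      have "(norm (P z))\<^sup>2 = (norm z)\<^sup>2 - (z \<bullet> e)\<^sup>2"
        unfolding power2_norm_eq_inner
        by (simp add: P_def inner_diff_left inner_diff_right e inner_commute[of e z] power2_eq_square)
      then have "(norm (P z))\<^sup>2 \<le> (norm z)\<^sup>2" by simp
      then show ?thesis by simp
    qed
    ultimately show ?thesis using that unfolding V_def
      by (metis dist_norm le_less_trans mem_ball)
  qed
  show ?thesis
  proof (rule that[of W V \<Phi> "\<lambda>y. g (P y)"])
    have W0U: "W0 \<subseteq> U" using IF(2) U0U by blast
    have W: "W = W0 \<inter> \<Phi> -` V" by (auto simp: W_def)
    show "open W" unfolding W
      by (rule continuous_open_preimage[OF smooth_on_imp_continuous_on[OF smooth_on_subset[OF s\<Phi> W0U]] IF(1)])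
        (simp add: V_def)
    show "p \<in> W" using IF r by (simp add: W_def V_def)
    show "W \<subseteq> U" using W0U by (auto simp: W_def)
    show "open V" "convex V" by (auto simp: V_def)
    show "smooth_on W \<Phi>" by (rule smooth_on_subset[OF s\<Phi> \<open>W \<subseteq> U\<close>])
    show "smooth_on V (\<lambda>y. g (P y))"
      by (rule smooth_on_compose[OF _ _ sg]) (use PV r blP in \<open>auto simp: V_def intro!: smooth_on_linear\<close>)
    show "\<Phi> ` W \<subseteq> V" by (auto simp: W_def)
    show gP: "g (P y) \<in> S \<inter> W" if "y \<in> V" for y
    proof -
      have PyV0: "P y \<in> V0" using PV[OF that] r by (auto simp: V_def)
      have 1: "\<Phi> (g (P y)) = P y" using IF(6) PyV0 by (auto simp: homeomorphism_def)
      have 2: "g (P y) \<in> W0" using IF(6) PyV0 by (auto simp: homeomorphism_def)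
      have "\<rho> (g (P y)) = P y \<bullet> e" using \<Phi>e[of "g (P y)"] 1 by simp
      also have "\<dots> = 0" by (simp add: P_def inner_diff_left e)
      finally show ?thesis using 1 2 PV[OF that] U(3) W0U by (auto simp: W_def)
    qed
    have P\<Phi>: "P (\<Phi> x) = \<Phi> x" if "x \<in> S \<inter> W" for x
      using that U(3) \<open>W \<subseteq> U\<close> by (auto simp: P_def \<Phi>e)
    show "g (P (\<Phi> x)) = x" if "x \<in> S \<inter> W" for x
      using P\<Phi>[OF that] that IF(6) by (auto simp: homeomorphism_def W_def)
    show "D (\<lambda>y. g (P y)) (\<Phi> x) (D \<Phi> x v) = v" if x: "x \<in> S \<inter> W" and v: "D \<rho> x v = 0" for x v
    proof -
      have xV0: "\<Phi> x \<in> V0" and xU0: "x \<in> U0" and g\<Phi>: "g (\<Phi> x) = x"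
        using x r IF(2,6) by (auto simp: W_def V_def homeomorphism_def)
      have "((\<lambda>y. g (P y)) has_derivative (\<lambda>v. h (P v) (g (P (\<Phi> x))))) (at (\<Phi> x))"
        using diff_chain_at[OF bounded_linear_imp_has_derivative[OF blP] dg, of "\<Phi> x"] P\<Phi>[OF x] xV0
        by (simp add: o_def)
      then have "D (\<lambda>y. g (P y)) (\<Phi> x) = (\<lambda>v. h (P v) x)" by (simp add: D_eq P\<Phi>[OF x] g\<Phi>)
      moreover have "D \<Phi> x = \<Phi>' x" using D_eq[OF d\<Phi>] xU0 U0U by auto
      moreover have "P (\<Phi>' x v) = \<Phi>' x v" by (simp add: P_def \<Phi>'e v)
      ultimately show ?thesis by (simp add: h\<Phi>[OF xU0])
    qed
  qed
qed

text \<open>Tangent vectors are velocities of curves in \<open>S\<close>. All independence statements about the defining function and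
about extensions of functions from \<open>S\<close> follow by differentiating along such a curve.\<close>

lemma tangent_curve:
  fixes S :: "'a::euclidean_space set"
  assumes ld: "local_defining_function S U \<rho>" and p: "p \<in> S" "p \<in> U" and v: "D \<rho> p v = 0"
  obtains c :: "real \<Rightarrow> 'a" and \<delta> where "c 0 = p" "(c has_derivative (\<lambda>t. t *\<^sub>R v)) (at 0)" "\<delta> > 0"
    "c ` {-\<delta><..<\<delta>} \<subseteq> S"
proof -
  obtain W V :: "'a set" and \<phi> \<psi> :: "'a \<Rightarrow> 'a" where ch: "open W" "p \<in> W" "W \<subseteq> U" "open V" "convex V"
    "smooth_on W \<phi>" "smooth_on V \<psi>" "\<phi> ` W \<subseteq> V" "\<And>y. y \<in> V \<Longrightarrow> \<psi> y \<in> S \<inter> W"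
    "\<And>x. x \<in> S \<inter> W \<Longrightarrow> \<psi> (\<phi> x) = x"
    "\<And>x v. x \<in> S \<inter> W \<Longrightarrow> D \<rho> x v = 0 \<Longrightarrow> D \<psi> (\<phi> x) (D \<phi> x v) = v"
    using hypersurface_chart[OF ld p] by blast
  let ?l = "\<lambda>t. \<phi> p + t *\<^sub>R D \<phi> p v"
  have "\<phi> p \<in> V" using ch by auto
  have "continuous_on UNIV ?l" by (intro continuous_intros)
  then have "open (?l -` V)" using ch(4) by (simp add: open_vimage continuous_on_eq_continuous_at)
  then obtain \<delta> where \<delta>: "\<delta> > 0" "ball 0 \<delta> \<subseteq> ?l -` V"
    using \<open>\<phi> p \<in> V\<close> by (auto elim!: openE[of _ 0])
  have l: "(?l has_derivative (\<lambda>t. t *\<^sub>R D \<phi> p v)) (at 0)" by (auto intro!: derivative_eq_intros)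
  have d\<psi>: "(\<psi> has_derivative D \<psi> (\<phi> p)) (at (?l 0))"
    using smooth_on_has_derivative[OF ch(7) \<open>\<phi> p \<in> V\<close>] by simp
  show ?thesis
  proof
    show "\<psi> (?l 0) = p" using ch(2,10) p by simp
    have "((\<lambda>t. \<psi> (?l t)) has_derivative (\<lambda>t. D \<psi> (\<phi> p) (t *\<^sub>R D \<phi> p v))) (at 0)"
      using diff_chain_at[OF l d\<psi>] by (simp add: o_def)
    moreover have "D \<psi> (\<phi> p) (t *\<^sub>R D \<phi> p v) = t *\<^sub>R v" for t
      using linear_cmul[OF has_derivative_linear[OF d\<psi>]] ch(11)[of p v] ch(2) p v by simp
    ultimately show "((\<lambda>t. \<psi> (?l t)) has_derivative (\<lambda>t. t *\<^sub>R v)) (at 0)" by simp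
    show "(\<lambda>t. \<psi> (?l t)) ` {-\<delta><..<\<delta>} \<subseteq> S"
      using \<delta>(2) ch(9) by (auto simp: subset_iff dist_norm abs_less_iff)
  qed (rule \<delta>)
qed

lemma has_derivative_along_curve:
  fixes S :: "'a::euclidean_space set" and c :: "real \<Rightarrow> 'a"
  assumes "c 0 = p" "(c has_derivative (\<lambda>t. t *\<^sub>R v)) (at 0)" "\<delta> > 0" "c ` {-\<delta><..<\<delta>} \<subseteq> S"
    and f: "(f has_derivative f') (at p within S)"
  shows "((\<lambda>t. f (c t)) has_derivative (\<lambda>t. t *\<^sub>R f' v)) (at 0)"
proof -
  have at: "at 0 within {-\<delta><..<\<delta>} = at (0::real)" using \<open>\<delta> > 0\<close> by (intro at_within_open) auto
  have "((f \<circ> c) has_derivative (f' \<circ> (\<lambda>t. t *\<^sub>R v))) (at 0 within {-\<delta><..<\<delta>})"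
    by (rule diff_chain_within)
      (use assms at in \<open>auto intro: has_derivative_subset\<close>)
  then show ?thesis unfolding at using linear_cmul[OF has_derivative_linear[OF f]] by (simp add: o_def)
qed

lemma tangent_space_iff:
  fixes S :: "'a::euclidean_space set"
  assumes ld: "local_defining_function S U \<rho>" and p: "p \<in> S" "p \<in> U"
  shows "v \<in> tangent_space S p \<longleftrightarrow> D \<rho> p v = 0"
proof
  assume "v \<in> tangent_space S p"
  then obtain U' \<rho>' where 1: "p \<in> U'" "local_defining_function S U' \<rho>'" "D \<rho>' p v = 0"
    by (auto simp: tangent_space_def)
  obtain c and \<delta> where c: "c 0 = p" "(c has_derivative (\<lambda>t. t *\<^sub>R v)) (at 0)" "\<delta> > 0"
    "c ` {-\<delta><..<\<delta>} \<subseteq> S"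
    using tangent_curve[OF 1(2) p(1) 1(1,3)] by blast
  have "(\<rho> has_derivative D \<rho> p) (at p within S)"
    using smooth_on_has_derivative[OF local_defining_functionD(2)[OF ld] p(2)] has_derivative_at_withinI by blast
  from has_derivative_along_curve[OF c this]
  have 2: "((\<lambda>t. \<rho> (c t)) has_derivative (\<lambda>t. t *\<^sub>R D \<rho> p v)) (at 0)" .
  have "open U" by (rule local_defining_functionD[OF ld])
  have "isCont c 0" using c(2) by (rule has_derivative_continuous)
  then have "\<forall>\<^sub>F t in nhds 0. c t \<in> U"
    using \<open>open U\<close> c(1) p(2) by (auto simp: continuous_at_open eventually_nhds)
  moreover have "\<forall>\<^sub>F t in nhds 0. c t \<in> S"
    unfolding eventually_nhds using c(3,4) by (intro exI[of _ "{-\<delta><..<\<delta>}"]) auto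
  ultimately have ev: "\<forall>\<^sub>F t in nhds 0. 0 = \<rho> (c t)"
    by eventually_elim (use local_defining_functionD(3)[OF ld] in auto)
  have "((\<lambda>t. \<rho> (c t)) has_derivative (\<lambda>t. 0)) (at 0)"
    by (rule has_derivative_transform_eventually[where f = "\<lambda>_. 0", OF has_derivative_const])
      (use ev[unfolded eventually_nhds_conv_at] in auto)
  from has_derivative_unique[OF this 2] show "D \<rho> p v = 0" by (metis scaleR_one)
qed (use assms in \<open>auto simp: tangent_space_def\<close>)

lemma surface_diff_eq:
  fixes S :: "'a::euclidean_space set"
  assumes "p \<in> S" "(f has_derivative f') (at p within S)" "v \<in> tangent_space S p"
  shows "surface_diff S f p v = f' v"
proof -
  obtain U \<rho> where 1: "p \<in> U" "local_defining_function S U \<rho>" "D \<rho> p v = 0"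
    using assms(3) by (auto simp: tangent_space_def)
  obtain c and \<delta> where c: "c 0 = p" "(c has_derivative (\<lambda>t. t *\<^sub>R v)) (at 0)" "\<delta> > 0"
    "c ` {-\<delta><..<\<delta>} \<subseteq> S"
    using tangent_curve[OF 1(2) assms(1) 1(1,3)] by blast
  have "(f has_derivative frechet_derivative f (at p within S)) (at p within S)"
    by (rule frechet_derivative_works[THEN iffD1, OF differentiableI[OF assms(2)]])
  from has_derivative_unique[OF has_derivative_along_curve[OF c this] has_derivative_along_curve[OF c assms(2)]]
  show ?thesis unfolding surface_diff_def by (metis scaleR_one)
qed

lemma surface_diff_extension:
  fixes S :: "'a::euclidean_space set"
  assumes "p \<in> S" "open W" "p \<in> W" "\<And>x. x \<in> S \<inter> W \<Longrightarrow> F x = f x" "(F has_derivative F') (at p)"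
    and "v \<in> tangent_space S p"
  shows "surface_diff S f p v = F' v"
proof (rule surface_diff_eq[OF assms(1) _ assms(6)])
  obtain \<delta> where \<delta>: "\<delta> > 0" "ball p \<delta> \<subseteq> W" using openE[OF assms(2,3)] .
  show "(f has_derivative F') (at p within S)"
  proof (rule has_derivative_transform_within[OF has_derivative_at_withinI[OF assms(5)] \<delta>(1) assms(1)])
    fix x assume "x \<in> S" "dist x p < \<delta>"
    then show "F x = f x" using \<delta>(2) by (intro assms(4)) (auto simp: dist_commute subset_iff)
  qed
qed

section \<open>Continuation of local primitives on a simply connected space\<close>

text \<open>\<open>g p\<close> is a function near \<open>p\<close>, a local primitive at \<open>p\<close>. The condition says that the primitives at nearby
points differ by locally constant functions.\<close>

definition compatible_germs :: "('a::metric_space \<Rightarrow> 'a \<Rightarrow> 'c::ab_group_add) \<Rightarrow> 'a set \<Rightarrow> bool" where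
  "compatible_germs g S \<longleftrightarrow> (\<forall>p\<in>S. \<exists>e>0. \<forall>q\<in>S. dist q p < e \<longrightarrow>
     (\<exists>e'>0. \<forall>x\<in>S. dist x q < e' \<longrightarrow> g p x - g p q = g q x - g q q))"

text \<open>\<open>K\<close> is a continuation of the local primitives along \<open>h\<close>: near each parameter \<open>z\<close> its increments are those of
the primitive at \<open>h z\<close>. The parameter set is arbitrary, so the same notion serves for paths, for homotopies and
(with \<open>h\<close> the identity) for the function on \<open>S\<close> that is finally wanted.\<close>

definition continues_along ::
    "('a::metric_space \<Rightarrow> 'a \<Rightarrow> 'c::ab_group_add) \<Rightarrow> ('b::metric_space \<Rightarrow> 'a) \<Rightarrow> 'b set \<Rightarrow> ('b \<Rightarrow> 'c) \<Rightarrow> bool" where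
  "continues_along g h A K \<longleftrightarrow> (\<forall>z\<in>A. \<exists>\<epsilon>>0. \<forall>z'\<in>A. dist z' z < \<epsilon> \<longrightarrow>
     K z' - K z = g (h z) (h z') - g (h z) (h z))"

lemma continues_alongD:
  assumes "continues_along g h A K" "z \<in> A"
  obtains \<epsilon> where "\<epsilon> > 0" "\<And>z'. z' \<in> A \<Longrightarrow> dist z' z < \<epsilon> \<Longrightarrow> K z' - K z = g (h z) (h z') - g (h z) (h z)"
  using assms unfolding continues_along_def by blast

lemma continues_along_subset: "continues_along g h A K \<Longrightarrow> B \<subseteq> A \<Longrightarrow> continues_along g h B K"
  unfolding continues_along_def by (meson subsetD)

lemma continues_along_cong:
  "continues_along g h A K \<Longrightarrow> (\<And>z. z \<in> A \<Longrightarrow> h z = h' z) \<Longrightarrow> continues_along g h' A K"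
  unfolding continues_along_def by simp

lemma continues_along_add_const: "continues_along g h A K \<Longrightarrow> continues_along g h A (\<lambda>z. K z + c)"
  unfolding continues_along_def by simp

lemma continues_along_compose:
  assumes K: "continues_along g h A K" and \<phi>: "continuous_on B \<phi>" "\<phi> ` B \<subseteq> A"
  shows "continues_along g (\<lambda>t. h (\<phi> t)) B (\<lambda>t. K (\<phi> t))"
  unfolding continues_along_def
proof
  fix z assume z: "z \<in> B"
  then have "\<phi> z \<in> A" using \<phi>(2) by blast
  from continues_alongD[OF K this] obtain \<epsilon> where \<epsilon>: "\<epsilon> > 0"
    "\<And>y. y \<in> A \<Longrightarrow> dist y (\<phi> z) < \<epsilon> \<Longrightarrow> K y - K (\<phi> z) = g (h (\<phi> z)) (h y) - g (h (\<phi> z)) (h (\<phi> z))"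
    by blast
  obtain \<delta> where \<delta>: "\<delta> > 0" "\<forall>z'\<in>B. dist z' z < \<delta> \<longrightarrow> dist (\<phi> z') (\<phi> z) < \<epsilon>"
    using \<phi>(1) z \<epsilon>(1) unfolding continuous_on_iff by blast
  show "\<exists>\<delta>>0. \<forall>z'\<in>B. dist z' z < \<delta> \<longrightarrow>
      K (\<phi> z') - K (\<phi> z) = g (h (\<phi> z)) (h (\<phi> z')) - g (h (\<phi> z)) (h (\<phi> z))"
    using \<delta> \<epsilon>(2) \<phi>(2) by (meson image_subset_iff)
qed

text \<open>The difference of two continuations is locally constant.\<close>

lemma continues_along_unique:
  assumes "connected A" "continues_along g h A K" "continues_along g h A K'" "a \<in> A" "b \<in> A"
  shows "K a - K' a = K b - K' b"
proof (rule connected_local_const[OF assms(1,4,5)])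
  show "\<forall>a\<in>A. \<forall>\<^sub>F b in at a within A. K a - K' a = K b - K' b"
  proof
    fix z assume z: "z \<in> A"
    obtain \<epsilon> where 1: "\<epsilon> > 0" "\<And>z'. z' \<in> A \<Longrightarrow> dist z' z < \<epsilon> \<Longrightarrow> K z' - K z = g (h z) (h z') - g (h z) (h z)"
      using continues_alongD[OF assms(2) z] by blast
    obtain \<epsilon>' where 2: "\<epsilon>' > 0" "\<And>z'. z' \<in> A \<Longrightarrow> dist z' z < \<epsilon>' \<Longrightarrow> K' z' - K' z = g (h z) (h z') - g (h z) (h z)"
      using continues_alongD[OF assms(3) z] by blast
    have "K z - K' z = K z' - K' z'" if "z' \<in> A" "dist z' z < min \<epsilon> \<epsilon>'" for z'
    proof -
      have "K z' - K z = K' z' - K' z" using that 1(2)[of z'] 2(2)[of z'] by simp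
      then show ?thesis by (simp add: algebra_simps)
    qed
    then show "\<forall>\<^sub>F b in at z within A. K z - K' z = K b - K' b"
      unfolding eventually_at using 1(1) 2(1) by (intro exI[of _ "min \<epsilon> \<epsilon>'"]) auto
  qed
qed

lemma continues_along_germ:
  assumes e: "\<And>q. q \<in> S \<Longrightarrow> dist q p < e \<Longrightarrow>
      \<exists>e'>0. \<forall>x\<in>S. dist x q < e' \<longrightarrow> g p x - g p q = g q x - g q q"
    and h: "continuous_on A h" "h ` A \<subseteq> S \<inter> ball p e"
  shows "continues_along g h A (\<lambda>z. g p (h z))"
  unfolding continues_along_def
proof
  fix z assume z: "z \<in> A"
  then have "h z \<in> S" "dist (h z) p < e" using h(2) by (auto simp: dist_commute)
  from e[OF this] obtain e' where e': "e' > 0"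
    "\<forall>x\<in>S. dist x (h z) < e' \<longrightarrow> g p x - g p (h z) = g (h z) x - g (h z) (h z)" by blast
  obtain \<delta> where "\<delta> > 0" "\<forall>z'\<in>A. dist z' z < \<delta> \<longrightarrow> dist (h z') (h z) < e'"
    using h(1) z e'(1) unfolding continuous_on_iff by blast
  then show "\<exists>\<epsilon>>0. \<forall>z'\<in>A. dist z' z < \<epsilon> \<longrightarrow> g p (h z') - g p (h z) = g (h z) (h z') - g (h z) (h z)"
    using e'(2) h(2) by (intro exI[of _ \<delta>]) auto
qed

lemma continues_along_local:
  assumes g: "compatible_germs g S" and h: "continuous_on A h" "h ` A \<subseteq> S" and z: "z \<in> A"
  obtains \<delta> where "\<delta> > 0" "\<And>B. B \<subseteq> A \<inter> ball z \<delta> \<Longrightarrow> \<exists>K. continues_along g h B K"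
proof -
  have "h z \<in> S" using h z by blast
  then obtain e where e: "e > 0" "\<And>q. q \<in> S \<Longrightarrow> dist q (h z) < e \<Longrightarrow>
      \<exists>e'>0. \<forall>x\<in>S. dist x q < e' \<longrightarrow> g (h z) x - g (h z) q = g q x - g q q"
    using g unfolding compatible_germs_def by blast
  obtain \<delta> where \<delta>: "\<delta> > 0" "\<forall>z'\<in>A. dist z' z < \<delta> \<longrightarrow> dist (h z') (h z) < e"
    using h(1) z e(1) unfolding continuous_on_iff by blast
  show ?thesis
  proof (rule that[OF \<delta>(1)])
    fix B assume B: "B \<subseteq> A \<inter> ball z \<delta>"
    have "continues_along g h B (\<lambda>y. g (h z) (h y))"
    proof (rule continues_along_germ[OF e(2)])
      show "continuous_on B h" using h(1) B by (auto intro: continuous_on_subset)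
      show "h ` B \<subseteq> S \<inter> ball (h z) e" using B \<delta>(2) h(2) by (fastforce simp: dist_commute subset_iff)
    qed
    then show "\<exists>K. continues_along g h B K" by blast
  qed
qed

text \<open>The connected overlap allows both continuations to be matched by one additive constant; closedness of the two
parts makes the local condition hold at the points of the seam.\<close>

lemma continues_along_Un:
  fixes g :: "'a::metric_space \<Rightarrow> 'a \<Rightarrow> 'c::ab_group_add" and h :: "'b::metric_space \<Rightarrow> 'a"
  assumes "continues_along g h A K" "continues_along g h B L" "closed A" "closed B" "connected (A \<inter> B)"
  obtains M where "continues_along g h (A \<union> B) M"
proof -
  obtain c where c: "\<And>z. z \<in> A \<inter> B \<Longrightarrow> K z - L z = c"
  proof (cases "A \<inter> B = {}")
    case False
    then obtain a where "a \<in> A \<inter> B" by blast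
    have "K z - L z = K a - L a" if "z \<in> A \<inter> B" for z
      by (rule continues_along_unique[OF assms(5) continues_along_subset[OF assms(1)]
            continues_along_subset[OF assms(2)] that \<open>a \<in> A \<inter> B\<close>]) auto
    then show ?thesis by (rule that)
  qed auto
  define L' where "L' z = L z + c" for z
  have L': "continues_along g h B L'" unfolding L'_def by (rule continues_along_add_const[OF assms(2)])
  define M where "M z = (if z \<in> A then K z else L' z)" for z
  have MA: "M z = K z" if "z \<in> A" for z using that by (simp add: M_def)
  have MB: "M z = L' z" if "z \<in> B" for z
    using that c[of z] by (auto simp: M_def L'_def algebra_simps)
  have local: "\<exists>\<epsilon>>0. \<forall>z'\<in>A'. dist z' z < \<epsilon> \<longrightarrow> M z' - M z = g (h z) (h z') - g (h z) (h z)"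
    if A': "closed A'" "continues_along g h A' K'" "\<And>y. y \<in> A' \<Longrightarrow> M y = K' y" for z A' K'
  proof (cases "z \<in> A'")
    case True
    from continues_alongD[OF A'(2) this] show ?thesis using A'(3) True by metis
  next
    case False
    then have "open (- A')" "z \<in> - A'" using A'(1) by auto
    then obtain \<epsilon> where "\<epsilon> > 0" "ball z \<epsilon> \<subseteq> - A'" using openE by metis
    then show ?thesis by (intro exI[of _ \<epsilon>]) (auto simp: dist_commute subset_iff)
  qed
  have "continues_along g h (A \<union> B) M"
    unfolding continues_along_def
  proof
    fix z
    obtain \<epsilon> where 1: "\<epsilon> > 0" "\<forall>z'\<in>A. dist z' z < \<epsilon> \<longrightarrow> M z' - M z = g (h z) (h z') - g (h z) (h z)"
      using local[OF assms(3,1) MA] by blast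
    obtain \<epsilon>' where 2: "\<epsilon>' > 0" "\<forall>z'\<in>B. dist z' z < \<epsilon>' \<longrightarrow> M z' - M z = g (h z) (h z') - g (h z) (h z)"
      using local[OF assms(4) L' MB] by blast
    show "\<exists>\<epsilon>>0. \<forall>z'\<in>A \<union> B. dist z' z < \<epsilon> \<longrightarrow> M z' - M z = g (h z) (h z') - g (h z) (h z)"
      using 1 2 by (intro exI[of _ "min \<epsilon> \<epsilon>'"]) auto
  qed
  then show ?thesis by (rule that)
qed

text \<open>Bisection in each of the two directions, by gluing rectangles along common edges: first a thin strip around a
vertical segment is exhausted, then the strips are joined.\<close>

lemma continues_along_square:
  fixes h :: "real \<times> real \<Rightarrow> 'a::metric_space"
  assumes g: "compatible_germs g S" and h: "continuous_on ({0..1} \<times> {0..1}) h" "h ` ({0..1} \<times> {0..1}) \<subseteq> S"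
  obtains K where "continues_along g h ({0..1} \<times> {0..1}) K"
proof -
  define R where "R a b c d = ({a..b} \<inter> {0..1}) \<times> ({c..d} \<inter> {0..1})" for a b c d :: real
  have R: "closed (R a b c d)" "convex (R a b c d)" for a b c d
    unfolding R_def by (auto intro!: closed_Times convex_Times convex_Int)
  define Q where "Q a b c d \<longleftrightarrow> (\<exists>K. continues_along g h (R a b c d) K)" for a b c d
  have Qv: "Q a b c e" if "Q a b c d" "Q a b d e" "c \<le> d" "d \<le> e" for a b c d e
  proof -
    have "R a b c d \<union> R a b d e = R a b c e" using that by (auto simp: R_def)
    moreover have "connected (R a b c d \<inter> R a b d e)" by (intro convex_connected convex_Int R)
    ultimately show ?thesis using that(1,2) continues_along_Un[OF _ _ R(1) R(1)] unfolding Q_def by metis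
  qed
  have Qh: "Q a c 0 1" if "Q a b 0 1" "Q b c 0 1" "a \<le> b" "b \<le> c" for a b c
  proof -
    have "R a b 0 1 \<union> R b c 0 1 = R a c 0 1" using that by (auto simp: R_def)
    moreover have "connected (R a b 0 1 \<inter> R b c 0 1)" by (intro convex_connected convex_Int R)
    ultimately show ?thesis using that(1,2) continues_along_Un[OF _ _ R(1) R(1)] unfolding Q_def by metis
  qed
  \<comment> \<open>the width of the strip is the minimum of the widths of finitely many squares\<close>
  have strip: "\<exists>\<delta>>0. \<forall>a b. a \<le> s \<and> s \<le> b \<and> b - a < \<delta> \<longrightarrow> Q a b 0 1" if s: "0 \<le> s" "s \<le> 1" for s
  proof (rule Bolzano[of 0 1 "\<lambda>c d. \<exists>\<delta>>0. \<forall>a b. a \<le> s \<and> s \<le> b \<and> b - a < \<delta> \<longrightarrow> Q a b c d"])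
    fix c d e assume "\<exists>\<delta>>0. \<forall>a b. a \<le> s \<and> s \<le> b \<and> b - a < \<delta> \<longrightarrow> Q a b c d"
      "\<exists>\<delta>>0. \<forall>a b. a \<le> s \<and> s \<le> b \<and> b - a < \<delta> \<longrightarrow> Q a b d e" "c \<le> d" "d \<le> (e::real)"
    then obtain \<delta> \<delta>' where "\<delta> > 0" "\<forall>a b. a \<le> s \<and> s \<le> b \<and> b - a < \<delta> \<longrightarrow> Q a b c d"
      "\<delta>' > 0" "\<forall>a b. a \<le> s \<and> s \<le> b \<and> b - a < \<delta>' \<longrightarrow> Q a b d e" by blast
    then show "\<exists>\<delta>>0. \<forall>a b. a \<le> s \<and> s \<le> b \<and> b - a < \<delta> \<longrightarrow> Q a b c e"
      using Qv[OF _ _ \<open>c \<le> d\<close> \<open>d \<le> e\<close>] by (intro exI[of _ "min \<delta> \<delta>'"]) auto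
  next
    fix t :: real assume t: "0 \<le> t" "t \<le> 1"
    then have "(s,t) \<in> {0..1} \<times> {0..1}" using s by auto
    then obtain \<delta> where \<delta>: "\<delta> > 0"
      "\<And>B. B \<subseteq> ({0..1} \<times> {0..1}) \<inter> ball (s,t) \<delta> \<Longrightarrow> \<exists>K. continues_along g h B K"
      using continues_along_local[OF g h] by blast
    have "Q a b c d" if "a \<le> s" "s \<le> b" "b - a < \<delta>/2" "c \<le> t" "t \<le> d" "d - c < \<delta>/2" for a b c d
      unfolding Q_def
    proof (rule \<delta>(2))
      have "dist (s,t) (x,y) < \<delta>" if "x \<in> {a..b}" "y \<in> {c..d}" for x y
      proof -
        have "dist (s,t) (x,y) \<le> \<bar>s - x\<bar> + \<bar>t - y\<bar>"
          using sqrt_sum_squares_le_sum_abs[of "s - x" "t - y"] by (simp add: dist_Pair_Pair dist_real_def)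
        moreover have "\<bar>s - x\<bar> < \<delta>/2" "\<bar>t - y\<bar> < \<delta>/2"
          using that \<open>a \<le> s\<close> \<open>s \<le> b\<close> \<open>b - a < \<delta>/2\<close> \<open>c \<le> t\<close> \<open>t \<le> d\<close> \<open>d - c < \<delta>/2\<close>
          unfolding abs_less_iff by auto
        ultimately show ?thesis by linarith
      qed
      then show "R a b c d \<subseteq> ({0..1} \<times> {0..1}) \<inter> ball (s,t) \<delta>" by (auto simp: R_def)
    qed
    then show "\<exists>d>0. \<forall>c e. c \<le> t \<and> t \<le> e \<and> e - c < d \<longrightarrow>
        (\<exists>\<delta>>0. \<forall>a b. a \<le> s \<and> s \<le> b \<and> b - a < \<delta> \<longrightarrow> Q a b c e)"
      using \<delta>(1) by (metis half_gt_zero)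
  qed simp
  have "Q 0 1 0 1"
    by (rule Bolzano[of 0 1 "\<lambda>a b. Q a b 0 1"]) (use Qh strip in auto)
  moreover have "R 0 1 0 1 = {0..1} \<times> {0..1}" by (simp add: R_def)
  ultimately show ?thesis using that unfolding Q_def by auto
qed

lemma continues_along_path:
  assumes g: "compatible_germs g S" and \<gamma>: "path \<gamma>" "path_image \<gamma> \<subseteq> S"
  obtains K where "continues_along g \<gamma> {0..1} K" "K 0 = 0"
proof -
  have "continuous_on ({0..1} \<times> {0..1}) (\<lambda>z. \<gamma> (fst z))"
    using \<gamma>(1) by (intro continuous_on_compose2[OF _ continuous_on_fst[OF continuous_on_id]]) (auto simp: path_def)
  moreover have "(\<lambda>z. \<gamma> (fst z)) ` ({0..1} \<times> {0..1::real}) \<subseteq> S"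
    using \<gamma>(2) by (auto simp: path_image_def)
  ultimately obtain K where K: "continues_along g (\<lambda>z. \<gamma> (fst z)) ({0..1} \<times> {0..1::real}) K"
    using continues_along_square[OF g] by blast
  have "continuous_on {0..1::real} (\<lambda>t. (t, 0::real))" by (intro continuous_intros)
  then have "continues_along g (\<lambda>t. \<gamma> t) {0..1} (\<lambda>t. K (t, 0))"
    using continues_along_compose[OF K, of "{0..1}" "\<lambda>t. (t, 0)"] by (simp add: image_subset_iff)
  then have "continues_along g \<gamma> {0..1} (\<lambda>t. K (t, 0) + - K (0, 0))"
    by (rule continues_along_add_const)
  then show ?thesis by (rule that) simp
qed

text \<open>Over the square of the homotopy a continuation exists. Its restrictions to two opposite edges continue along
the two paths, and it is constant on the other two edges, where the homotopy is constant.\<close>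

lemma continues_along_homotopic:
  assumes g: "compatible_germs g S" and hom: "homotopic_paths S \<gamma> \<gamma>'"
    and K: "continues_along g \<gamma> {0..1} K" and K': "continues_along g \<gamma>' {0..1} K'"
  shows "K 1 - K 0 = K' 1 - K' 0"
proof -
  obtain h where h: "continuous_on ({0..1} \<times> {0..1}) h" "h \<in> ({0..1} \<times> {0..1}) \<rightarrow> S"
    "\<forall>x\<in>{0..1}. h (0,x) = \<gamma> x" "\<forall>x\<in>{0..1}. h (1,x) = \<gamma>' x"
    "\<forall>t\<in>{0..1::real}. pathstart (h \<circ> Pair t) = pathstart \<gamma> \<and> pathfinish (h \<circ> Pair t) = pathfinish \<gamma>"
    using hom unfolding homotopic_paths by auto
  obtain L where L: "continues_along g h ({0..1} \<times> {0..1}) L"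
    using continues_along_square[OF g h(1)] h(2) by blast
  have edge: "M 1 - M 0 = L (s,1) - L (s,0)"
    if "continues_along g \<beta> {0..1} M" "s \<in> {0..1}" "\<forall>x\<in>{0..1}. h (s,x) = \<beta> x" for M \<beta> s
  proof -
    have "continuous_on {0..1::real} (\<lambda>t. (s, t))" by (intro continuous_intros)
    then have "continues_along g (\<lambda>t. h (s,t)) {0..1} (\<lambda>t. L (s, t))"
      using continues_along_compose[OF L, of "{0..1}" "\<lambda>t. (s, t)"] that(2) by (simp add: image_subset_iff)
    then have "continues_along g \<beta> {0..1} (\<lambda>t. L (s, t))"
      by (rule continues_along_cong) (use that in auto)
    from continues_along_unique[OF _ that(1) this, of 1 0] show ?thesis by (simp add: algebra_simps)
  qed
  have side: "L (0,t) = L (1,t)" if "t \<in> {0,1}" for t :: real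
  proof -
    have cst: "h (s,t) = h (0,t)" if "s \<in> {0..1}" for s
      using h(5)[rule_format, OF that] h(5)[rule_format, of 0] \<open>t \<in> {0,1}\<close>
      by (auto simp: pathstart_def pathfinish_def)
    have "continuous_on {0..1::real} (\<lambda>s. (s, t))" by (intro continuous_intros)
    then have "continues_along g (\<lambda>s. h (s,t)) {0..1} (\<lambda>s. L (s, t))"
      using continues_along_compose[OF L, of "{0..1}" "\<lambda>s. (s, t)"] that by (auto simp: image_subset_iff)
    then have 1: "continues_along g (\<lambda>s. h (0,t)) {0..1} (\<lambda>s. L (s, t))"
      by (rule continues_along_cong) (rule cst)
    have 2: "continues_along g (\<lambda>s. h (0,t)) {0..1::real} (\<lambda>s. 0)"
      unfolding continues_along_def by (auto intro!: exI[of _ "1::real"])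
    from continues_along_unique[OF _ 1 2, of 0 1] show ?thesis by simp
  qed
  show ?thesis using edge[OF K _ h(3)] edge[OF K' _ h(4)] side[of 0] side[of 1] by simp
qed

text \<open>The value at \<open>x\<close> is the increment of a continuation along any path from a base point, which does not depend on
the path because all of them are homotopic. Local path connectedness shows that the resulting function has the
increments of \<open>g x\<close> near \<open>x\<close>: prolong a path to \<open>x\<close> by a short path inside the domain of \<open>g x\<close>.\<close>

theorem monodromy:
  fixes S :: "'a::real_normed_vector set" and g :: "'a \<Rightarrow> 'a \<Rightarrow> 'c::ab_group_add"
  assumes S: "simply_connected S"
    and loc: "\<And>x e. x \<in> S \<Longrightarrow> 0 < e \<Longrightarrow> \<exists>d>0. \<forall>y\<in>S. dist y x < d \<longrightarrow>
        (\<exists>\<gamma>. path \<gamma> \<and> path_image \<gamma> \<subseteq> S \<inter> ball x e \<and> pathstart \<gamma> = x \<and> pathfinish \<gamma> = y)"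
    and g: "compatible_germs g S"
  obtains f where "\<And>x. x \<in> S \<Longrightarrow> \<exists>\<epsilon>>0. \<forall>y\<in>S. dist y x < \<epsilon> \<longrightarrow> f y - f x = g x y - g x x"
proof (cases "S = {}")
  case False
  then obtain x0 where x0: "x0 \<in> S" by blast
  note sc = S[unfolded simply_connected_eq_homotopic_paths]
  have pc: "path_connected S" using sc by (rule conjunct1)
  have hom: "homotopic_paths S p q" if "path p" "path_image p \<subseteq> S" "path q" "path_image q \<subseteq> S"
      "pathstart q = pathstart p" "pathfinish q = pathfinish p" for p q
    using sc[THEN conjunct2, rule_format, of p q] that by simp
  define val where "val x c \<longleftrightarrow> (\<exists>\<gamma> K. path \<gamma> \<and> path_image \<gamma> \<subseteq> S \<and> pathstart \<gamma> = x0 \<and> pathfinish \<gamma> = x \<and>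
      continues_along g \<gamma> {0..1} K \<and> K 0 = 0 \<and> K 1 = c)" for x c
  have ex: "\<exists>c. val x c" if x: "x \<in> S" for x
  proof -
    obtain \<gamma> where \<gamma>: "path \<gamma>" "path_image \<gamma> \<subseteq> S" "pathstart \<gamma> = x0" "pathfinish \<gamma> = x"
      using pc[unfolded path_connected_def, rule_format, OF x0 x] by blast
    then show ?thesis using continues_along_path[OF g \<gamma>(1,2)] unfolding val_def by metis
  qed
  have uniq: "c = c'" if vals: "val x c" "val x c'" for x c c'
  proof -
    obtain \<gamma> K where 1: "path \<gamma>" "path_image \<gamma> \<subseteq> S" "pathstart \<gamma> = x0" "pathfinish \<gamma> = x"
      "continues_along g \<gamma> {0..1} K" "K 0 = 0" "K 1 = c" using vals(1) unfolding val_def by blast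
    obtain \<gamma>' K' where 2: "path \<gamma>'" "path_image \<gamma>' \<subseteq> S" "pathstart \<gamma>' = x0" "pathfinish \<gamma>' = x"
      "continues_along g \<gamma>' {0..1} K'" "K' 0 = 0" "K' 1 = c'" using vals(2) unfolding val_def by blast
    have "homotopic_paths S \<gamma> \<gamma>'" using 1 2 by (intro hom) auto
    from continues_along_homotopic[OF g this 1(5) 2(5)] show ?thesis using 1 2 by simp
  qed
  define f where "f x = (SOME c. val x c)" for x
  have f: "val x (f x)" if "x \<in> S" for x unfolding f_def using ex[OF that] by (rule someI_ex)
  show ?thesis
  proof (rule that)
    fix x assume x: "x \<in> S"
    obtain e where e: "e > 0" "\<And>q. q \<in> S \<Longrightarrow> dist q x < e \<Longrightarrow>
        \<exists>e'>0. \<forall>y\<in>S. dist y q < e' \<longrightarrow> g x y - g x q = g q y - g q q"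
      using g x unfolding compatible_germs_def by blast
    obtain d where d: "d > 0" "\<And>y. y \<in> S \<Longrightarrow> dist y x < d \<Longrightarrow>
        \<exists>\<gamma>. path \<gamma> \<and> path_image \<gamma> \<subseteq> S \<inter> ball x e \<and> pathstart \<gamma> = x \<and> pathfinish \<gamma> = y"
      using loc[OF x e(1)] by blast
    obtain \<gamma> K where \<gamma>: "path \<gamma>" "path_image \<gamma> \<subseteq> S" "pathstart \<gamma> = x0" "pathfinish \<gamma> = x"
      "continues_along g \<gamma> {0..1} K" "K 0 = 0" "K 1 = f x" using f[OF x] unfolding val_def by blast
    have "f y - f x = g x y - g x x" if y: "y \<in> S" "dist y x < d" for y
    proof -
      obtain \<beta> where \<beta>: "path \<beta>" "path_image \<beta> \<subseteq> S \<inter> ball x e" "pathstart \<beta> = x" "pathfinish \<beta> = y"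
        using d(2)[OF y] by blast
      let ?j = "\<gamma> +++ \<beta>"
      have j: "path ?j" "path_image ?j \<subseteq> S" "pathstart ?j = x0" "pathfinish ?j = y"
        using \<gamma> \<beta> by (auto simp: path_image_join)
      obtain L where L: "continues_along g ?j {0..1} L" "L 0 = 0"
        using continues_along_path[OF g j(1,2)] by blast
      have "val y (L 1)" unfolding val_def using j L by blast
      then have "f y = L 1" using uniq f[OF y(1)] by blast
      have "continuous_on {0..1::real} (\<lambda>t. t / 2)" by (intro continuous_intros) auto
      then have "continues_along g (\<lambda>t. ?j (t/2)) {0..1} (\<lambda>t. L (t/2))"
        using continues_along_compose[OF L(1), of "{0..1}" "\<lambda>t. t/2"] by (simp add: image_subset_iff)
      then have 1: "continues_along g \<gamma> {0..1} (\<lambda>t. L (t/2))"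
        by (rule continues_along_cong) (auto simp: joinpaths_def)
      from continues_along_unique[OF _ \<gamma>(5) 1, of 1 0] have "L (1/2) = f x"
        using \<gamma>(6,7) L(2) by (simp add: algebra_simps)
      have "continuous_on {0..1::real} (\<lambda>t. (t + 1) / 2)" by (intro continuous_intros) auto
      then have "continues_along g (\<lambda>t. ?j ((t+1)/2)) {0..1} (\<lambda>t. L ((t+1)/2))"
        using continues_along_compose[OF L(1), of "{0..1}" "\<lambda>t. (t+1)/2"] by (simp add: image_subset_iff)
      then have 2: "continues_along g \<beta> {0..1} (\<lambda>t. L ((t+1)/2))"
      proof (rule continues_along_cong)
        fix t :: real assume "t \<in> {0..1}"
        moreover have "2 * ((t + 1) / 2) - 1 = t" by (simp add: field_simps)
        ultimately show "?j ((t+1)/2) = \<beta> t"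
          using \<gamma>(4) \<beta>(3) by (cases "t = 0") (auto simp: joinpaths_def pathstart_def pathfinish_def)
      qed
      have 3: "continues_along g \<beta> {0..1} (\<lambda>t. g x (\<beta> t))"
        by (rule continues_along_germ[OF e(2)]) (use \<beta> in \<open>auto simp: path_def path_image_def\<close>)
      from continues_along_unique[OF _ 2 3, of 1 0] have "L 1 - g x (\<beta> 1) = L (1/2) - g x (\<beta> 0)" by simp
      moreover have "\<beta> 1 = y" "\<beta> 0 = x" using \<beta> by (auto simp: pathstart_def pathfinish_def)
      ultimately show ?thesis using \<open>f y = L 1\<close> \<open>L (1/2) = f x\<close> by (simp add: algebra_simps)
    qed
    then show "\<exists>\<epsilon>>0. \<forall>y\<in>S. dist y x < \<epsilon> \<longrightarrow> f y - f x = g x y - g x x" using d(1) by blast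
  qed
qed (use that in auto)

section \<open>Closed one-forms on a hypersurface\<close>

text \<open>One-forms are given by their coefficient functions with respect to the standard basis.\<close>

definition one_form :: "('a::euclidean_space \<Rightarrow> 'a \<Rightarrow> 'c::real_normed_vector) \<Rightarrow> 'a \<Rightarrow> 'a \<Rightarrow> 'c" where
  "one_form a x v = (\<Sum>b\<in>Basis. (v \<bullet> b) *\<^sub>R a b x)"

text \<open>The derivative of the form in direction \<open>v\<close>, applied to \<open>w\<close>; closedness means symmetry in \<open>v\<close> and \<open>w\<close>.\<close>

definition one_form_deriv ::
    "('a::euclidean_space \<Rightarrow> 'a \<Rightarrow> 'c::real_normed_vector) \<Rightarrow> 'a \<Rightarrow> 'a \<Rightarrow> 'a \<Rightarrow> 'c" where
  "one_form_deriv a x v w = (\<Sum>b\<in>Basis. (w \<bullet> b) *\<^sub>R D (a b) x v)"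

lemma bounded_linear_one_form: "bounded_linear (one_form a x)"
  unfolding one_form_def
  by (intro bounded_linear_sum bounded_linear_scaleR_const bounded_linear_inner_left)

lemma linear_one_form: "linear (one_form a x)"
  using bounded_linear_one_form by (rule bounded_linear.linear)

lemma one_form_linear_eq: "linear L \<Longrightarrow> (\<And>b. b \<in> Basis \<Longrightarrow> L b = a b x) \<Longrightarrow> one_form a x v = L v"
  using linear_Basis_expansion[of L v] by (simp add: one_form_def)

lemma has_derivative_one_form:
  assumes a: "\<And>b. b \<in> Basis \<Longrightarrow> (a b has_derivative D (a b) (l y)) (at (l y))"
    and l: "(l has_derivative l') (at y)" and m: "(m has_derivative m') (at y)"
  shows "((\<lambda>y. one_form a (l y) (m y)) has_derivative
     (\<lambda>v. one_form_deriv a (l y) (l' v) (m y) + one_form a (l y) (m' v))) (at y)"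
proof -
  have "((\<lambda>y. (m y \<bullet> b) *\<^sub>R a b (l y)) has_derivative
      (\<lambda>v. (m y \<bullet> b) *\<^sub>R D (a b) (l y) (l' v) + (m' v \<bullet> b) *\<^sub>R a b (l y))) (at y)" if "b \<in> Basis" for b
  proof -
    have 1: "((\<lambda>y. a b (l y)) has_derivative (\<lambda>v. D (a b) (l y) (l' v))) (at y)"
      using diff_chain_at[OF l a[OF that]] by (simp add: o_def)
    have 2: "((\<lambda>y. m y \<bullet> b) has_derivative (\<lambda>v. m' v \<bullet> b)) (at y)"
      by (rule has_derivative_inner_left[OF m])
    show ?thesis by (rule has_derivative_scaleR[OF 2 1])
  qed
  then have "((\<lambda>y. \<Sum>b\<in>Basis. (m y \<bullet> b) *\<^sub>R a b (l y)) has_derivative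
      (\<lambda>v. \<Sum>b\<in>Basis. (m y \<bullet> b) *\<^sub>R D (a b) (l y) (l' v) + (m' v \<bullet> b) *\<^sub>R a b (l y))) (at y)"
    by (rule has_derivative_sum)
  then show ?thesis by (simp add: one_form_def one_form_deriv_def sum.distrib)
qed

lemma D_one_form:
  assumes "\<And>b. b \<in> Basis \<Longrightarrow> (a b has_derivative D (a b) x) (at x)"
  shows "D (\<lambda>y. one_form a y w) x v = one_form_deriv a x v w"
proof -
  have "((\<lambda>y. one_form a y w) has_derivative (\<lambda>v. one_form_deriv a x v w + one_form a x 0)) (at x)"
    by (rule has_derivative_one_form[where l = "\<lambda>y. y" and m = "\<lambda>y. w", OF assms]) auto
  then show ?thesis using D_eq linear_0[OF linear_one_form] by fastforce
qed

lemma one_form_deriv_sym: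
  assumes a: "\<And>b. b \<in> Basis \<Longrightarrow> linear (D (a b) x)"
    and cl: "\<And>b b'. b \<in> Basis \<Longrightarrow> b' \<in> Basis \<Longrightarrow> D (a b) x b' = D (a b') x b"
  shows "one_form_deriv a x v w = one_form_deriv a x w v"
proof -
  have "one_form_deriv a x v w = (\<Sum>b\<in>Basis. \<Sum>b'\<in>Basis. ((w \<bullet> b) * (v \<bullet> b')) *\<^sub>R D (a b) x b')" for v w
    unfolding one_form_deriv_def
  proof (rule sum.cong[OF refl])
    fix b :: 'a assume "b \<in> Basis"
    from linear_Basis_expansion[OF a[OF this], of v]
    show "(w \<bullet> b) *\<^sub>R D (a b) x v = (\<Sum>b'\<in>Basis. ((w \<bullet> b) * (v \<bullet> b')) *\<^sub>R D (a b) x b')"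
      by (simp only: scaleR_sum_right scaleR_scaleR)
  qed
  note e = this
  show ?thesis
    unfolding e[of v w] e[of w v]
    by (subst sum.swap) (auto intro!: sum.cong simp: cl mult.commute)
qed

text \<open>The primitive is the integral of the form over the segment from a base point. Differentiating under the
integral, closedness turns the integrand into the derivative of \<open>t \<mapsto> t a(c + t (y - c)) v\<close>.\<close>

theorem poincare_convex:
  fixes a :: "'a::euclidean_space \<Rightarrow> 'a \<Rightarrow> 'c::euclidean_space"
  assumes V: "open V" "convex V" and a: "\<And>b. b \<in> Basis \<Longrightarrow> smooth_on V (a b)"
    and cl: "\<And>y b b'. y \<in> V \<Longrightarrow> b \<in> Basis \<Longrightarrow> b' \<in> Basis \<Longrightarrow> D (a b) y b' = D (a b') y b"
  obtains G where "\<And>y. y \<in> V \<Longrightarrow> (G has_derivative one_form a y) (at y)"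
proof (cases "V = {}")
  case False
  then obtain c where c: "c \<in> V" by blast
  define z where "z y t = c + t *\<^sub>R (y - c)" for y t
  have zV: "z y t \<in> V" if "y \<in> V" "0 \<le> t" "t \<le> 1" for y t
  proof -
    have "z y t = (1 - t) *\<^sub>R c + t *\<^sub>R y" by (simp add: z_def algebra_simps)
    then show ?thesis using V(2) c that by (simp add: convex_alt)
  qed
  have da: "(a b has_derivative D (a b) y) (at y)" if "y \<in> V" "b \<in> Basis" for y b
    using smooth_on_has_derivative[OF a[OF that(2)] that(1)] .
  have sym: "one_form_deriv a y v w = one_form_deriv a y w v" if "y \<in> V" for y v w
    using da[OF that] cl[OF that] by (intro one_form_deriv_sym) (auto intro: has_derivative_linear)
  have ca: "continuous_on V (a b)" if "b \<in> Basis" for b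
    by (intro smooth_on_imp_continuous_on a that)
  have cda: "continuous_on V (\<lambda>y. D (a b) y v)" if "b \<in> Basis" for b v
    by (intro smooth_on_imp_continuous_on smooth_on_D a that)
  define f where "f y t = one_form a (z y t) (y - c)" for y t
  define f' where "f' y t v = one_form_deriv a (z y t) (t *\<^sub>R v) (y - c) + one_form a (z y t) v" for y t v
  have df: "((\<lambda>y. f y t) has_derivative f' y t) (at y)" if "y \<in> V" "0 \<le> t" "t \<le> 1" for y t
    unfolding f_def f'_def[abs_def]
  proof (rule has_derivative_one_form)
    show "((\<lambda>y. z y t) has_derivative (\<lambda>v. t *\<^sub>R v)) (at y)"
      unfolding z_def by (auto intro!: derivative_eq_intros)
    show "((\<lambda>y. y - c) has_derivative (\<lambda>v. v)) (at y)" by (auto intro!: derivative_eq_intros)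
  qed (rule da[OF zV[OF that]])
  have f'_alt: "f' y t v = t *\<^sub>R (\<Sum>b\<in>Basis. ((y - c) \<bullet> b) *\<^sub>R (\<Sum>b'\<in>Basis. (v \<bullet> b') *\<^sub>R D (a b) (z y t) b'))
      + one_form a (z y t) v" if "y \<in> V" "0 \<le> t" "t \<le> 1" for y t v
  proof -
    have "D (a b) (z y t) (t *\<^sub>R v) = t *\<^sub>R (\<Sum>b'\<in>Basis. (v \<bullet> b') *\<^sub>R D (a b) (z y t) b')" if "b \<in> Basis" for b
    proof -
      have l: "linear (D (a b) (z y t))"
        using da[OF zV[OF \<open>y \<in> V\<close> \<open>0 \<le> t\<close> \<open>t \<le> 1\<close>] that] by (rule has_derivative_linear)
      show ?thesis
        unfolding linear_cmul[OF l] by (subst linear_Basis_expansion[OF l, of v]) (rule refl)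
    qed
    then show ?thesis
      by (simp add: f'_def one_form_deriv_def scaleR_sum_right mult.left_commute)
  qed
  define F' where "F' y t = Blinfun (f' y t)" for y t
  have F': "blinfun_apply (F' y t) = f' y t" if "y \<in> V" "0 \<le> t" "t \<le> 1" for y t
    unfolding F'_def using df[OF that] by (intro bounded_linear_Blinfun_apply has_derivative_bounded_linear)
  have cz: "continuous_on (V \<times> {0..1}) (\<lambda>p. z (fst p) (snd p))"
    unfolding z_def by (intro continuous_intros)
  have zsub: "(\<lambda>p. z (fst p) (snd p)) ` (V \<times> {0..1}) \<subseteq> V" using zV by auto
  have contF: "continuous_on (V \<times> {0..1}) (\<lambda>p. F' (fst p) (snd p))"
  proof (rule continuous_on_blinfun_componentwise)
    fix i :: 'a
    have "continuous_on (V \<times> {0..1}) (\<lambda>p. snd p *\<^sub>R (\<Sum>b\<in>Basis. ((fst p - c) \<bullet> b) *\<^sub>R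
        (\<Sum>b'\<in>Basis. (i \<bullet> b') *\<^sub>R D (a b) (z (fst p) (snd p)) b')) + one_form a (z (fst p) (snd p)) i)"
      unfolding one_form_def
      by (intro continuous_intros continuous_on_compose2[OF ca cz zsub] continuous_on_compose2[OF cda cz zsub])
    then show "continuous_on (V \<times> {0..1}) (\<lambda>p. blinfun_apply (F' (fst p) (snd p)) i)"
      by (rule continuous_on_eq) (auto simp: F' f'_alt)
  qed
  define G where "G y = integral (cbox 0 1) (f y)" for y
  show ?thesis
  proof (rule that)
    fix y assume y: "y \<in> V"
    have "((\<lambda>y. integral (cbox 0 1) (f y)) has_derivative blinfun_apply (integral (cbox 0 1) (F' y))) (at y within V)"
    proof (rule leibniz_rule[OF _ _ _ y V(2)])
      show "((\<lambda>y. f y t) has_derivative blinfun_apply (F' x t)) (at x within V)" if "x \<in> V" "t \<in> cbox 0 1" for x t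
        using df that by (auto simp: F' intro: has_derivative_at_withinI)
      show "f x integrable_on cbox 0 1" if "x \<in> V" for x
      proof (rule integrable_continuous)
        have 1: "continuous_on (cbox 0 1) (z x)" unfolding z_def by (intro continuous_intros)
        have 2: "z x ` (cbox 0 1) \<subseteq> V" using zV that by auto
        show "continuous_on (cbox 0 1) (f x)"
          unfolding f_def one_form_def by (intro continuous_intros continuous_on_compose2[OF ca 1 2])
      qed
      show "continuous_on (V \<times> cbox 0 1) (\<lambda>(x, t). F' x t)" using contF by (simp add: case_prod_beta')
    qed
    moreover have "blinfun_apply (integral (cbox 0 1) (F' y)) = one_form a y"
    proof
      fix v
      have "continuous_on (cbox 0 1) (\<lambda>t. (\<lambda>p. F' (fst p) (snd p)) (y, t))"
        by (rule continuous_on_compose2[OF contF]) (use y in \<open>auto intro: continuous_intros\<close>)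
      then have "F' y integrable_on cbox 0 1" by (simp add: integrable_continuous_real)
      then have "blinfun_apply (integral (cbox 0 1) (F' y)) v = integral {0..1} (\<lambda>t. blinfun_apply (F' y t) v)"
        by (simp add: blinfun_apply_integral)
      also have "\<dots> = integral {0..1} (\<lambda>t. f' y t v)"
        by (rule integral_cong) (use y in \<open>auto simp: F'\<close>)
      also have "\<dots> = one_form a (z y 1) (1 *\<^sub>R v) - one_form a (z y 0) (0 *\<^sub>R v)"
      proof (rule integral_unique, rule fundamental_theorem_of_calculus)
        fix t :: real assume t: "t \<in> {0..1}"
        have "((\<lambda>t. one_form a (z y t) (t *\<^sub>R v)) has_derivative
           (\<lambda>h. one_form_deriv a (z y t) (h *\<^sub>R (y - c)) (t *\<^sub>R v) + one_form a (z y t) (h *\<^sub>R v))) (at t)"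
        proof (rule has_derivative_one_form)
          show "((\<lambda>t. z y t) has_derivative (\<lambda>h. h *\<^sub>R (y - c))) (at t)"
            unfolding z_def by (auto intro!: derivative_eq_intros)
          show "((\<lambda>t. t *\<^sub>R v) has_derivative (\<lambda>h. h *\<^sub>R v)) (at t)" by (auto intro!: derivative_eq_intros)
        qed (use da[OF zV] y t in auto)
        moreover have "one_form_deriv a (z y t) (h *\<^sub>R (y - c)) (t *\<^sub>R v) + one_form a (z y t) (h *\<^sub>R v)
            = h *\<^sub>R f' y t v" for h
        proof -
          have "one_form_deriv a (z y t) (h *\<^sub>R (y - c)) (t *\<^sub>R v)
              = one_form_deriv a (z y t) (t *\<^sub>R v) (h *\<^sub>R (y - c))"
            by (rule sym) (use zV y t in auto)
          also have "\<dots> = h *\<^sub>R one_form_deriv a (z y t) (t *\<^sub>R v) (y - c)"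
            by (simp add: one_form_deriv_def scaleR_sum_right)
          finally show ?thesis by (simp add: f'_def linear_cmul[OF linear_one_form] scaleR_add_right)
        qed
        ultimately show "((\<lambda>t. one_form a (z y t) (t *\<^sub>R v)) has_vector_derivative f' y t v) (at t within {0..1})"
          unfolding has_vector_derivative_def by (auto intro: has_derivative_at_withinI)
      qed simp
      also have "\<dots> = one_form a y v" by (simp add: z_def linear_0[OF linear_one_form])
      finally show "blinfun_apply (integral (cbox 0 1) (F' y)) v = one_form a y v" .
    qed
    ultimately show "(G has_derivative one_form a y) (at y)"
      unfolding G_def[abs_def] at_within_open[OF y V(1)] by simp
  qed
qed (use that in auto)

lemma local_defining_function_subset:
  "local_defining_function S U \<rho> \<Longrightarrow> open V \<Longrightarrow> V \<subseteq> U \<Longrightarrow> local_defining_function S V \<rho>"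
  unfolding local_defining_function_def by (auto intro: smooth_on_subset)

text \<open>The same parametrization, near \<open>p\<close> and with tangent spaces in place of a particular defining function.\<close>

lemma hypersurface_chart_within:
  fixes S :: "'a::euclidean_space set"
  assumes S: "smooth_hypersurface S" and p: "p \<in> S" and N: "open N" "p \<in> N"
  obtains W V :: "'a set" and \<phi> \<psi> :: "'a \<Rightarrow> 'a" where "open W" "p \<in> W" "W \<subseteq> N" "open V" "convex V"
    "smooth_on W \<phi>" "smooth_on V \<psi>" "\<phi> ` W \<subseteq> V" "\<And>y. y \<in> V \<Longrightarrow> \<psi> y \<in> S \<inter> W"
    "\<And>x. x \<in> S \<inter> W \<Longrightarrow> \<psi> (\<phi> x) = x"
    "\<And>x v. x \<in> S \<inter> W \<Longrightarrow> v \<in> tangent_space S x \<Longrightarrow> D \<psi> (\<phi> x) (D \<phi> x v) = v"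
    "\<And>y v. y \<in> V \<Longrightarrow> D \<psi> y v \<in> tangent_space S (\<psi> y)"
proof -
  obtain U \<rho> where U: "p \<in> U" "local_defining_function S U \<rho>"
    using S p unfolding smooth_hypersurface_def by blast
  have ld: "local_defining_function S (U \<inter> N) \<rho>"
    using local_defining_function_subset[OF U(2)] local_defining_functionD(1)[OF U(2)] N(1) by auto
  obtain W V :: "'a set" and \<phi> \<psi> :: "'a \<Rightarrow> 'a" where ch: "open W" "p \<in> W" "W \<subseteq> U \<inter> N" "open V" "convex V"
    "smooth_on W \<phi>" "smooth_on V \<psi>" "\<phi> ` W \<subseteq> V" "\<And>y. y \<in> V \<Longrightarrow> \<psi> y \<in> S \<inter> W"
    "\<And>x. x \<in> S \<inter> W \<Longrightarrow> \<psi> (\<phi> x) = x"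
    "\<And>x v. x \<in> S \<inter> W \<Longrightarrow> D \<rho> x v = 0 \<Longrightarrow> D \<psi> (\<phi> x) (D \<phi> x v) = v"
    using hypersurface_chart[OF ld p] U(1) N(2) by blast
  have T: "v \<in> tangent_space S x \<longleftrightarrow> D \<rho> x v = 0" if "x \<in> S \<inter> W" for x v
    using tangent_space_iff[OF ld, of x v] that ch(3) by blast
  have "D \<psi> y v \<in> tangent_space S (\<psi> y)" if y: "y \<in> V" for y v
  proof -
    have d\<psi>: "(\<psi> has_derivative D \<psi> y) (at y)" by (rule smooth_on_has_derivative[OF ch(7) y])
    have "(\<rho> has_derivative D \<rho> (\<psi> y)) (at (\<psi> y))"
      using smooth_on_has_derivative[OF local_defining_functionD(2)[OF ld]] ch(3) ch(9)[OF y] by blast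
    from diff_chain_at[OF d\<psi> this]
    have 1: "((\<lambda>y. \<rho> (\<psi> y)) has_derivative (\<lambda>v. D \<rho> (\<psi> y) (D \<psi> y v))) (at y)" by (simp add: o_def)
    have "\<rho> (\<psi> x) = 0" if "x \<in> V" for x
      using ch(9)[OF that] ch(3) local_defining_functionD(3)[OF ld] by blast
    then have "((\<lambda>y. \<rho> (\<psi> y)) has_derivative (\<lambda>v. 0)) (at y)"
      by (intro has_derivative_transform_within_open[OF has_derivative_const ch(4) y]) auto
    from fun_cong[OF has_derivative_unique[OF 1 this], of v] show ?thesis using T ch(9)[OF y] by blast
  qed
  then show ?thesis using ch T by (intro that[of W V \<phi> \<psi>]) auto
qed

lemma hypersurface_locally_path_connected:
  fixes S :: "'a::euclidean_space set"
  assumes S: "smooth_hypersurface S" and p: "p \<in> S" "e > 0"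
  shows "\<exists>d>0. \<forall>y\<in>S. dist y p < d \<longrightarrow>
        (\<exists>\<gamma>. path \<gamma> \<and> path_image \<gamma> \<subseteq> S \<inter> ball p e \<and> pathstart \<gamma> = p \<and> pathfinish \<gamma> = y)"
proof -
  obtain W V :: "'a set" and \<phi> \<psi> :: "'a \<Rightarrow> 'a" where ch: "open W" "p \<in> W" "W \<subseteq> ball p e" "open V" "convex V"
    "smooth_on V \<psi>" "\<phi> ` W \<subseteq> V" "\<And>y. y \<in> V \<Longrightarrow> \<psi> y \<in> S \<inter> W" "\<And>x. x \<in> S \<inter> W \<Longrightarrow> \<psi> (\<phi> x) = x"
    by (rule hypersurface_chart_within[OF S p(1), of "ball p e"]) (use p in auto)
  obtain d where d: "d > 0" "ball p d \<subseteq> W" using openE[OF ch(1,2)] .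
  have "\<exists>\<gamma>. path \<gamma> \<and> path_image \<gamma> \<subseteq> S \<inter> ball p e \<and> pathstart \<gamma> = p \<and> pathfinish \<gamma> = y"
    if y: "y \<in> S" "dist y p < d" for y
  proof -
    have yW: "y \<in> W" using y d(2) by (auto simp: dist_commute subset_iff)
    have seg: "path_image (linepath (\<phi> p) (\<phi> y)) \<subseteq> V"
      using closed_segment_subset[OF _ _ ch(5)] ch(2,7) yW by auto
    have "path (\<psi> \<circ> linepath (\<phi> p) (\<phi> y))"
      by (intro path_continuous_image path_linepath continuous_on_subset[OF smooth_on_imp_continuous_on[OF ch(6)] seg])
    moreover have "path_image (\<psi> \<circ> linepath (\<phi> p) (\<phi> y)) \<subseteq> S \<inter> ball p e"
      using seg ch(3,8) unfolding path_image_compose by blast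
    ultimately show ?thesis
      using ch(2,9) yW y(1) p(1) by (intro exI[of _ "\<psi> \<circ> linepath (\<phi> p) (\<phi> y)"]) (auto simp: pathstart_compose pathfinish_compose)
  qed
  then show ?thesis using d(1) by blast
qed

lemma locally_constant_on_hypersurface:
  fixes S :: "'a::euclidean_space set" and F :: "'a \<Rightarrow> 'c::euclidean_space"
  assumes S: "smooth_hypersurface S" and q: "q \<in> S" "open N" "q \<in> N" and F: "smooth_on N F"
    and zero: "\<And>x v. x \<in> S \<inter> N \<Longrightarrow> v \<in> tangent_space S x \<Longrightarrow> D F x v = 0"
  shows "\<exists>e>0. \<forall>x\<in>S. dist x q < e \<longrightarrow> F x = F q"
proof -
  obtain W V :: "'a set" and \<phi> \<psi> :: "'a \<Rightarrow> 'a" where ch: "open W" "q \<in> W" "W \<subseteq> N" "open V" "convex V"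
    "smooth_on V \<psi>" "\<phi> ` W \<subseteq> V" "\<And>y. y \<in> V \<Longrightarrow> \<psi> y \<in> S \<inter> W" "\<And>x. x \<in> S \<inter> W \<Longrightarrow> \<psi> (\<phi> x) = x"
    "\<And>y v. y \<in> V \<Longrightarrow> D \<psi> y v \<in> tangent_space S (\<psi> y)"
    by (rule hypersurface_chart_within[OF S q]) auto
  have "((\<lambda>y. F (\<psi> y)) has_derivative (\<lambda>v. 0)) (at y within V)" if y: "y \<in> V" for y
  proof -
    have d\<psi>: "(\<psi> has_derivative D \<psi> y) (at y)" by (rule smooth_on_has_derivative[OF ch(6) y])
    have "(F has_derivative D F (\<psi> y)) (at (\<psi> y))"
      using smooth_on_has_derivative[OF F] ch(3) ch(8)[OF y] by blast
    from diff_chain_at[OF d\<psi> this] have "((\<lambda>y. F (\<psi> y)) has_derivative (\<lambda>v. D F (\<psi> y) (D \<psi> y v))) (at y)"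
      by (simp add: o_def)
    moreover have "D F (\<psi> y) (D \<psi> y v) = 0" for v
      using zero[OF _ ch(10)[OF y]] ch(3) ch(8)[OF y] by blast
    ultimately show ?thesis by (simp add: has_derivative_at_withinI)
  qed
  from has_derivative_zero_unique[OF ch(5) this]
  have const: "F (\<psi> y) = F (\<psi> y')" if "y \<in> V" "y' \<in> V" for y y' using that by blast
  obtain e where e: "e > 0" "ball q e \<subseteq> W" using openE[OF ch(1,2)] .
  have "F x = F q" if "x \<in> S" "dist x q < e" for x
  proof -
    have x: "x \<in> W" using that e(2) by (auto simp: dist_commute subset_iff)
    then have "\<phi> x \<in> V" "\<phi> q \<in> V" using ch(2,7) by auto
    from const[OF this] show ?thesis using ch(9) x that(1) q(1) ch(2) by simp
  qed
  then show ?thesis using e(1) by blast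
qed

text \<open>The pullback of the form by the parametrization is closed on a convex open set: the terms with second
derivatives of \<open>\<psi>\<close> are symmetric, and the others only involve tangent vectors of \<open>S\<close>. Its primitive is carried
back to the ambient space by \<open>\<phi>\<close>.\<close>

lemma closed_form_locally_exact:
  fixes S :: "'a::euclidean_space set" and \<eta> :: "'a \<Rightarrow> 'a \<Rightarrow> 'c::euclidean_space"
  assumes S: "smooth_hypersurface S" and lin: "\<And>p. p \<in> S \<Longrightarrow> linear (\<eta> p)"
    and sm: "\<And>v. smooth_on_surface S (\<lambda>x. \<eta> x v)"
    and cl: "\<And>p v w. p \<in> S \<Longrightarrow> v \<in> tangent_space S p \<Longrightarrow> w \<in> tangent_space S p \<Longrightarrow>
      surface_diff S (\<lambda>x. \<eta> x w) p v = surface_diff S (\<lambda>x. \<eta> x v) p w"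
    and p: "p \<in> S"
  obtains W F where "open W" "p \<in> W" "smooth_on W F"
    "\<And>x v. x \<in> S \<inter> W \<Longrightarrow> v \<in> tangent_space S x \<Longrightarrow> D F x v = \<eta> x v"
proof -
  have "\<exists>U F. open U \<and> p \<in> U \<and> smooth_on U F \<and> (\<forall>x\<in>S \<inter> U. F x = \<eta> x b)" for b
    using sm[of b] p unfolding smooth_on_surface_def by blast
  then obtain U a where U: "\<And>b. open (U b)" "\<And>b. p \<in> U b" "\<And>b. smooth_on (U b) (a b)"
    "\<And>b x. x \<in> S \<inter> U b \<Longrightarrow> a b x = \<eta> x b" by metis
  define N where "N = (\<Inter>b\<in>Basis. U b)"
  have N: "open N" "p \<in> N" using U by (auto simp: N_def)
  have NU: "N \<subseteq> U b" if "b \<in> Basis" for b using that by (auto simp: N_def)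
  have sa: "smooth_on N (a b)" if "b \<in> Basis" for b using smooth_on_subset[OF U(3) NU[OF that]] .
  have da: "(a b has_derivative D (a b) x) (at x)" if "x \<in> N" "b \<in> Basis" for x b
    using smooth_on_has_derivative[OF sa[OF that(2)] that(1)] .
  have a\<eta>: "one_form a x v = \<eta> x v" if "x \<in> S \<inter> N" for x v
  proof (rule one_form_linear_eq)
    show "linear (\<eta> x)" using lin that by blast
    show "\<eta> x b = a b x" if "b \<in> Basis" for b
      using U(4)[of x b] NU[OF that] \<open>x \<in> S \<inter> N\<close> by auto
  qed
  have sym: "one_form_deriv a x v w = one_form_deriv a x w v"
    if x: "x \<in> S \<inter> N" and vw: "v \<in> tangent_space S x" "w \<in> tangent_space S x" for x v w
  proof -
    have "surface_diff S (\<lambda>x. \<eta> x w) x v = one_form_deriv a x v w" if "v \<in> tangent_space S x" for v w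
    proof -
      have "((\<lambda>y. one_form a y w) has_derivative (\<lambda>v. one_form_deriv a x v w + one_form a x 0)) (at x)"
        by (rule has_derivative_one_form[where l = "\<lambda>y. y" and m = "\<lambda>y. w", OF da]) (use x in auto)
      from surface_diff_extension[OF _ N(1) _ _ this that, of "\<lambda>x. \<eta> x w"] show ?thesis
        using x a\<eta> linear_0[OF lin[of x]] by simp
    qed
    then show ?thesis using cl[OF _ vw] x vw by auto
  qed
  obtain W V :: "'a set" and \<phi> \<psi> :: "'a \<Rightarrow> 'a" where ch: "open W" "p \<in> W" "W \<subseteq> N" "open V" "convex V"
    "smooth_on W \<phi>" "smooth_on V \<psi>" "\<phi> ` W \<subseteq> V" "\<And>y. y \<in> V \<Longrightarrow> \<psi> y \<in> S \<inter> W"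
    "\<And>x. x \<in> S \<inter> W \<Longrightarrow> \<psi> (\<phi> x) = x"
    "\<And>x v. x \<in> S \<inter> W \<Longrightarrow> v \<in> tangent_space S x \<Longrightarrow> D \<psi> (\<phi> x) (D \<phi> x v) = v"
    "\<And>y v. y \<in> V \<Longrightarrow> D \<psi> y v \<in> tangent_space S (\<psi> y)"
    by (rule hypersurface_chart_within[OF S p N]) blast
  define c where "c b y = one_form a (\<psi> y) (D \<psi> y b)" for b y
  have \<psi>N: "\<psi> y \<in> S \<inter> N" if "y \<in> V" for y using ch(3) ch(9)[OF that] by blast
  have d\<psi>: "(\<psi> has_derivative D \<psi> y) (at y)" if "y \<in> V" for y by (rule smooth_on_has_derivative[OF ch(7) that])
  have cform: "one_form c y v = one_form a (\<psi> y) (D \<psi> y v)" if "y \<in> V" for y v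
    by (rule one_form_linear_eq[OF linear_compose[OF has_derivative_linear[OF d\<psi>[OF that]] linear_one_form, unfolded o_def]])
      (simp add: c_def)
  have sc: "smooth_on V (c b)" for b
    unfolding c_def one_form_def using ch(4,7) \<psi>N
    by (intro smooth_on_sum smooth_on_scaleR smooth_on_inner smooth_on_D smooth_on_const smooth_on_compose[OF _ _ sa]) auto
  have dc: "D (c b) y v = one_form_deriv a (\<psi> y) (D \<psi> y v) (D \<psi> y b) + one_form a (\<psi> y) (D (\<lambda>y. D \<psi> y b) y v)"
    if y: "y \<in> V" for b y v
  proof -
    have "(c b has_derivative (\<lambda>v. one_form_deriv a (\<psi> y) (D \<psi> y v) (D \<psi> y b)
         + one_form a (\<psi> y) (D (\<lambda>y. D \<psi> y b) y v))) (at y)"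
      unfolding c_def[abs_def]
      by (rule has_derivative_one_form[OF da d\<psi>[OF y] smooth_on_has_derivative[OF smooth_on_D[OF ch(7)] y]])
        (use \<psi>N[OF y] in auto)
    then show ?thesis by (rule fun_cong[OF D_eq])
  qed
  have "D (c b) y b' = D (c b') y b" if y: "y \<in> V" for y b b'
    using sym[OF \<psi>N[OF y] ch(12)[OF y, of b'] ch(12)[OF y, of b]]
      second_derivative_symmetric[OF ch(4,7) y, of b b'] by (simp only: dc[OF y])
  then obtain G where G: "\<And>y. y \<in> V \<Longrightarrow> (G has_derivative one_form c y) (at y)"
    using poincare_convex[of V c, OF ch(4,5) sc] by blast
  have sG: "smooth_on V G"
  proof (rule smooth_onI[OF ch(4) G])
    show "smooth_on V (\<lambda>y. one_form c y v)" for v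
      unfolding one_form_def by (intro smooth_on_sum smooth_on_scaleR smooth_on_const sc ch(4)) auto
  qed
  show ?thesis
  proof (rule that[OF ch(1,2)])
    show "smooth_on W (\<lambda>x. G (\<phi> x))" by (rule smooth_on_compose[OF ch(1,6) sG ch(8)])
    fix x v assume x: "x \<in> S \<inter> W" and v: "v \<in> tangent_space S x"
    have \<phi>x: "\<phi> x \<in> V" using ch(8) x by auto
    have "((\<lambda>x. G (\<phi> x)) has_derivative (\<lambda>v. one_form c (\<phi> x) (D \<phi> x v))) (at x)"
      using diff_chain_at[OF smooth_on_has_derivative[OF ch(6)] G[OF \<phi>x]] x by (simp add: o_def)
    then have "D (\<lambda>x. G (\<phi> x)) x v = one_form c (\<phi> x) (D \<phi> x v)" by (rule fun_cong[OF D_eq])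
    also have "\<dots> = one_form a x v" using cform[OF \<phi>x] ch(10,11) x v by simp
    also have "\<dots> = \<eta> x v" using a\<eta> x ch(3) by blast
    finally show "D (\<lambda>x. G (\<phi> x)) x v = \<eta> x v" .
  qed
qed

theorem closed_form_exact:
  fixes S :: "'a::euclidean_space set" and \<eta> :: "'a \<Rightarrow> 'a \<Rightarrow> 'c::euclidean_space"
  assumes S: "smooth_hypersurface S" "simply_connected S" and lin: "\<And>p. p \<in> S \<Longrightarrow> linear (\<eta> p)"
    and sm: "\<And>v. smooth_on_surface S (\<lambda>x. \<eta> x v)"
    and cl: "\<And>p v w. p \<in> S \<Longrightarrow> v \<in> tangent_space S p \<Longrightarrow> w \<in> tangent_space S p \<Longrightarrow>
      surface_diff S (\<lambda>x. \<eta> x w) p v = surface_diff S (\<lambda>x. \<eta> x v) p w"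
  obtains f where "smooth_on_surface S f"
    "\<And>p v. p \<in> S \<Longrightarrow> v \<in> tangent_space S p \<Longrightarrow> surface_diff S f p v = \<eta> p v"
proof -
  have "\<exists>W F. p \<in> S \<longrightarrow> open W \<and> p \<in> W \<and> smooth_on W F \<and>
      (\<forall>x\<in>S \<inter> W. \<forall>v\<in>tangent_space S x. D F x v = \<eta> x v)" for p
  proof (cases "p \<in> S")
    case True
    show ?thesis by (rule closed_form_locally_exact[OF S(1) lin sm cl True]) blast+
  qed simp
  then obtain W g where Wg: "\<And>p. p \<in> S \<Longrightarrow> open (W p)" "\<And>p. p \<in> S \<Longrightarrow> p \<in> W p"
    "\<And>p. p \<in> S \<Longrightarrow> smooth_on (W p) (g p)"
    "\<And>p x v. p \<in> S \<Longrightarrow> x \<in> S \<inter> W p \<Longrightarrow> v \<in> tangent_space S x \<Longrightarrow> D (g p) x v = \<eta> x v"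
    by metis
  have "compatible_germs g S"
    unfolding compatible_germs_def
  proof
    fix p assume p: "p \<in> S"
    obtain e where e: "e > 0" "ball p e \<subseteq> W p" using openE[OF Wg(1,2)[OF p]] .
    have "\<exists>e'>0. \<forall>x\<in>S. dist x q < e' \<longrightarrow> g p x - g p q = g q x - g q q" if q: "q \<in> S" "dist q p < e" for q
    proof -
      let ?N = "W p \<inter> W q"
      have N: "open ?N" "q \<in> ?N" using Wg p q e(2) by (auto simp: dist_commute subset_iff)
      have 1: "smooth_on ?N (g p)" "smooth_on ?N (g q)"
        using Wg(3) p q by (auto intro: smooth_on_subset)
      have 2: "smooth_on ?N (\<lambda>x. g p x - g q x)" by (rule smooth_on_diff[OF N(1) 1])
      have "D (\<lambda>x. g p x - g q x) x v = 0" if x: "x \<in> S \<inter> ?N" and v: "v \<in> tangent_space S x" for x v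
      proof -
        have "((\<lambda>x. g p x - g q x) has_derivative (\<lambda>v. D (g p) x v - D (g q) x v)) (at x)"
          using x by (intro has_derivative_diff smooth_on_has_derivative[OF 1(1)] smooth_on_has_derivative[OF 1(2)]) auto
        then have "D (\<lambda>x. g p x - g q x) x v = D (g p) x v - D (g q) x v" by (rule fun_cong[OF D_eq])
        then show ?thesis using Wg(4)[OF p _ v] Wg(4)[OF q(1) _ v] x by simp
      qed
      from locally_constant_on_hypersurface[OF S(1) q(1) N 2 this]
      obtain e' where "e' > 0" "\<forall>x\<in>S. dist x q < e' \<longrightarrow> g p x - g q x = g p q - g q q" by blast
      then show ?thesis by (intro exI[of _ e']) (auto simp: algebra_simps)
    qed
    then show "\<exists>e>0. \<forall>q\<in>S. dist q p < e \<longrightarrow> (\<exists>e'>0. \<forall>x\<in>S. dist x q < e' \<longrightarrow> g p x - g p q = g q x - g q q)"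
      using e(1) by blast
  qed
  then obtain f where f: "\<And>x. x \<in> S \<Longrightarrow> \<exists>\<epsilon>>0. \<forall>y\<in>S. dist y x < \<epsilon> \<longrightarrow> f y - f x = g x y - g x x"
    using monodromy[OF S(2) hypersurface_locally_path_connected[OF S(1)]] by blast
  have ext: "\<exists>U F. open U \<and> p \<in> U \<and> smooth_on U F \<and> (\<forall>x\<in>S \<inter> U. F x = f x) \<and>
      (\<forall>v\<in>tangent_space S p. D F p v = \<eta> p v)" if p: "p \<in> S" for p
  proof -
    obtain \<epsilon> where \<epsilon>: "\<epsilon> > 0" "\<And>y. y \<in> S \<Longrightarrow> dist y p < \<epsilon> \<Longrightarrow> f y - f p = g p y - g p p" using f[OF p] by blast
    let ?U = "W p \<inter> ball p \<epsilon>" and ?F = "\<lambda>y. g p y + (f p - g p p)"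
    have U: "open ?U" "p \<in> ?U" using Wg(1,2)[OF p] \<epsilon>(1) by auto
    have sm: "smooth_on ?U (g p)" using Wg(3)[OF p] by (rule smooth_on_subset) auto
    have "smooth_on ?U ?F" by (intro smooth_on_add smooth_on_const sm U)
    moreover have "?F y = f y" if "y \<in> S \<inter> ?U" for y
      using \<epsilon>(2)[of y] that by (simp add: dist_commute algebra_simps)
    moreover have "D ?F p v = \<eta> p v" if v: "v \<in> tangent_space S p" for v
    proof -
      have "(?F has_derivative (\<lambda>v. D (g p) p v)) (at p)"
        using has_derivative_add_const[OF smooth_on_has_derivative[OF sm U(2)]] .
      then have "D ?F p = D (g p) p" by (rule D_eq)
      then show ?thesis using Wg(4)[OF p _ v] Wg(2)[OF p] p by simp
    qed
    ultimately show ?thesis using U by blast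
  qed
  show ?thesis
  proof (rule that)
    show "smooth_on_surface S f" unfolding smooth_on_surface_def using ext by blast
    fix p v assume p: "p \<in> S" and v: "v \<in> tangent_space S p"
    obtain U F where U: "open U" "p \<in> U" "smooth_on U F" "\<forall>x\<in>S \<inter> U. F x = f x" "\<forall>v\<in>tangent_space S p. D F p v = \<eta> p v"
      using ext[OF p] by blast
    have "surface_diff S f p v = D F p v"
      by (rule surface_diff_extension[OF p U(1,2) _ smooth_on_has_derivative[OF U(3,2)] v]) (use U in auto)
    then show "surface_diff S f p v = \<eta> p v" using U(5) v by simp
  qed
qed

section \<open>Functions on a hypersurface and complex notation\<close>

text \<open>The complex bilinear (not Hermitian) product, which pairs covectors with vectors.\<close>

definition cdot :: "C2 \<Rightarrow> C2 \<Rightarrow> complex" where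
  "cdot a v = fst a * fst v + snd a * snd v"

definition wirtinger :: "(C2 \<Rightarrow> real) \<Rightarrow> C2 \<Rightarrow> C2" where
  "wirtinger \<rho> x = (wirtinger1 \<rho> x, wirtinger2 \<rho> x)"

lemma cdot_simps:
  "cdot a (v + v') = cdot a v + cdot a v'" "cdot a (v - v') = cdot a v - cdot a v'"
  "cdot a (- v) = - cdot a v" "cdot a (r *\<^sub>R v) = of_real r * cdot a v" "cdot a (J v) = \<i> * cdot a v"
  "cdot a 0 = 0"
  by (simp_all add: cdot_def J_def scaleR_conv_of_real algebra_simps)

lemma J_simps: "J (u + v) = J u + J v" "J (- u) = - J u" "J (u - v) = J u - J v" "J (r *\<^sub>R u) = r *\<^sub>R J u"
    "J (J u) = - u" "J 0 = 0"
  by (auto simp: J_def algebra_simps scaleR_conv_of_real prod_eq_iff)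

text \<open>A real differential is twice the real part of its \<open>(1,0)\<close>-part.\<close>

lemma real_derivative_wirtinger:
  assumes "linear (D \<rho> x)"
  shows "D \<rho> x v = 2 * Re (cdot (wirtinger \<rho> x) v)"
proof -
  have v: "v = Re (fst v) *\<^sub>R (1, 0) + Im (fst v) *\<^sub>R (\<i>, 0) + Re (snd v) *\<^sub>R (0, 1) + Im (snd v) *\<^sub>R (0, \<i>)"
    by (simp add: prod_eq_iff complex_eq_iff)
  have "D \<rho> x v = Re (fst v) * D \<rho> x (1, 0) + Im (fst v) * D \<rho> x (\<i>, 0)
      + Re (snd v) * D \<rho> x (0, 1) + Im (snd v) * D \<rho> x (0, \<i>)"
    by (subst v) (simp only: linear_add[OF assms] linear_cmul[OF assms] real_scaleR_def)
  then show ?thesis by (simp add: cdot_def wirtinger_def wirtinger1_def wirtinger2_def field_simps)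
qed

lemma smooth_on_wirtinger:
  assumes "open U" "smooth_on U \<rho>"
  shows "smooth_on U (wirtinger1 \<rho>)" "smooth_on U (wirtinger2 \<rho>)"
proof -
  have s: "smooth_on U (\<lambda>x. of_real (D \<rho> x v) :: complex)" for v
    by (rule smooth_on_bounded_linear[OF assms(1) bounded_linear_of_real smooth_on_D[OF assms(2)]])
  have "smooth_on U (\<lambda>x. (of_real (D \<rho> x v) - \<i> * of_real (D \<rho> x v')) / 2)" for v v'
    by (intro smooth_on_divide smooth_on_diff smooth_on_mult smooth_on_const s assms) auto
  then show "smooth_on U (wirtinger1 \<rho>)" "smooth_on U (wirtinger2 \<rho>)"
    unfolding wirtinger1_def[abs_def] wirtinger2_def[abs_def] by blast+
qed

text \<open>Functions on \<open>S\<close> are differentiated through smooth functions on ambient open sets.\<close>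

definition extends :: "'a::euclidean_space set \<Rightarrow> 'a set \<Rightarrow> ('a \<Rightarrow> 'b::real_normed_vector) \<Rightarrow> ('a \<Rightarrow> 'b) \<Rightarrow> bool" where
  "extends S N F f \<longleftrightarrow> open N \<and> smooth_on N F \<and> (\<forall>x\<in>S \<inter> N. F x = f x)"

lemma extendsD:
  assumes "extends S N F f"
  shows "open N" "smooth_on N F" "x \<in> S \<Longrightarrow> x \<in> N \<Longrightarrow> F x = f x"
    "x \<in> N \<Longrightarrow> (F has_derivative D F x) (at x)"
  using assms smooth_on_has_derivative unfolding extends_def by blast+

lemma extends_surface_diff:
  assumes E: "extends S N F f" and x: "x \<in> S" "x \<in> N" "v \<in> tangent_space S x"
  shows "surface_diff S f x v = D F x v"
  by (rule surface_diff_extension[OF x(1) extendsD(1)[OF E] x(2) _ extendsD(4)[OF E x(2)] x(3)])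
    (use extendsD(3)[OF E] in auto)

lemma extends_subset: "extends S N F f \<Longrightarrow> open N' \<Longrightarrow> N' \<subseteq> N \<Longrightarrow> extends S N' F f"
  unfolding extends_def by (blast intro: smooth_on_subset)

lemma extends_exists:
  assumes "smooth_on_surface S f" "p \<in> S" obtains N F where "p \<in> N" "extends S N F f"
  using assms unfolding smooth_on_surface_def extends_def by metis

lemma smooth_on_surfaceI:
  "(\<And>p. p \<in> S \<Longrightarrow> \<exists>N F. p \<in> N \<and> extends S N F f) \<Longrightarrow> smooth_on_surface S f"
  unfolding smooth_on_surface_def extends_def by blast

lemma extends_exists2:
  assumes "smooth_on_surface S f" "smooth_on_surface S g" "p \<in> S"
  obtains N F G where "p \<in> N" "extends S N F f" "extends S N G g"
proof -
  obtain M F where M: "p \<in> M" "extends S M F f" using extends_exists[OF assms(1,3)] .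
  obtain N G where N: "p \<in> N" "extends S N G g" using extends_exists[OF assms(2,3)] .
  have o: "open (M \<inter> N)" using extendsD(1)[OF M(2)] extendsD(1)[OF N(2)] by auto
  show ?thesis
    by (rule that[of "M \<inter> N" F G]) (use M N o in \<open>auto intro: extends_subset\<close>)
qed

lemma smooth_on_surface_global: "smooth_on UNIV F \<Longrightarrow> smooth_on_surface S F"
  unfolding smooth_on_surface_def by blast

lemma smooth_on_surface_bilinear:
  assumes h: "bounded_bilinear h" and f: "smooth_on_surface S f" and g: "smooth_on_surface S g"
  shows "smooth_on_surface S (\<lambda>x. h (f x) (g x))"
    and "p \<in> S \<Longrightarrow> v \<in> tangent_space S p \<Longrightarrow>
      surface_diff S (\<lambda>x. h (f x) (g x)) p v = h (f p) (surface_diff S g p v) + h (surface_diff S f p v) (g p)"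
proof -
  have E: "extends S N (\<lambda>x. h (F x) (G x)) (\<lambda>x. h (f x) (g x))" if "extends S N F f" "extends S N G g" for N F G
    using that smooth_on_bilinear[OF h, of N F G] unfolding extends_def by auto
  show "smooth_on_surface S (\<lambda>x. h (f x) (g x))"
    by (rule smooth_on_surfaceI) (metis E extends_exists2[OF f g])
  assume p: "p \<in> S" and v: "v \<in> tangent_space S p"
  obtain N F G where N: "p \<in> N" "extends S N F f" "extends S N G g" using extends_exists2[OF f g p] .
  have "surface_diff S (\<lambda>x. h (f x) (g x)) p v = D (\<lambda>x. h (F x) (G x)) p v"
    by (rule extends_surface_diff[OF E[OF N(2,3)] p N(1) v])
  also have "\<dots> = h (F p) (D G p v) + h (D F p v) (G p)"
    by (rule fun_cong[OF D_eq], rule bounded_bilinear.FDERIV[OF h extendsD(4)[OF N(2,1)] extendsD(4)[OF N(3,1)]])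
  finally show "surface_diff S (\<lambda>x. h (f x) (g x)) p v = h (f p) (surface_diff S g p v) + h (surface_diff S f p v) (g p)"
    using extends_surface_diff[OF N(2) p N(1) v] extends_surface_diff[OF N(3) p N(1) v]
      extendsD(3)[OF N(2) p N(1)] extendsD(3)[OF N(3) p N(1)] by simp
qed

lemmas surface_diff_mult = smooth_on_surface_bilinear(2)[OF bounded_bilinear_mult]
lemmas smooth_on_surface_mult = smooth_on_surface_bilinear(1)[OF bounded_bilinear_mult]

lemma smooth_on_surface_linear:
  assumes h: "bounded_linear h" and f: "smooth_on_surface S f"
  shows "smooth_on_surface S (\<lambda>x. h (f x))"
    and "p \<in> S \<Longrightarrow> v \<in> tangent_space S p \<Longrightarrow> surface_diff S (\<lambda>x. h (f x)) p v = h (surface_diff S f p v)"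
proof -
  have E: "extends S N (\<lambda>x. h (F x)) (\<lambda>x. h (f x))" if "extends S N F f" for N F
    using that smooth_on_bounded_linear[OF _ h, of N F] unfolding extends_def by auto
  show "smooth_on_surface S (\<lambda>x. h (f x))"
    by (rule smooth_on_surfaceI) (metis E extends_exists[OF f])
  assume p: "p \<in> S" and v: "v \<in> tangent_space S p"
  obtain N F where N: "p \<in> N" "extends S N F f" using extends_exists[OF f p] .
  show "surface_diff S (\<lambda>x. h (f x)) p v = h (surface_diff S f p v)"
    unfolding extends_surface_diff[OF E[OF N(2)] p N(1) v] extends_surface_diff[OF N(2) p N(1) v]
      D_bounded_linear_compose[OF h extendsD(4)[OF N(2,1)]] ..
qed

lemma smooth_on_surface_add:
  assumes f: "smooth_on_surface S f" and g: "smooth_on_surface S g"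
  shows "smooth_on_surface S (\<lambda>x. f x + g x)"
    and "p \<in> S \<Longrightarrow> v \<in> tangent_space S p \<Longrightarrow>
      surface_diff S (\<lambda>x. f x + g x) p v = surface_diff S f p v + surface_diff S g p v"
proof -
  have E: "extends S N (\<lambda>x. F x + G x) (\<lambda>x. f x + g x)" if "extends S N F f" "extends S N G g" for N F G
    using that smooth_on_add[of N F G] unfolding extends_def by auto
  show "smooth_on_surface S (\<lambda>x. f x + g x)"
    by (rule smooth_on_surfaceI) (metis E extends_exists2[OF f g])
  assume p: "p \<in> S" and v: "v \<in> tangent_space S p"
  obtain N F G where N: "p \<in> N" "extends S N F f" "extends S N G g" using extends_exists2[OF f g p] .
  have "surface_diff S (\<lambda>x. f x + g x) p v = D (\<lambda>x. F x + G x) p v"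
    by (rule extends_surface_diff[OF E[OF N(2,3)] p N(1) v])
  also have "\<dots> = D F p v + D G p v"
    by (rule fun_cong[OF D_eq], rule has_derivative_add[OF extendsD(4)[OF N(2,1)] extendsD(4)[OF N(3,1)]])
  finally show "surface_diff S (\<lambda>x. f x + g x) p v = surface_diff S f p v + surface_diff S g p v"
    using extends_surface_diff[OF N(2) p N(1) v] extends_surface_diff[OF N(3) p N(1) v] by simp
qed

lemma surface_diff_linear:
  fixes S :: "'a::euclidean_space set"
  assumes f: "smooth_on_surface S f" and p: "p \<in> S" and S: "smooth_hypersurface S"
    and u: "u \<in> tangent_space S p" and v: "v \<in> tangent_space S p"
  shows "r *\<^sub>R u + s *\<^sub>R v \<in> tangent_space S p"
    and "surface_diff S f p (r *\<^sub>R u + s *\<^sub>R v) = r *\<^sub>R surface_diff S f p u + s *\<^sub>R surface_diff S f p v"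
proof -
  obtain U \<rho> where U: "p \<in> U" "local_defining_function S U \<rho>"
    using S p unfolding smooth_hypersurface_def by blast
  have "linear (D \<rho> p)"
    using smooth_on_has_derivative[OF local_defining_functionD(2)[OF U(2)] U(1)] by (rule has_derivative_linear)
  then show t: "r *\<^sub>R u + s *\<^sub>R v \<in> tangent_space S p"
    using u v unfolding tangent_space_iff[OF U(2) p U(1)] by (simp add: linear_add linear_cmul)
  obtain N F where N: "p \<in> N" "extends S N F f" using extends_exists[OF f p] .
  have "linear (D F p)" using extendsD(4)[OF N(2,1)] by (rule has_derivative_linear)
  then show "surface_diff S f p (r *\<^sub>R u + s *\<^sub>R v) = r *\<^sub>R surface_diff S f p u + s *\<^sub>R surface_diff S f p v"
    using extends_surface_diff[OF N(2) p N(1)] t u v by (simp add: linear_add linear_cmul)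
qed

lemma surface_diff_cong:
  fixes S :: "'a::euclidean_space set"
  assumes f: "smooth_on_surface S f" and eq: "\<And>x. x \<in> S \<Longrightarrow> f x = g x" and p: "p \<in> S" "v \<in> tangent_space S p"
  shows "surface_diff S f p v = surface_diff S g p v"
proof -
  obtain N F where N: "p \<in> N" "extends S N F f" using extends_exists[OF f p(1)] .
  then have "extends S N F g" using eq by (auto simp: extends_def)
  then show ?thesis
    using extends_surface_diff[OF N(2) p(1) N(1) p(2)] extends_surface_diff[of S N F g, OF _ p(1) N(1) p(2)] by simp
qed

section \<open>Projective maps\<close>

definition cmul :: "complex \<Rightarrow> C2 \<Rightarrow> C2" where
  "cmul c v = (c * fst v, c * snd v)"

lemma cmul_simps: "cmul c (u + v) = cmul c u + cmul c v" "cmul (c + d) v = cmul c v + cmul d v"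
  "cmul c (cmul d v) = cmul (c * d) v" "cmul 1 v = v" "cmul 0 v = 0" "cmul c 0 = 0" "cdot a (cmul c v) = c * cdot a v"
  "cdot (cmul c a) v = c * cdot a v"
  by (simp_all add: cmul_def cdot_def algebra_simps zero_prod_def prod_eq_iff)

lemma cmul_decompose: "cmul c v = Re c *\<^sub>R v + Im c *\<^sub>R J v"
  by (simp add: cmul_def J_def prod_eq_iff complex_eq_iff)

lemma cmul_eq_0: "cmul c v = 0 \<longleftrightarrow> c = 0 \<or> v = 0"
  by (auto simp: cmul_def zero_prod_def prod_eq_iff)

lemma bounded_linear_cdot_left: "bounded_linear (\<lambda>a. cdot a v)"
  by (simp add: linear_conv_bounded_linear[symmetric] linearI cdot_def scaleR_conv_of_real algebra_simps)

lemma tangent_space_wirtinger: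
  assumes ld: "local_defining_function S U \<rho>" and p: "p \<in> S" "p \<in> U"
  shows "v \<in> tangent_space S p \<longleftrightarrow> Re (cdot (wirtinger \<rho> p) v) = 0"
proof -
  have "linear (D \<rho> p)"
    using smooth_on_has_derivative[OF local_defining_functionD(2)[OF ld] p(2)] by (rule has_derivative_linear)
  then show ?thesis using tangent_space_iff[OF ld p] real_derivative_wirtinger[of \<rho> p v] by simp
qed

text \<open>The complex tangent space is the kernel of \<open>\<partial>\<rho>\<close>: both \<open>v\<close> and \<open>J v\<close> are tangent iff real and imaginary part
of the pairing vanish.\<close>

lemma complex_tangent_space_wirtinger:
  assumes ld: "local_defining_function S U \<rho>" and p: "p \<in> S" "p \<in> U"
  shows "v \<in> complex_tangent_space S p \<longleftrightarrow> cdot (wirtinger \<rho> p) v = 0"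
proof -
  have "v \<in> J ` tangent_space S p \<longleftrightarrow> - J v \<in> tangent_space S p"
    by (metis J_simps(2,5) add.inverse_inverse image_iff)
  then show ?thesis
    unfolding complex_tangent_space_def using tangent_space_wirtinger[OF ld p]
    by (auto simp: cdot_simps complex_eq_iff)
qed

lemma homog_image_nth: "homog_image A z $ i = A $ i $ 1 + A $ i $ 2 * fst z + A $ i $ 3 * snd z"
  by (simp add: homog_image_def matrix_vector_mult_def sum_3 vector_3)

lemma matrix_vector_homogeneous: "(A *v vector [0, fst v, snd v]) $ i = A $ i $ 2 * fst v + A $ i $ 3 * snd v"
  for A :: "complex^3^3"
  by (simp add: matrix_vector_mult_def sum_3 vector_3)

lemma projective_map_homog:
  assumes "homog_image A z $ 1 \<noteq> 0"
  shows "homog_image A z = homog_image A z $ 1 *s vector [1, fst (projective_map A z), snd (projective_map A z)]"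
  using assms by (simp add: vec_eq_iff forall_3 projective_map_def vector_3)

lemma invertible_cancel:
  fixes A :: "complex^3^3"
  assumes "invertible A" "A *v x = A *v y" shows "x = y"
  using assms unfolding invertible_def by (metis matrix_vector_mul_assoc matrix_vector_mul_lid)

lemma projective_map_inj:
  assumes A: "invertible A" and h: "homog_image A z $ 1 \<noteq> 0" "homog_image A z' $ 1 \<noteq> 0"
    and eq: "projective_map A z = projective_map A z'"
  shows "z = z'"
proof -
  define c where "c = homog_image A z' $ 1 / homog_image A z $ 1"
  have "homog_image A z' = c *s homog_image A z"
    using projective_map_homog[OF h(1)] projective_map_homog[OF h(2)] eq h
    by (metis (no_types, lifting) c_def nonzero_mult_div_cancel_right times_divide_eq_left vector_smult_assoc)
  then have "A *v vector [1, fst z', snd z'] = A *v (c *s vector [1, fst z, snd z])"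
    by (simp add: homog_image_def vector_scalar_commute)
  from invertible_cancel[OF A this] have e: "vector [1, fst z', snd z'] = c *s (vector [1, fst z, snd z] :: complex^3)" .
  then have "c = 1" using vector_3(1)[of 1 "fst z'" "snd z'"] by (simp add: vec_eq_iff forall_3 vector_3)
  then show ?thesis using e by (simp add: vec_eq_iff forall_3 vector_3 prod_eq_iff)
qed

text \<open>The linear part of the affine function that gives a homogeneous coordinate of the image.\<close>

definition hlin :: "complex^3^3 \<Rightarrow> 3 \<Rightarrow> C2 \<Rightarrow> complex" where
  "hlin A i v = A $ i $ 2 * fst v + A $ i $ 3 * snd v"

definition projective_deriv :: "complex^3^3 \<Rightarrow> C2 \<Rightarrow> C2 \<Rightarrow> C2" where
  "projective_deriv A z v =
     cmul (1 / homog_image A z $ 1) ((hlin A 2 v, hlin A 3 v) - cmul (hlin A 1 v) (projective_map A z))"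

lemma homog_image_has_derivative: "((\<lambda>z. homog_image A z $ i) has_derivative hlin A i) (at z)"
  unfolding homog_image_nth hlin_def[abs_def] by (auto intro!: derivative_eq_intros)

lemma projective_map_has_derivative:
  assumes "homog_image A z $ 1 \<noteq> 0"
  shows "(projective_map A has_derivative projective_deriv A z) (at z)"
proof -
  have "((\<lambda>z. homog_image A z $ i / homog_image A z $ 1) has_derivative
      (\<lambda>v. (hlin A i v - hlin A 1 v * (homog_image A z $ i / homog_image A z $ 1)) / homog_image A z $ 1)) (at z)" for i
    by (rule derivative_eq_intros homog_image_has_derivative assms refl | simp add: assms field_simps)+
  then have "((\<lambda>z. (homog_image A z $ 2 / homog_image A z $ 1, homog_image A z $ 3 / homog_image A z $ 1)) has_derivative
    (\<lambda>v. ((hlin A 2 v - hlin A 1 v * (homog_image A z $ 2 / homog_image A z $ 1)) / homog_image A z $ 1,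
          (hlin A 3 v - hlin A 1 v * (homog_image A z $ 3 / homog_image A z $ 1)) / homog_image A z $ 1))) (at z)"
    by (intro has_derivative_Pair)
  then show ?thesis
    unfolding projective_map_def[abs_def] projective_deriv_def[abs_def] by (simp add: cmul_def)
qed

lemma projective_deriv_cmul: "projective_deriv A z (cmul c v) = cmul c (projective_deriv A z v)"
  by (simp add: projective_deriv_def cmul_def hlin_def algebra_simps)

lemma projective_deriv_inj:
  assumes A: "invertible A" and h: "homog_image A z $ 1 \<noteq> 0" and 0: "projective_deriv A z v = 0"
  shows "v = 0"
proof -
  define c where "c = hlin A 1 v / homog_image A z $ 1"
  have "(hlin A 2 v, hlin A 3 v) = cmul (hlin A 1 v) (projective_map A z)"
    using 0 h by (simp add: projective_deriv_def cmul_eq_0)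
  then have "A *v vector [0, fst v, snd v] = c *s homog_image A z"
    using h by (simp add: vec_eq_iff forall_3 matrix_vector_homogeneous c_def projective_map_def cmul_def
        flip: hlin_def)
  then have "A *v vector [0, fst v, snd v] = A *v (c *s vector [1, fst z, snd z])"
    by (simp add: homog_image_def vector_scalar_commute)
  from invertible_cancel[OF A this] show ?thesis by (simp add: vec_eq_iff forall_3 vector_3 prod_eq_iff)
qed

lemma smooth_on_homog_image: "open U \<Longrightarrow> smooth_on U (\<lambda>z. homog_image A z $ i)"
  unfolding homog_image_nth
  by (intro smooth_on_add smooth_on_mult smooth_on_const smooth_on_fst smooth_on_snd smooth_on_ident)

lemma smooth_on_projective_map:
  "open U \<Longrightarrow> (\<And>z. z \<in> U \<Longrightarrow> homog_image A z $ 1 \<noteq> 0) \<Longrightarrow> smooth_on U (projective_map A)"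
  unfolding projective_map_def[abs_def]
  by (intro smooth_on_Pair smooth_on_divide smooth_on_homog_image)

text \<open>A projective map sends complex lines to complex lines, so its acceleration along a line is a complex multiple
of its velocity.\<close>

lemma projective_map_second_derivative:
  assumes U: "open U" "z \<in> U" "\<And>z. z \<in> U \<Longrightarrow> homog_image A z $ 1 \<noteq> 0"
  shows "D (\<lambda>z. D (projective_map A) z v) z v
       = cmul (- 2 * hlin A 1 v / homog_image A z $ 1) (projective_deriv A z v)"
proof -
  have h: "homog_image A z $ 1 \<noteq> 0" using U by blast
  have M: "(projective_map A has_derivative projective_deriv A z) (at z)"
    by (rule projective_map_has_derivative[OF h])
  note M1 = has_derivative_fst[OF M] and M2 = has_derivative_snd[OF M]
  let ?h = "\<lambda>z. homog_image A z $ 1"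
  have quot: "((\<lambda>z. 1 / ?h z * (c - b * q z)) has_derivative
      (\<lambda>w. (- q' w * b - 1 / ?h z * (c - b * q z) * hlin A 1 w) / ?h z)) (at z)"
    if "(q has_derivative q') (at z)" for q q' b c
    by (rule derivative_eq_intros that homog_image_has_derivative h refl | simp add: h field_simps)+
  have "((\<lambda>z. projective_deriv A z v) has_derivative (\<lambda>w.
      ((- fst (projective_deriv A z w) * hlin A 1 v - fst (projective_deriv A z v) * hlin A 1 w) / ?h z,
       (- snd (projective_deriv A z w) * hlin A 1 v - snd (projective_deriv A z v) * hlin A 1 w) / ?h z))) (at z)"
    unfolding projective_deriv_def[of A _ v] cmul_def diff_Pair fst_conv snd_conv
    by (intro has_derivative_Pair quot M1 M2)
  then have "D (\<lambda>z. projective_deriv A z v) z v = cmul (- 2 * hlin A 1 v / ?h z) (projective_deriv A z v)"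
    using D_eq by (fastforce simp: cmul_def algebra_simps)
  moreover have "D (\<lambda>z. D (projective_map A) z v) z = D (\<lambda>z. projective_deriv A z v) z"
    by (rule D_cong[OF U(1,2)]) (metis D_eq U(3) projective_map_has_derivative)
  ultimately show ?thesis by simp
qed

section \<open>The dual map\<close>

text \<open>Only the values on \<open>S\<close> matter for tangential derivatives.\<close>

lemma D_eq_on_surface:
  fixes S :: "'a::euclidean_space set"
  assumes "p \<in> S" "open N" "p \<in> N" "smooth_on N F" "smooth_on N G" "\<And>x. x \<in> S \<inter> N \<Longrightarrow> F x = G x"
    and "v \<in> tangent_space S p"
  shows "D F p v = D G p v"
  using surface_diff_extension[OF assms(1-3,6) smooth_on_has_derivative[OF assms(4,3)] assms(7)]
    surface_diff_extension[OF assms(1-3) refl smooth_on_has_derivative[OF assms(5,3)] assms(7)] by simp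

lemma gradient_inner:
  assumes "linear (D \<rho> x)" shows "gradient \<rho> x \<bullet> w = D \<rho> x w"
  using linear_Basis_expansion[OF assms, of w]
  by (simp add: gradient_def inner_sum_left inner_commute[of w] mult.commute)

text \<open>On tangent vectors the second fundamental form is a multiple of the Hessian of the defining function, because
the derivative of the normalizing factor is paired with \<open>D \<rho> p v = 0\<close>.\<close>

lemma second_fundamental_form_eq:
  fixes \<rho> :: "'a::euclidean_space \<Rightarrow> real"
  assumes U: "open U" "p \<in> U" "smooth_on U \<rho>" and nz: "D \<rho> p v0 \<noteq> 0" and v: "D \<rho> p v = 0"
  obtains c where "second_fundamental_form \<rho> p v v = c * D (\<lambda>x. D \<rho> x v) p v"
proof -
  have lin: "linear (D \<rho> x)" if "x \<in> U" for x
    using smooth_on_has_derivative[OF U(3) that] by (rule has_derivative_linear)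
  have "gradient \<rho> p \<bullet> v0 \<noteq> 0" using gradient_inner[OF lin[OF U(2)]] nz by simp
  then have g0: "gradient \<rho> p \<noteq> 0" by auto
  have sg: "smooth_on U (gradient \<rho>)"
    unfolding gradient_def[abs_def]
    by (intro smooth_on_sum smooth_on_scaleR smooth_on_D smooth_on_const U) auto
  have dg: "(gradient \<rho> has_derivative D (gradient \<rho>) p) (at p)"
    by (rule smooth_on_has_derivative[OF sg U(2)])
  obtain n' where n': "(norm has_derivative n') (at (gradient \<rho> p))"
    using differentiable_norm_at[OF g0] unfolding differentiable_def by blast
  have "((\<lambda>x. norm (gradient \<rho> x)) has_derivative (\<lambda>w. n' (D (gradient \<rho>) p w))) (at p)"
    using diff_chain_at[OF dg n'] by (simp add: o_def)
  then have du: "((\<lambda>x. inverse (norm (gradient \<rho> x))) has_derivative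
      (\<lambda>w. - (inverse (norm (gradient \<rho> p)) * n' (D (gradient \<rho>) p w) * inverse (norm (gradient \<rho> p))))) (at p)"
    using g0 by (intro Deriv.has_derivative_inverse) auto
  from has_derivative_scaleR[OF du dg]
  have dn: "(unit_normal \<rho> has_derivative D (unit_normal \<rho>) p) (at p)"
    unfolding unit_normal_def[abs_def] using differentiableI frechet_derivative_works by blast
  have "((\<lambda>x. unit_normal \<rho> x \<bullet> v) has_derivative (\<lambda>w. D (unit_normal \<rho>) p w \<bullet> v)) (at p)"
    by (rule has_derivative_inner_left[OF dn])
  moreover have "unit_normal \<rho> x \<bullet> v = inverse (norm (gradient \<rho> x)) * D \<rho> x v" if "x \<in> U" for x
    using gradient_inner[OF lin[OF that]] by (simp add: unit_normal_def)
  ultimately have 1: "((\<lambda>x. inverse (norm (gradient \<rho> x)) * D \<rho> x v) has_derivative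
      (\<lambda>w. D (unit_normal \<rho>) p w \<bullet> v)) (at p)"
    by (rule has_derivative_transform_within_open[OF _ U(1,2)])
  have "((\<lambda>x. D \<rho> x v) has_derivative D (\<lambda>x. D \<rho> x v) p) (at p)"
    by (rule smooth_on_has_derivative[OF smooth_on_D[OF U(3)] U(2)])
  from has_derivative_unique[OF 1 has_derivative_mult[OF du this]]
  have "D (unit_normal \<rho>) p v \<bullet> v = inverse (norm (gradient \<rho> p)) * D (\<lambda>x. D \<rho> x v) p v"
    using v by (auto simp: fun_eq_iff)
  then show ?thesis by (intro that) (simp only: second_fundamental_form_def)
qed

locale star_hypersurface =
  fixes S :: "C2 set"
  assumes smooth: "smooth_hypersurface S"
    and off: "\<forall>p\<in>S. 0 \<notin> complex_tangent_hyperplane S p"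
begin

lemma defining_functionE:
  assumes "p \<in> S" obtains U \<rho> where "p \<in> U" "local_defining_function S U \<rho>"
  using smooth assms unfolding smooth_hypersurface_def by blast

lemma wirtinger_pairing_nonzero:
  assumes "local_defining_function S U \<rho>" "p \<in> S" "p \<in> U"
  shows "cdot (wirtinger \<rho> p) p \<noteq> 0"
proof
  assume "cdot (wirtinger \<rho> p) p = 0"
  then have "- p \<in> complex_tangent_space S p"
    using complex_tangent_space_wirtinger[OF assms] by (simp add: cdot_simps)
  then have "p + - p \<in> complex_tangent_hyperplane S p"
    unfolding complex_tangent_hyperplane_def by (rule imageI)
  then show False using off assms(2) by simp
qed

text \<open>Two defining functions have the same complex tangent space, hence proportional \<open>\<partial>\<rho>\<close>, and the normalization
removes the factor.\<close>

lemma dual_map_eq: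
  assumes ld: "local_defining_function S U \<rho>" and p: "p \<in> S" "p \<in> U"
  shows "dual_map S p = cmul (1 / cdot (wirtinger \<rho> p) p) (wirtinger \<rho> p)"
proof -
  define \<sigma> where "\<sigma> = (SOME \<rho>. \<exists>U. p \<in> U \<and> local_defining_function S U \<rho>)"
  have "\<exists>U. p \<in> U \<and> local_defining_function S U \<sigma>"
    unfolding \<sigma>_def by (rule someI[of _ \<rho>]) (use assms in blast)
  then obtain U' where ld': "p \<in> U'" "local_defining_function S U' \<sigma>" by blast
  define a where "a = wirtinger \<rho> p"
  define b where "b = wirtinger \<sigma> p"
  have nz: "cdot a p \<noteq> 0" "cdot b p \<noteq> 0"
    using wirtinger_pairing_nonzero[OF ld p] wirtinger_pairing_nonzero[OF ld'(2) p(1) ld'(1)]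
    by (auto simp: a_def b_def)
  have "cdot a (snd a, - fst a) = 0" by (simp add: cdot_def)
  then have "cdot b (snd a, - fst a) = 0"
    using complex_tangent_space_wirtinger[OF ld p] complex_tangent_space_wirtinger[OF ld'(2) p(1) ld'(1)]
    by (auto simp: a_def b_def)
  then have ab: "fst b * snd a = snd b * fst a" by (simp add: cdot_def)
  have "dual_map S p = (fst b / cdot b p, snd b / cdot b p)"
    unfolding dual_map_def \<sigma>_def[symmetric]
    by (simp add: b_def wirtinger_def cdot_def Let_def mult.commute)
  also have "fst b / cdot b p = fst a / cdot a p"
    using nz ab by (simp add: frac_eq_eq) (simp add: cdot_def algebra_simps)
  also have "snd b / cdot b p = snd a / cdot a p"
    using nz ab by (simp add: frac_eq_eq) (simp add: cdot_def algebra_simps)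
  finally show ?thesis by (simp add: a_def cmul_def)
qed

lemma cdot_dual_map:
  assumes "p \<in> S" shows "cdot (dual_map S p) p = 1"
proof -
  obtain U \<rho> where ld: "p \<in> U" "local_defining_function S U \<rho>" using defining_functionE[OF assms] .
  show ?thesis
    using wirtinger_pairing_nonzero[OF ld(2) assms ld(1)]
    by (simp add: dual_map_eq[OF ld(2) assms ld(1)] cmul_simps)
qed

text \<open>The dual map is a complex multiple of \<open>\<partial>\<rho>\<close>, so it recovers the real tangent space up to a phase.\<close>

lemma dual_map_conormal:
  assumes "p \<in> S"
  obtains d where "d \<noteq> 0" "\<And>v. v \<in> tangent_space S p \<longleftrightarrow> Re (d * cdot (dual_map S p) v) = 0"
proof -
  obtain U \<rho> where ld: "p \<in> U" "local_defining_function S U \<rho>" using defining_functionE[OF assms] .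
  let ?d = "cdot (wirtinger \<rho> p) p"
  have d: "?d \<noteq> 0" by (rule wirtinger_pairing_nonzero[OF ld(2) assms ld(1)])
  have "?d * cdot (dual_map S p) v = cdot (wirtinger \<rho> p) v" for v
    using d by (simp add: dual_map_eq[OF ld(2) assms ld(1)] cmul_simps)
  then show ?thesis using that[OF d] tangent_space_wirtinger[OF ld(2) assms ld(1)] by simp
qed

lemma complex_tangent_space_iff:
  assumes "p \<in> S"
  shows "v \<in> complex_tangent_space S p \<longleftrightarrow> cdot (dual_map S p) v = 0"
proof -
  obtain U \<rho> where ld: "p \<in> U" "local_defining_function S U \<rho>" using defining_functionE[OF assms] .
  have d: "cdot (wirtinger \<rho> p) p \<noteq> 0" by (rule wirtinger_pairing_nonzero[OF ld(2) assms ld(1)])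
  then show ?thesis
    by (simp add: dual_map_eq[OF ld(2) assms ld(1)] complex_tangent_space_wirtinger[OF ld(2) assms ld(1)] cmul_simps)
qed

lemma dual_map_extension:
  assumes ld: "local_defining_function S U \<rho>"
  defines "U' \<equiv> {x \<in> U. cdot (wirtinger \<rho> x) x \<noteq> 0}"
  shows "open U'" "S \<inter> U \<subseteq> U'" "smooth_on U (\<lambda>x. cdot (wirtinger \<rho> x) x)" "smooth_on U (wirtinger \<rho>)"
    "smooth_on U' (\<lambda>x. cmul (1 / cdot (wirtinger \<rho> x) x) (wirtinger \<rho> x))"
proof -
  note U = local_defining_functionD[OF ld]
  show sd: "smooth_on U (\<lambda>x. cdot (wirtinger \<rho> x) x)"
    unfolding cdot_def wirtinger_def fst_conv snd_conv
    by (intro smooth_on_add smooth_on_mult smooth_on_wirtinger smooth_on_fst smooth_on_snd smooth_on_ident U)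
  show sw: "smooth_on U (wirtinger \<rho>)"
    unfolding wirtinger_def[abs_def] by (intro smooth_on_Pair smooth_on_wirtinger U)
  have "U' = U \<inter> (\<lambda>x. cdot (wirtinger \<rho> x) x) -` (- {0})" by (auto simp: U'_def)
  then show o: "open U'"
    using continuous_open_preimage[OF smooth_on_imp_continuous_on[OF sd] U(1), of "- {0}"] by auto
  show "S \<inter> U \<subseteq> U'" using wirtinger_pairing_nonzero[OF ld] by (auto simp: U'_def)
  have sub: "U' \<subseteq> U" by (auto simp: U'_def)
  show "smooth_on U' (\<lambda>x. cmul (1 / cdot (wirtinger \<rho> x) x) (wirtinger \<rho> x))"
    unfolding cmul_def
    by (intro smooth_on_Pair smooth_on_mult smooth_on_divide smooth_on_const smooth_on_fst smooth_on_snd o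
        smooth_on_subset[OF sd sub] smooth_on_subset[OF sw sub]) (auto simp: U'_def)
qed

lemma smooth_dual_map: "smooth_on_surface S (dual_map S)"
proof (rule smooth_on_surfaceI)
  fix p assume p: "p \<in> S"
  obtain U \<rho> where ld: "p \<in> U" "local_defining_function S U \<rho>" using defining_functionE[OF p] .
  note E = dual_map_extension[OF ld(2)]
  show "\<exists>U F. p \<in> U \<and> extends S U F (dual_map S)"
    unfolding extends_def using E(1,2,5) p ld dual_map_eq[OF ld(2)]
    by (intro exI[of _ "{x \<in> U. cdot (wirtinger \<rho> x) x \<noteq> 0}"]
        exI[of _ "\<lambda>x. cmul (1 / cdot (wirtinger \<rho> x) x) (wirtinger \<rho> x)"]) auto
qed

text \<open>Along \<open>S\<close>, \<open>D \<rho> x v\<close> is the real part of \<open>2 d(x) (w(x) \<cdot> v)\<close> with \<open>w\<close> the dual map. At \<open>p\<close> the factor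
\<open>w \<cdot> v\<close> vanishes since \<open>v\<close> is complex tangential, and its derivative vanishes since \<open>v\<close> is in the kernel of the
derivative of the dual map.\<close>

lemma dual_map_critical:
  assumes ld: "local_defining_function S U \<rho>" and p: "p \<in> S" "p \<in> U"
    and v: "v \<in> complex_tangent_space S p" "surface_diff S (dual_map S) p v = 0"
  shows "D (\<lambda>x. D \<rho> x v) p v = 0"
proof -
  note U = local_defining_functionD[OF ld]
  note E = dual_map_extension[OF ld]
  let ?U' = "{x \<in> U. cdot (wirtinger \<rho> x) x \<noteq> 0}"
  define d where "d x = cdot (wirtinger \<rho> x) x" for x
  define w where "w x = cmul (1 / d x) (wirtinger \<rho> x)" for x
  have pU': "p \<in> ?U'" using E(2) p by blast
  have sub: "?U' \<subseteq> U" by auto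
  have vT: "v \<in> tangent_space S p" using v(1) by (simp add: complex_tangent_space_def)
  have sw: "smooth_on ?U' w" and sd: "smooth_on ?U' d"
    unfolding w_def[abs_def] d_def[abs_def] using E(5) smooth_on_subset[OF E(3) sub] by auto
  have wS: "w x = dual_map S x" if "x \<in> S \<inter> ?U'" for x
    using dual_map_eq[OF ld, of x] that by (simp add: w_def d_def)
  have dw: "D w p v = 0"
    using surface_diff_extension[OF p(1) E(1) pU' wS smooth_on_has_derivative[OF sw pU'] vT] v(2) by simp
  have wv: "cdot (w p) v = 0"
    using wS[of p] p(1) pU' v(1) complex_tangent_space_iff[OF p(1)] by simp
  have Dr: "D \<rho> x v = 2 * Re (d x * cdot (w x) v)" if "x \<in> ?U'" for x
  proof -
    have x: "x \<in> U" "d x \<noteq> 0" using that by (auto simp: d_def)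
    have "linear (D \<rho> x)" using smooth_on_has_derivative[OF U(2) x(1)] by (rule has_derivative_linear)
    then show ?thesis using x(2) by (simp add: real_derivative_wirtinger w_def cmul_simps)
  qed
  have 1: "((\<lambda>x. cdot (w x) v) has_derivative (\<lambda>u. cdot (D w p u) v)) (at p)"
    by (rule bounded_linear.has_derivative[OF bounded_linear_cdot_left smooth_on_has_derivative[OF sw pU']])
  have "((\<lambda>x. d x * cdot (w x) v) has_derivative (\<lambda>u. d p * cdot (D w p u) v + D d p u * cdot (w p) v)) (at p)"
    by (rule has_derivative_mult[OF smooth_on_has_derivative[OF sd pU'] 1])
  then have "((\<lambda>x. 2 * Re (d x * cdot (w x) v)) has_derivative
      (\<lambda>u. 2 * Re (d p * cdot (D w p u) v + D d p u * cdot (w p) v))) (at p)"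
    by (intro has_derivative_mult_right bounded_linear.has_derivative[OF bounded_linear_Re])
  then have "D (\<lambda>x. 2 * Re (d x * cdot (w x) v)) p v = 0"
    using D_eq dw wv by (fastforce simp: cdot_def)
  moreover have "D (\<lambda>x. D \<rho> x v) p = D (\<lambda>x. 2 * Re (d x * cdot (w x) v)) p"
    by (rule D_cong[OF E(1) pU' Dr])
  ultimately show ?thesis by simp
qed

text \<open>Let \<open>M\<close> be the projective map that makes \<open>S\<close> strongly convex near \<open>p\<close>, and \<open>\<rho> = \<rho>' \<circ> M\<close> the pulled back
defining function. For a kernel vector \<open>v\<close> the Hessian of \<open>\<rho>\<close> vanishes on \<open>v\<close>. By the chain rule it is the
Hessian of \<open>\<rho>'\<close> on \<open>v' = DM v\<close> plus \<open>D \<rho>'\<close> applied to the acceleration of \<open>M\<close>; the latter is a complex multiple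
of the complex tangential vector \<open>v'\<close> and contributes nothing. So the second fundamental form of the strongly
convex image vanishes on \<open>v'\<close>, which forces \<open>v' = 0\<close>.\<close>

theorem dual_map_immersive:
  assumes SC: "strongly_C_convex S" and p: "p \<in> S"
    and v: "v \<in> complex_tangent_space S p" "surface_diff S (dual_map S) p v = 0"
  shows "v = 0"
proof (rule ccontr)
  assume v0: "v \<noteq> 0"
  obtain U A where U: "open U" "p \<in> U" "invertible A" "\<And>z. z \<in> S \<inter> U \<Longrightarrow> homog_image A z $ 1 \<noteq> 0"
    and conv: "strongly_convex_hypersurface (projective_map A ` (S \<inter> U))"
    using SC p unfolding strongly_C_convex_def by blast
  let ?h = "\<lambda>z. homog_image A z $ 1" and ?M = "projective_map A"
  define S' where "S' = ?M ` (S \<inter> U)"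
  have "?M p \<in> S'" using p U(2) by (auto simp: S'_def)
  then obtain V \<rho>' where V: "?M p \<in> V" "local_defining_function S' V \<rho>'"
    using conv unfolding strongly_convex_hypersurface_def smooth_hypersurface_def S'_def by blast
  note LV = local_defining_functionD[OF V(2)]
  define U1 where "U1 = U \<inter> ?h -` (- {0})"
  have o1: "open U1" unfolding U1_def
    by (intro continuous_open_preimage[OF smooth_on_imp_continuous_on[OF smooth_on_homog_image]] U) auto
  have h1: "?h z \<noteq> 0" if "z \<in> U1" for z using that by (auto simp: U1_def)
  have sM: "smooth_on U1 ?M" by (rule smooth_on_projective_map[OF o1 h1])
  define U2 where "U2 = U1 \<inter> ?M -` V"
  have o2: "open U2" unfolding U2_def
    by (intro continuous_open_preimage[OF smooth_on_imp_continuous_on[OF sM]] o1 LV)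
  have p2: "p \<in> U2" using U p V by (auto simp: U2_def U1_def)
  have h2: "?h z \<noteq> 0" if "z \<in> U2" for z using h1 that by (auto simp: U2_def)
  have dM: "(?M has_derivative projective_deriv A z) (at z)" if "z \<in> U2" for z
    by (rule projective_map_has_derivative[OF h2[OF that]])
  have sM2: "smooth_on U2 ?M" by (rule smooth_on_subset[OF sM]) (auto simp: U2_def)
  define \<rho> where "\<rho> x = \<rho>' (?M x)" for x
  have d\<rho>: "(\<rho> has_derivative (\<lambda>u. D \<rho>' (?M x) (projective_deriv A x u))) (at x)" if "x \<in> U2" for x
  proof -
    have "?M x \<in> V" using that by (simp add: U2_def)
    from diff_chain_at[OF dM[OF that] smooth_on_has_derivative[OF LV(2) this]]
    show ?thesis by (simp add: o_def \<rho>_def[abs_def])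
  qed
  have ld: "local_defining_function S U2 \<rho>"
    unfolding local_defining_function_def
  proof (intro conjI ballI)
    show "smooth_on U2 \<rho>"
      unfolding \<rho>_def[abs_def] by (rule smooth_on_compose[OF o2 sM2 LV(2)]) (auto simp: U2_def)
    show "S \<inter> U2 = {x \<in> U2. \<rho> x = 0}"
    proof (intro set_eqI iffI)
      fix x assume x: "x \<in> S \<inter> U2"
      then have "?M x \<in> S' \<inter> V" by (auto simp: S'_def U2_def U1_def)
      then show "x \<in> {x \<in> U2. \<rho> x = 0}" using LV(3) x by (auto simp: \<rho>_def)
    next
      fix x assume x: "x \<in> {x \<in> U2. \<rho> x = 0}"
      then have "?M x \<in> S'" using LV(3) by (auto simp: \<rho>_def U2_def)
      then obtain y where y: "y \<in> S \<inter> U" "?M x = ?M y" by (auto simp: S'_def)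
      have "x = y" by (rule projective_map_inj[OF U(3) h2 U(4)[OF y(1)] y(2)]) (use x in auto)
      then show "x \<in> S \<inter> U2" using x y by auto
    qed
    fix x assume x: "x \<in> S \<inter> U2"
    then have "?M x \<in> S'" "?M x \<in> V" by (auto simp: S'_def U2_def U1_def)
    from LV(4)[OF this] obtain u where u: "D \<rho>' (?M x) u \<noteq> 0" by blast
    have x2: "x \<in> U2" using x by blast
    have lin: "linear (projective_deriv A x)" using dM[OF x2] by (rule has_derivative_linear)
    have "inj (projective_deriv A x)"
      unfolding linear_injective_0[OF lin] using projective_deriv_inj[OF U(3) h2[OF x2]] by blast
    then have "surj (projective_deriv A x)" using linear_injective_imp_surjective[OF lin] by simp
    then obtain u' where "u = projective_deriv A x u'" by (rule surjE)
    then have "D \<rho> x u' \<noteq> 0" using u D_eq[OF d\<rho>[OF x2]] by simp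
    then show "\<exists>v. D \<rho> x v \<noteq> 0" by blast
  qed (rule o2)
  define v' where "v' = projective_deriv A p v"
  have v'0: "v' \<noteq> 0" using projective_deriv_inj[OF U(3) h2[OF p2]] v0 unfolding v'_def by blast
  have vT: "v \<in> tangent_space S p" using v(1) by (simp add: complex_tangent_space_def)
  \<comment> \<open>\<open>D \<rho>'\<close> kills the whole complex line of \<open>v'\<close>, not only the real one\<close>
  have kerc: "D \<rho>' (?M p) (cmul c v') = 0" for c
  proof -
    have "D \<rho>' (?M p) (cmul c v') = D \<rho> p (cmul c v)"
      using D_eq[OF d\<rho>[OF p2]] by (simp add: v'_def projective_deriv_cmul)
    also have "\<dots> = 2 * Re (cdot (wirtinger \<rho> p) (cmul c v))"
      by (rule real_derivative_wirtinger) (use D_eq[OF d\<rho>[OF p2]] d\<rho>[OF p2] in \<open>auto dest: has_derivative_linear\<close>)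
    also have "\<dots> = 0"
      using v(1) unfolding complex_tangent_space_wirtinger[OF ld p p2] by (simp add: cmul_simps)
    finally show ?thesis .
  qed
  have ker: "D \<rho>' (?M p) v' = 0" using kerc[of 1] by (simp add: cmul_simps)
  have v'T: "v' \<in> tangent_space S' (?M p)"
    unfolding tangent_space_iff[OF V(2) \<open>?M p \<in> S'\<close> V(1)] by (rule ker)
  define a where "a b y = D \<rho>' y b" for b y
  have aform: "one_form a y u = D \<rho>' y u" if "y \<in> V" for y u
    by (rule one_form_linear_eq) (use smooth_on_has_derivative[OF LV(2) that] in \<open>auto simp: a_def dest: has_derivative_linear\<close>)
  have da: "(a b has_derivative D (a b) y) (at y)" if "y \<in> V" for b y
    unfolding a_def[abs_def] by (rule smooth_on_has_derivative[OF smooth_on_D[OF LV(2)] that])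
  have d2M: "D (\<lambda>x. D ?M x v) p v = cmul (- 2 * hlin A 1 v / ?h p) v'"
    unfolding v'_def by (rule projective_map_second_derivative[OF o2 p2 h2])
  have "((\<lambda>x. one_form a (?M x) (D ?M x v)) has_derivative
      (\<lambda>u. one_form_deriv a (?M p) (projective_deriv A p u) (D ?M p v)
         + one_form a (?M p) (D (\<lambda>x. D ?M x v) p u))) (at p)"
    by (rule has_derivative_one_form[OF da dM[OF p2] smooth_on_has_derivative[OF smooth_on_D[OF sM2] p2]])
      (rule V(1))
  then have "D (\<lambda>x. one_form a (?M x) (D ?M x v)) p v
     = one_form_deriv a (?M p) v' v' + one_form a (?M p) (D (\<lambda>x. D ?M x v) p v)"
    using D_eq D_eq[OF dM[OF p2]] by (fastforce simp: v'_def)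
  also have "one_form a (?M p) (D (\<lambda>x. D ?M x v) p v) = 0"
    unfolding aform[OF V(1)] d2M by (rule kerc)
  also have "one_form_deriv a (?M p) v' v' = D (\<lambda>y. D \<rho>' y v') (?M p) v'"
  proof -
    have "one_form_deriv a (?M p) v' v' = D (\<lambda>y. one_form a y v') (?M p) v'"
      by (rule D_one_form[symmetric, OF da[OF V(1)]])
    also have "D (\<lambda>y. one_form a y v') (?M p) = D (\<lambda>y. D \<rho>' y v') (?M p)"
      by (rule D_cong[OF LV(1) V(1) aform])
    finally show ?thesis .
  qed
  finally have e1: "D (\<lambda>x. one_form a (?M x) (D ?M x v)) p v = D (\<lambda>y. D \<rho>' y v') (?M p) v'" by simp
  have "D (\<lambda>x. one_form a (?M x) (D ?M x v)) p = D (\<lambda>x. D \<rho> x v) p"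
  proof (rule D_cong[OF o2 p2])
    fix x assume x: "x \<in> U2"
    then have "?M x \<in> V" by (simp add: U2_def)
    then show "one_form a (?M x) (D ?M x v) = D \<rho> x v"
      using D_eq[OF d\<rho>[OF x]] D_eq[OF dM[OF x]] aform by simp
  qed
  then have "D (\<lambda>y. D \<rho>' y v') (?M p) v' = 0" using e1 dual_map_critical[OF ld p p2 v] by simp
  moreover obtain u where "D \<rho>' (?M p) u \<noteq> 0" using LV(4)[OF \<open>?M p \<in> S'\<close> V(1)] by blast
  ultimately have "second_fundamental_form \<rho>' (?M p) v' v' = 0"
    using second_fundamental_form_eq[OF LV(1) V(1) LV(2) _ ker] by (metis mult_zero_right)
  moreover have "second_fundamental_form \<rho>' (?M p) v' v' \<noteq> 0"
    using conv \<open>?M p \<in> S'\<close> V v'T v'0 unfolding strongly_convex_hypersurface_def S'_def[symmetric]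
    by (metis DiffI less_irrefl singletonD)
  ultimately show False by simp
qed

end

section \<open>Complex vector fields and their brackets\<close>

lemma complex_vector_fieldD:
  assumes "complex_vector_field S V"
  shows "smooth_on_surface S (\<lambda>x. fst (V x))" "smooth_on_surface S (\<lambda>x. snd (V x))"
    "p \<in> S \<Longrightarrow> fst (V p) \<in> tangent_space S p" "p \<in> S \<Longrightarrow> snd (V p) \<in> tangent_space S p"
  using assms smooth_on_surface_linear(1)[OF bounded_linear_fst] smooth_on_surface_linear(1)[OF bounded_linear_snd]
  unfolding complex_vector_field_def by blast+

text \<open>The action of the complex field \<open>A + i B\<close> on functions in the ambient space.\<close>

definition field_op :: "(C2 \<Rightarrow> C2) \<Rightarrow> (C2 \<Rightarrow> C2) \<Rightarrow> (C2 \<Rightarrow> complex) \<Rightarrow> C2 \<Rightarrow> complex" where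
  "field_op A B F x = D F x (A x) + \<i> * D F x (B x)"

lemma smooth_on_field_op:
  assumes "open N" "smooth_on N A" "smooth_on N B" "smooth_on N F"
  shows "smooth_on N (field_op A B F)"
  unfolding field_op_def[abs_def]
  by (intro smooth_on_add smooth_on_mult smooth_on_const smooth_on_D_dir assms)

lemma extends_apply_field:
  assumes V: "complex_vector_field S V" and "extends S N A (\<lambda>x. fst (V x))" "extends S N B (\<lambda>x. snd (V x))"
    and "extends S N F f"
  shows "extends S N (field_op A B F) (apply_field S V f)"
  unfolding extends_def
proof (intro conjI ballI)
  show "open N" by (rule extendsD[OF assms(4)])
  then show "smooth_on N (field_op A B F)" by (intro smooth_on_field_op extendsD(2)[OF assms(2)] extendsD(2)[OF assms(3)] extendsD(2)[OF assms(4)])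
  fix x assume x: "x \<in> S \<inter> N"
  then show "field_op A B F x = apply_field S V f x"
    using complex_vector_fieldD(3,4)[OF V, of x] extendsD(3)[OF assms(2), of x] extendsD(3)[OF assms(3), of x]
    by (simp add: field_op_def apply_field_def extends_surface_diff[OF assms(4)])
qed

lemma field_extension:
  assumes V: "complex_vector_field S V" and p: "p \<in> S"
  obtains N A B where "p \<in> N" "extends S N A (\<lambda>x. fst (V x))" "extends S N B (\<lambda>x. snd (V x))"
  using extends_exists2[OF complex_vector_fieldD(1,2)[OF V] p] .

lemma smooth_apply_field:
  assumes V: "complex_vector_field S V" and f: "smooth_on_surface S f"
  shows "smooth_on_surface S (apply_field S V f)"
proof (rule smooth_on_surfaceI)
  fix p assume p: "p \<in> S"
  obtain N A B where N: "p \<in> N" "extends S N A (\<lambda>x. fst (V x))" "extends S N B (\<lambda>x. snd (V x))"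
    using field_extension[OF V p] .
  obtain M F where M: "p \<in> M" "extends S M F f" using extends_exists[OF f p] .
  have o: "open (N \<inter> M)" using extendsD(1)[OF N(2)] extendsD(1)[OF M(2)] by auto
  have "extends S (N \<inter> M) (field_op A B F) (apply_field S V f)"
    by (rule extends_apply_field[OF V]) (use N M o in \<open>auto intro: extends_subset\<close>)
  then show "\<exists>U F. p \<in> U \<and> extends S U F (apply_field S V f)" using N(1) M(1) by blast
qed

lemma apply_field_cong:
  assumes V: "complex_vector_field S V" and f: "smooth_on_surface S f" and eq: "\<And>x. x \<in> S \<Longrightarrow> f x = g x" and p: "p \<in> S"
  shows "apply_field S V f p = apply_field S V g p"
  unfolding apply_field_def
  using surface_diff_cong[OF f eq p complex_vector_fieldD(3)[OF V p]]
    surface_diff_cong[OF f eq p complex_vector_fieldD(4)[OF V p]] by simp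

lemma smooth_on_surface_const: "smooth_on_surface S (\<lambda>x. c)"
  by (rule smooth_on_surface_global[OF smooth_on_const])

lemma apply_field_zero:
  assumes V: "complex_vector_field S V" and eq: "\<And>x. x \<in> S \<Longrightarrow> f x = 0" and p: "p \<in> S"
  shows "apply_field S V f p = 0"
proof -
  have "surface_diff S (\<lambda>x. 0::complex) p v = 0" if "v \<in> tangent_space S p" for v
    by (rule surface_diff_extension[OF p open_UNIV _ _ has_derivative_const[of 0] that]) auto
  then have "apply_field S V (\<lambda>x. 0) p = 0"
    using complex_vector_fieldD(3,4)[OF V p] by (simp add: apply_field_def)
  then show ?thesis using apply_field_cong[OF V smooth_on_surface_const _ p, of 0 f] eq by simp
qed

lemma apply_field_add:
  assumes V: "complex_vector_field S V" and f: "smooth_on_surface S f" and g: "smooth_on_surface S g" and p: "p \<in> S"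
  shows "apply_field S V (\<lambda>x. f x + g x) p = apply_field S V f p + apply_field S V g p"
  unfolding apply_field_def
  using smooth_on_surface_add(2)[OF f g p complex_vector_fieldD(3)[OF V p]]
    smooth_on_surface_add(2)[OF f g p complex_vector_fieldD(4)[OF V p]] by (simp add: algebra_simps)

lemma apply_field_minus:
  assumes V: "complex_vector_field S V" and f: "smooth_on_surface S f" and p: "p \<in> S"
  shows "apply_field S V (\<lambda>x. - f x) p = - apply_field S V f p"
proof -
  note l = smooth_on_surface_linear(2)[OF bounded_linear_minus[OF bounded_linear_ident] f p]
  show ?thesis
    unfolding apply_field_def
    using l[OF complex_vector_fieldD(3)[OF V p]] l[OF complex_vector_fieldD(4)[OF V p]] by simp
qed

text \<open>Real and imaginary part of the Lie bracket of \<open>V\<^sub>1 + i V\<^sub>2\<close> and \<open>W\<^sub>1 + i W\<^sub>2\<close>. Only derivatives of the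
components in tangential directions occur, so it makes sense for fields that are defined on \<open>S\<close> alone.\<close>

definition bracket :: "C2 set \<Rightarrow> (C2 \<Rightarrow> C2 \<times> C2) \<Rightarrow> (C2 \<Rightarrow> C2 \<times> C2) \<Rightarrow> C2 \<Rightarrow> C2 \<times> C2" where
  "bracket S V W p =
    (surface_diff S (\<lambda>x. fst (W x)) p (fst (V p)) - surface_diff S (\<lambda>x. snd (W x)) p (snd (V p))
      - (surface_diff S (\<lambda>x. fst (V x)) p (fst (W p)) - surface_diff S (\<lambda>x. snd (V x)) p (snd (W p))),
     surface_diff S (\<lambda>x. fst (W x)) p (snd (V p)) + surface_diff S (\<lambda>x. snd (W x)) p (fst (V p))
      - (surface_diff S (\<lambda>x. fst (V x)) p (snd (W p)) + surface_diff S (\<lambda>x. snd (V x)) p (fst (W p))))"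

text \<open>The second-order terms cancel by the symmetry of second derivatives.\<close>

lemma field_op_commutator:
  assumes N: "open N" "p \<in> N" and s: "smooth_on N A" "smooth_on N B" "smooth_on N A'" "smooth_on N B'" "smooth_on N F"
  shows "field_op A B (field_op A' B' F) p - field_op A' B' (field_op A B F) p
    = D F p (D A' p (A p) - D B' p (B p) - (D A p (A' p) - D B p (B' p)))
      + \<i> * D F p (D A' p (B p) + D B' p (A p) - (D A p (B' p) + D B p (A' p)))"
proof -
  define Q where "Q a v = D (\<lambda>x. D F x a) p v" for a v
  have linF: "linear (D F p)"
    using smooth_on_has_derivative[OF s(5) N(2)] by (rule has_derivative_linear)
  have sym: "Q a v = Q v a" for a v
    unfolding Q_def by (rule second_derivative_symmetric[OF N(1) s(5) N(2)])
  have dir: "((\<lambda>x. D F x (C x)) has_derivative (\<lambda>v. Q (C p) v + D F p (D C p v))) (at p)"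
    if C: "smooth_on N C" for C
  proof -
    define a where "a b x = D F x b" for b x
    have aform: "one_form a x u = D F x u" if "x \<in> N" for x u
      by (rule one_form_linear_eq)
        (use smooth_on_has_derivative[OF s(5) that] in \<open>auto simp: a_def dest: has_derivative_linear\<close>)
    have da: "(a b has_derivative D (a b) p) (at p)" for b
      unfolding a_def[abs_def] by (rule smooth_on_has_derivative[OF smooth_on_D[OF s(5)] N(2)])
    have "((\<lambda>x. one_form a x (C x)) has_derivative
        (\<lambda>v. one_form_deriv a p v (C p) + one_form a p (D C p v))) (at p)"
      by (rule has_derivative_one_form[OF da has_derivative_ident smooth_on_has_derivative[OF C N(2)]])
    moreover have "one_form_deriv a p v (C p) = Q (C p) v" for v
    proof -
      have "one_form_deriv a p v (C p) = D (\<lambda>y. one_form a y (C p)) p v"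
        by (rule D_one_form[symmetric, OF da])
      also have "D (\<lambda>y. one_form a y (C p)) p = D (\<lambda>y. D F y (C p)) p"
        by (rule D_cong[OF N aform])
      finally show ?thesis by (simp add: Q_def)
    qed
    ultimately have "((\<lambda>x. one_form a x (C x)) has_derivative (\<lambda>v. Q (C p) v + D F p (D C p v))) (at p)"
      by (simp add: aform[OF N(2)])
    then show ?thesis
      by (rule has_derivative_transform_within_open[OF _ N]) (simp add: aform)
  qed
  have op: "D (field_op C E F) p v = Q (C p) v + D F p (D C p v) + \<i> * (Q (E p) v + D F p (D E p v))"
    if "smooth_on N C" "smooth_on N E" for C E v
  proof -
    have "(field_op C E F has_derivative
        (\<lambda>v. Q (C p) v + D F p (D C p v) + \<i> * (Q (E p) v + D F p (D E p v)))) (at p)"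
      unfolding field_op_def[abs_def]
      by (intro has_derivative_add has_derivative_mult_right dir that)
    then show ?thesis by (rule fun_cong[OF D_eq])
  qed
  have 1: "field_op A B (field_op A' B' F) p
    = (Q (A' p) (A p) + D F p (D A' p (A p)) + \<i> * (Q (B' p) (A p) + D F p (D B' p (A p))))
     + \<i> * (Q (A' p) (B p) + D F p (D A' p (B p)) + \<i> * (Q (B' p) (B p) + D F p (D B' p (B p))))"
    unfolding field_op_def[of A B "field_op A' B' F"] op[OF s(3,4)] ..
  have 2: "field_op A' B' (field_op A B F) p
    = (Q (A' p) (A p) + D F p (D A p (A' p)) + \<i> * (Q (A' p) (B p) + D F p (D B p (A' p))))
     + \<i> * (Q (B' p) (A p) + D F p (D A p (B' p)) + \<i> * (Q (B' p) (B p) + D F p (D B p (B' p))))"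
    unfolding field_op_def[of A' B' "field_op A B F"] op[OF s(1,2)]
    using sym[of "A p" "A' p"] sym[of "A p" "B' p"] sym[of "B p" "A' p"] sym[of "B p" "B' p"] by simp
  have ii: "\<i> * (\<i> * z) = - z" for z by (simp flip: mult.assoc)
  show ?thesis
    unfolding 1 2 by (simp add: linear_add[OF linF] linear_diff[OF linF] distrib_left right_diff_distrib ii)
qed

lemma bracket_extension:
  assumes V: "complex_vector_field S V" and W: "complex_vector_field S W"
    and E: "extends S N A (\<lambda>x. fst (V x))" "extends S N B (\<lambda>x. snd (V x))"
      "extends S N A' (\<lambda>x. fst (W x))" "extends S N B' (\<lambda>x. snd (W x))"
    and x: "x \<in> S" "x \<in> N"
  shows "bracket S V W x = (D A' x (A x) - D B' x (B x) - (D A x (A' x) - D B x (B' x)),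
     D A' x (B x) + D B' x (A x) - (D A x (B' x) + D B x (A' x)))"
proof -
  note v = complex_vector_fieldD(3,4)[OF V x(1)] and w = complex_vector_fieldD(3,4)[OF W x(1)]
  have "fst (V x) = A x" "snd (V x) = B x" "fst (W x) = A' x" "snd (W x) = B' x"
    using extendsD(3)[OF E(1) x] extendsD(3)[OF E(2) x] extendsD(3)[OF E(3) x] extendsD(3)[OF E(4) x] by simp_all
  with v w show ?thesis
    unfolding bracket_def
    by (simp add: extends_surface_diff[OF E(1) x] extends_surface_diff[OF E(2) x]
        extends_surface_diff[OF E(3) x] extends_surface_diff[OF E(4) x])
qed

lemma two_field_extension:
  assumes V: "complex_vector_field S V" and W: "complex_vector_field S W" and p: "p \<in> S" and M: "open M" "p \<in> M"
  obtains N A B A' B' where "open N" "p \<in> N" "N \<subseteq> M"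
    "extends S N A (\<lambda>x. fst (V x))" "extends S N B (\<lambda>x. snd (V x))"
    "extends S N A' (\<lambda>x. fst (W x))" "extends S N B' (\<lambda>x. snd (W x))"
proof -
  obtain N1 A B where 1: "p \<in> N1" "extends S N1 A (\<lambda>x. fst (V x))" "extends S N1 B (\<lambda>x. snd (V x))"
    using field_extension[OF V p] .
  obtain N2 A' B' where 2: "p \<in> N2" "extends S N2 A' (\<lambda>x. fst (W x))" "extends S N2 B' (\<lambda>x. snd (W x))"
    using field_extension[OF W p] .
  have o: "open (N1 \<inter> N2 \<inter> M)" using extendsD(1)[OF 1(2)] extendsD(1)[OF 2(2)] M by auto
  show ?thesis
    by (rule that[of "N1 \<inter> N2 \<inter> M" A B A' B'])
      (use 1 2 o M in \<open>auto intro: extends_subset\<close>)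
qed

text \<open>Apply the commutator to a defining function: a tangential field sends it to a function that vanishes on \<open>S\<close>,
and a second tangential field sends this to zero.\<close>

lemma bracket_tangent:
  assumes S: "smooth_hypersurface S" and V: "complex_vector_field S V" and W: "complex_vector_field S W" and p: "p \<in> S"
  shows "fst (bracket S V W p) \<in> tangent_space S p" "snd (bracket S V W p) \<in> tangent_space S p"
proof -
  obtain U \<rho> where U: "p \<in> U" "local_defining_function S U \<rho>"
    using S p unfolding smooth_hypersurface_def by blast
  note LU = local_defining_functionD[OF U(2)]
  obtain N A B A' B' where N: "open N" "p \<in> N" "N \<subseteq> U"
    and E: "extends S N A (\<lambda>x. fst (V x))" "extends S N B (\<lambda>x. snd (V x))"
    "extends S N A' (\<lambda>x. fst (W x))" "extends S N B' (\<lambda>x. snd (W x))"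
    using two_field_extension[OF V W p LU(1) U(1)] .
  define F where "F x = complex_of_real (\<rho> x)" for x
  have sF: "smooth_on N F"
    unfolding F_def[abs_def]
    by (rule smooth_on_bounded_linear[OF N(1) bounded_linear_of_real smooth_on_subset[OF LU(2) N(3)]])
  have DF: "D F x v = of_real (D \<rho> x v)" if "x \<in> N" for x v
    unfolding F_def[abs_def] using N(3) that
    by (subst D_bounded_linear_compose[OF bounded_linear_of_real smooth_on_has_derivative[OF LU(2)]]) auto
  have tan: "D F x v = 0" if "x \<in> S" "x \<in> N" "v \<in> tangent_space S x" for x v
    using DF[OF that(2), of v] tangent_space_iff[OF U(2) that(1) subsetD[OF N(3) that(2)], of v] that(3) by simp
  have van: "field_op C E F x = 0"
    if "x \<in> S \<inter> N" "C x \<in> tangent_space S x" "E x \<in> tangent_space S x" for C E x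
    using that tan by (simp add: field_op_def)
  have van2: "field_op C E g p = 0"
    if g: "smooth_on N g" "\<And>x. x \<in> S \<inter> N \<Longrightarrow> g x = 0"
      and CE: "C p \<in> tangent_space S p" "E p \<in> tangent_space S p" for C E g
  proof -
    have "D g p v = D (\<lambda>x. 0) p v" if "v \<in> tangent_space S p" for v
      by (rule D_eq_on_surface[OF p N(1,2) g(1) smooth_on_const _ that]) (rule g(2))
    then show ?thesis using CE by (simp add: field_op_def)
  qed
  have AT: "A x \<in> tangent_space S x" "B x \<in> tangent_space S x" "A' x \<in> tangent_space S x" "B' x \<in> tangent_space S x"
    if "x \<in> S \<inter> N" for x
    using that complex_vector_fieldD(3,4)[OF V, of x] complex_vector_fieldD(3,4)[OF W, of x]
      extendsD(3)[OF E(1), of x] extendsD(3)[OF E(2), of x] extendsD(3)[OF E(3), of x] extendsD(3)[OF E(4), of x]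
    by auto
  note s = extendsD(2)[OF E(1)] extendsD(2)[OF E(2)] extendsD(2)[OF E(3)] extendsD(2)[OF E(4)]
  have pN: "p \<in> S \<inter> N" using p N by blast
  have "field_op A B (field_op A' B' F) p = 0"
    by (rule van2[OF smooth_on_field_op[OF N(1) s(3,4) sF] van]) (use AT pN in auto)
  moreover have "field_op A' B' (field_op A B F) p = 0"
    by (rule van2[OF smooth_on_field_op[OF N(1) s(1,2) sF] van]) (use AT pN in auto)
  ultimately have "D F p (fst (bracket S V W p)) + \<i> * D F p (snd (bracket S V W p)) = 0"
    using field_op_commutator[OF N(1,2) s sF] by (simp add: bracket_extension[OF V W E p N(2)])
  then have "D \<rho> p (fst (bracket S V W p)) = 0" "D \<rho> p (snd (bracket S V W p)) = 0"
    unfolding DF[OF N(2)] by (auto simp: complex_eq_iff)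
  then show "fst (bracket S V W p) \<in> tangent_space S p" "snd (bracket S V W p) \<in> tangent_space S p"
    using tangent_space_iff[OF U(2) p U(1)] by auto
qed

lemma complex_vector_field_bracket:
  assumes S: "smooth_hypersurface S" and V: "complex_vector_field S V" and W: "complex_vector_field S W"
  shows "complex_vector_field S (bracket S V W)"
  unfolding complex_vector_field_def
proof (intro conjI ballI)
  show "smooth_on_surface S (bracket S V W)"
  proof (rule smooth_on_surfaceI)
    fix p assume p: "p \<in> S"
    obtain N A B A' B' where N: "open N" "p \<in> N" "N \<subseteq> UNIV"
      and E: "extends S N A (\<lambda>x. fst (V x))" "extends S N B (\<lambda>x. snd (V x))"
      "extends S N A' (\<lambda>x. fst (W x))" "extends S N B' (\<lambda>x. snd (W x))"
      using two_field_extension[OF V W p open_UNIV UNIV_I] .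
    note s = extendsD(2)[OF E(1)] extendsD(2)[OF E(2)] extendsD(2)[OF E(3)] extendsD(2)[OF E(4)]
    have sB: "smooth_on N (\<lambda>x. (D A' x (A x) - D B' x (B x) - (D A x (A' x) - D B x (B' x)),
       D A' x (B x) + D B' x (A x) - (D A x (B' x) + D B x (A' x))))"
      by (intro smooth_on_Pair smooth_on_diff smooth_on_add smooth_on_D_dir N s)
    show "\<exists>U F. p \<in> U \<and> extends S U F (bracket S V W)"
      unfolding extends_def
      by (rule exI[of _ N], rule exI, intro conjI ballI, rule N(2), rule N(1), rule sB)
        (simp add: bracket_extension[OF V W E])
  qed
qed (use bracket_tangent[OF S V W] in auto)

lemma apply_bracket:
  assumes V: "complex_vector_field S V" and W: "complex_vector_field S W" and f: "smooth_on_surface S f" and p: "p \<in> S"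
    and S: "smooth_hypersurface S"
  shows "apply_field S (bracket S V W) f p
     = apply_field S V (apply_field S W f) p - apply_field S W (apply_field S V f) p"
proof -
  obtain M F where M: "p \<in> M" "extends S M F f" using extends_exists[OF f p] .
  obtain N A B A' B' where N: "open N" "p \<in> N" "N \<subseteq> M"
    and E: "extends S N A (\<lambda>x. fst (V x))" "extends S N B (\<lambda>x. snd (V x))"
    "extends S N A' (\<lambda>x. fst (W x))" "extends S N B' (\<lambda>x. snd (W x))"
    using two_field_extension[OF V W p extendsD(1)[OF M(2)] M(1)] .
  have F: "extends S N F f" by (rule extends_subset[OF M(2) N(1,3)])
  note s = extendsD(2)[OF E(1)] extendsD(2)[OF E(2)] extendsD(2)[OF E(3)] extendsD(2)[OF E(4)] extendsD(2)[OF F]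
  have 1: "apply_field S V (apply_field S W f) p = field_op A B (field_op A' B' F) p"
    using extendsD(3)[OF extends_apply_field[OF V E(1,2) extends_apply_field[OF W E(3,4) F]] p N(2)] by simp
  have 2: "apply_field S W (apply_field S V f) p = field_op A' B' (field_op A B F) p"
    using extendsD(3)[OF extends_apply_field[OF W E(3,4) extends_apply_field[OF V E(1,2) F]] p N(2)] by simp
  have 3: "apply_field S (bracket S V W) f p = D F p (fst (bracket S V W p)) + \<i> * D F p (snd (bracket S V W p))"
    using bracket_tangent[OF S V W p] by (simp add: apply_field_def extends_surface_diff[OF F p N(2)])
  show ?thesis
    unfolding 1 2 3 field_op_commutator[OF N(1,2) s] bracket_extension[OF V W E p N(2)] by simp
qed

section \<open>The frame of the two fields and their bracket\<close>

text \<open>The complex linear extension of the differential to the complexified tangent space, whose elements are pairs.\<close>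

definition cdiff :: "C2 set \<Rightarrow> (C2 \<Rightarrow> complex) \<Rightarrow> C2 \<Rightarrow> C2 \<times> C2 \<Rightarrow> complex" where
  "cdiff S f p V = surface_diff S f p (fst V) + \<i> * surface_diff S f p (snd V)"

text \<open>The image of a complexified tangent vector in \<open>\<complex>\<^sup>2\<close>, that is its action on \<open>(z\<^sub>1, z\<^sub>2)\<close>; the formal
imaginary unit becomes \<open>J\<close>.\<close>

definition cvec :: "C2 \<times> C2 \<Rightarrow> C2" where
  "cvec V = fst V + J (snd V)"

definition cscale :: "complex \<Rightarrow> C2 \<times> C2 \<Rightarrow> C2 \<times> C2" where
  "cscale c V = (Re c *\<^sub>R fst V - Im c *\<^sub>R snd V, Re c *\<^sub>R snd V + Im c *\<^sub>R fst V)"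

definition ctangent :: "C2 set \<Rightarrow> C2 \<Rightarrow> (C2 \<times> C2) set" where
  "ctangent S p = tangent_space S p \<times> tangent_space S p"

lemma apply_field_cdiff: "apply_field S V f p = cdiff S f p (V p)"
  by (simp add: apply_field_def cdiff_def)

lemma cvec_simps: "cvec (cscale c V) = cmul c (cvec V)" "cvec (V + W) = cvec V + cvec W" "cvec (v, 0) = v"
  by (simp_all add: cvec_def cscale_def J_simps cmul_decompose algebra_simps)

lemma surface_diff_coord:
  assumes "p \<in> S" "v \<in> tangent_space S p"
  shows "surface_diff S fst p v = fst v" "surface_diff S snd p v = snd v"
  by (rule surface_diff_extension[OF assms(1) open_UNIV UNIV_I refl _ assms(2)],
      rule bounded_linear_imp_has_derivative, rule bounded_linear_fst)
    (rule surface_diff_extension[OF assms(1) open_UNIV UNIV_I refl _ assms(2)],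
      rule bounded_linear_imp_has_derivative, rule bounded_linear_snd)

lemma smooth_on_surface_coord: "smooth_on_surface S fst" "smooth_on_surface S snd"
  by (rule smooth_on_surface_global[OF smooth_on_linear[OF open_UNIV bounded_linear_fst]])
    (rule smooth_on_surface_global[OF smooth_on_linear[OF open_UNIV bounded_linear_snd]])

lemma cdiff_coord:
  assumes "p \<in> S" "V \<in> ctangent S p"
  shows "(cdiff S fst p V, cdiff S snd p V) = cvec V"
  using assms by (auto simp: cdiff_def cvec_def ctangent_def surface_diff_coord J_def prod_eq_iff)

context star_hypersurface
begin

lemmas tangent_linear = surface_diff_linear[OF _ _ smooth]

lemma surface_diff_minus:
  assumes "smooth_on_surface S f" "p \<in> S" "v \<in> tangent_space S p"
  shows "- v \<in> tangent_space S p" "surface_diff S f p (- v) = - surface_diff S f p v"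
  using tangent_linear[OF assms assms(3), of "-1" 0] by auto

lemma surface_diff_zero:
  assumes "smooth_on_surface S f" "p \<in> S"
  shows "(0::C2) \<in> tangent_space S p" "surface_diff S f p 0 = 0"
proof -
  obtain U \<rho> where U: "p \<in> U" "local_defining_function S U \<rho>" using defining_functionE[OF assms(2)] .
  show z: "(0::C2) \<in> tangent_space S p"
    using tangent_space_wirtinger[OF U(2) assms(2) U(1)] by (simp add: cdot_simps)
  show "surface_diff S f p 0 = 0" using tangent_linear(2)[OF assms z z, of 0 0] by simp
qed

text \<open>Tangency and \<open>cdiff\<close> are complex linear for the formal multiplication \<open>cscale\<close>.\<close>

lemma ctangent_cscale_add:
  assumes f: "smooth_on_surface S f" and p: "p \<in> S" and V: "V \<in> ctangent S p" and W: "W \<in> ctangent S p"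
  shows "V + cscale c W \<in> ctangent S p" "cdiff S f p (V + cscale c W) = cdiff S f p V + c * cdiff S f p W"
    "cscale c W \<in> ctangent S p" "cdiff S f p (cscale c W) = c * cdiff S f p W"
proof -
  obtain v1 v2 where v: "V = (v1, v2)" by (cases V)
  obtain w1 w2 where w: "W = (w1, w2)" by (cases W)
  note vw = v w
  have t: "v1 \<in> tangent_space S p" "v2 \<in> tangent_space S p" "w1 \<in> tangent_space S p" "w2 \<in> tangent_space S p"
    using V W by (auto simp: ctangent_def vw)
  note l = tangent_linear[OF f p]
  have 1: "Re c *\<^sub>R w1 - Im c *\<^sub>R w2 \<in> tangent_space S p"
    "surface_diff S f p (Re c *\<^sub>R w1 - Im c *\<^sub>R w2) = Re c *\<^sub>R surface_diff S f p w1 - Im c *\<^sub>R surface_diff S f p w2"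
    using l[OF t(3,4), of "Re c" "- Im c"] by auto
  have 2: "Re c *\<^sub>R w2 + Im c *\<^sub>R w1 \<in> tangent_space S p"
    "surface_diff S f p (Re c *\<^sub>R w2 + Im c *\<^sub>R w1) = Re c *\<^sub>R surface_diff S f p w2 + Im c *\<^sub>R surface_diff S f p w1"
    using l[OF t(4,3), of "Re c" "Im c"] by auto
  have 3: "v1 + (Re c *\<^sub>R w1 - Im c *\<^sub>R w2) \<in> tangent_space S p"
    "surface_diff S f p (v1 + (Re c *\<^sub>R w1 - Im c *\<^sub>R w2)) = surface_diff S f p v1 + surface_diff S f p (Re c *\<^sub>R w1 - Im c *\<^sub>R w2)"
    using l[OF t(1) 1(1), of 1 1] by auto
  have 4: "v2 + (Re c *\<^sub>R w2 + Im c *\<^sub>R w1) \<in> tangent_space S p"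
    "surface_diff S f p (v2 + (Re c *\<^sub>R w2 + Im c *\<^sub>R w1)) = surface_diff S f p v2 + surface_diff S f p (Re c *\<^sub>R w2 + Im c *\<^sub>R w1)"
    using l[OF t(2) 2(1), of 1 1] by auto
  have c: "c = of_real (Re c) + \<i> * of_real (Im c)" by (simp add: complex_eq)
  have ii: "\<i> * (\<i> * z) = - z" for z by (simp flip: mult.assoc)
  show "V + cscale c W \<in> ctangent S p" "cscale c W \<in> ctangent S p"
    using 1(1) 2(1) 3(1) 4(1) by (simp_all add: vw ctangent_def cscale_def)
  show s: "cdiff S f p (cscale c W) = c * cdiff S f p W"
    by (subst (2) c, simp only: vw cdiff_def cscale_def fst_conv snd_conv 1(2) 2(2))
      (simp add: scaleR_conv_of_real algebra_simps ii)
  show "cdiff S f p (V + cscale c W) = cdiff S f p V + c * cdiff S f p W"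
    unfolding s[symmetric]
    by (simp only: vw cdiff_def cscale_def fst_conv snd_conv add_Pair 3(2) 4(2)) (simp add: algebra_simps)
qed

lemma smooth_dual_coord:
  "smooth_on_surface S (\<lambda>x. fst (dual_map S x))" "smooth_on_surface S (\<lambda>x. snd (dual_map S x))"
  using smooth_on_surface_linear(1)[OF bounded_linear_fst smooth_dual_map]
    smooth_on_surface_linear(1)[OF bounded_linear_snd smooth_dual_map] by auto

lemma complex_tangentI:
  assumes p: "p \<in> S" and "v \<in> tangent_space S p" "J v \<in> tangent_space S p \<or> - J v \<in> tangent_space S p"
  shows "v \<in> complex_tangent_space S p"
proof -
  have "- J v \<in> tangent_space S p"
    using assms(3) surface_diff_minus(1)[OF smooth_on_surface_coord(1) p] by blast
  moreover have "v = J (- J v)" by (simp add: J_simps)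
  ultimately show ?thesis using assms(2) unfolding complex_tangent_space_def by blast
qed

lemma complex_tangentD:
  assumes p: "p \<in> S" and v: "v \<in> complex_tangent_space S p"
  shows "v \<in> tangent_space S p" "J v \<in> tangent_space S p" "- J v \<in> tangent_space S p" "J v \<in> complex_tangent_space S p"
proof -
  show "v \<in> tangent_space S p" using v by (simp add: complex_tangent_space_def)
  show Jv: "J v \<in> complex_tangent_space S p"
    using v unfolding complex_tangent_space_iff[OF p] by (simp add: cdot_simps)
  then show "J v \<in> tangent_space S p" by (simp add: complex_tangent_space_def)
  then show "- J v \<in> tangent_space S p" by (rule surface_diff_minus(1)[OF smooth_on_surface_coord(1) p])
qed

text \<open>A generator of the complex line \<open>H\<^sub>pS = {v. w \<cdot> v = 0}\<close>.\<close>

definition \<tau> :: "C2 \<Rightarrow> C2" where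
  "\<tau> p = (snd (dual_map S p), - fst (dual_map S p))"

lemma complex_tangent_line:
  assumes p: "p \<in> S" and v: "v \<in> complex_tangent_space S p"
  shows "v = cmul (fst v * snd p - snd v * fst p) (\<tau> p)"
proof -
  have 1: "fst (dual_map S p) * fst v + snd (dual_map S p) * snd v = 0"
    using v complex_tangent_space_iff[OF p] by (simp add: cdot_def)
  have 2: "fst (dual_map S p) * fst p + snd (dual_map S p) * snd p = 1"
    using cdot_dual_map[OF p] by (simp add: cdot_def)
  have "fst v = (fst v * snd p - snd v * fst p) * snd (dual_map S p)"
    "snd v = (fst v * snd p - snd v * fst p) * - fst (dual_map S p)"
    using 1 2 by algebra+
  then show ?thesis unfolding cmul_def \<tau>_def prod_eq_iff fst_conv snd_conv by (rule conjI)
qed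

end

locale dual_fields = star_hypersurface +
  fixes X T :: "C2 \<Rightarrow> C2 \<times> C2"
  assumes C_convex: "strongly_C_convex S"
    and X: "complex_vector_field S X"
    and T: "complex_vector_field S T"
    and X_z: "p \<in> S \<Longrightarrow> apply_field S X fst p = 0" "p \<in> S \<Longrightarrow> apply_field S X snd p = 0"
    and X_w: "p \<in> S \<Longrightarrow> apply_field S X (\<lambda>x. fst (dual_map S x)) p = snd p"
      "p \<in> S \<Longrightarrow> apply_field S X (\<lambda>x. snd (dual_map S x)) p = - fst p"
    and T_z: "p \<in> S \<Longrightarrow> apply_field S T fst p = snd (dual_map S p)"
      "p \<in> S \<Longrightarrow> apply_field S T snd p = - fst (dual_map S p)"
    and T_w: "p \<in> S \<Longrightarrow> apply_field S T (\<lambda>x. fst (dual_map S x)) p = 0"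
      "p \<in> S \<Longrightarrow> apply_field S T (\<lambda>x. snd (dual_map S x)) p = 0"
begin

abbreviation "w1 \<equiv> \<lambda>x. fst (dual_map S x)"
abbreviation "w2 \<equiv> \<lambda>x. snd (dual_map S x)"

lemma field_in_ctangent: "complex_vector_field S V \<Longrightarrow> p \<in> S \<Longrightarrow> V p \<in> ctangent S p"
  using complex_vector_fieldD(3,4) by (auto simp: ctangent_def mem_Times_iff)

lemma cvec_field:
  assumes "complex_vector_field S V" "p \<in> S"
  shows "cvec (V p) = (apply_field S V fst p, apply_field S V snd p)"
  using cdiff_coord[OF assms(2) field_in_ctangent[OF assms]] by (simp add: apply_field_cdiff)

text \<open>A complexified tangent vector \<open>(a, b)\<close> that kills \<open>z\<^sub>1, z\<^sub>2\<close> has \<open>a = - J b\<close>, so \<open>b\<close> lies in the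
complex line \<open>H\<^sub>pS\<close> and determines the vector. Thus these vectors form a complex line, and \<open>X\<close> generates it.\<close>

lemma cvec_zero_multiple_X:
  assumes p: "p \<in> S" and V: "V \<in> ctangent S p" and 0: "cvec V = 0"
  obtains c where "V = cscale c (X p)"
proof -
  have mult: "fst W = - J (snd W) \<and> snd W = cmul (fst (snd W) * snd p - snd (snd W) * fst p) (\<tau> p)"
    if W: "W \<in> ctangent S p" "cvec W = 0" for W
  proof -
    have a: "fst W = - J (snd W)" using W(2) by (simp add: cvec_def eq_neg_iff_add_eq_0)
    then have "snd W \<in> complex_tangent_space S p"
      using W(1) by (intro complex_tangentI[OF p]) (auto simp: ctangent_def mem_Times_iff)
    then show ?thesis using a complex_tangent_line[OF p] by blast
  qed
  have X0: "cvec (X p) = 0" using cvec_field[OF X p] X_z[OF p] by (simp add: zero_prod_def)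
  note mX = mult[OF field_in_ctangent[OF X p] X0] and mV = mult[OF V 0]
  define \<beta> where "\<beta> = fst (snd V) * snd p - snd (snd V) * fst p"
  define \<beta>0 where "\<beta>0 = fst (snd (X p)) * snd p - snd (snd (X p)) * fst p"
  have "\<beta>0 \<noteq> 0"
  proof
    assume "\<beta>0 = 0"
    then have "snd (X p) = 0" using mX by (simp add: \<beta>0_def cmul_simps)
    moreover from this have "fst (X p) = 0" using mX by (simp add: J_simps)
    ultimately have "apply_field S X f p = 0" if "smooth_on_surface S f" for f
      using surface_diff_zero(2)[OF that p] by (simp add: apply_field_def)
    then have "p = 0" using X_w[OF p] smooth_dual_coord by (simp add: prod_eq_iff)
    then show False using cdot_dual_map[OF p] by (simp add: cdot_simps)
  qed
  define c where "c = \<beta> / \<beta>0"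
  have "snd V = cmul \<beta> (\<tau> p)" "snd (X p) = cmul \<beta>0 (\<tau> p)"
    using mX mV unfolding \<beta>_def \<beta>0_def by blast+
  then have "snd V = cmul c (snd (X p))" using \<open>\<beta>0 \<noteq> 0\<close> by (simp add: c_def cmul_simps)
  then have sV: "snd V = Re c *\<^sub>R snd (X p) + Im c *\<^sub>R J (snd (X p))" by (simp add: cmul_decompose)
  have fV: "fst V = - J (snd V)" and fX: "fst (X p) = - J (snd (X p))" using mX mV by blast+
  \<comment> \<open>\<open>J\<close> acts on the second component as \<open>- i\<close> times the formal unit, whence the conjugate\<close>
  have "V = cscale (cnj c) (X p)"
    unfolding cscale_def prod_eq_iff[of V] fst_conv snd_conv fV sV fX by (simp add: J_simps)
  then show ?thesis by (rule that)
qed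

text \<open>In the \<open>sl\<^sub>2\<close>-triple formed by \<open>X\<close>, \<open>T\<close> and \<open>H\<close> this is the semisimple element.\<close>

definition H :: "C2 \<Rightarrow> C2 \<times> C2" where "H = bracket S X T"

lemma H: "complex_vector_field S H"
  unfolding H_def by (rule complex_vector_field_bracket[OF smooth X T])

lemma apply_H:
  "smooth_on_surface S f \<Longrightarrow> p \<in> S \<Longrightarrow>
   apply_field S H f p = apply_field S X (apply_field S T f) p - apply_field S T (apply_field S X f) p"
  unfolding H_def by (rule apply_bracket[OF X T _ _ smooth])

lemma apply_field_of:
  assumes V: "complex_vector_field S V" and W: "complex_vector_field S W" and f: "smooth_on_surface S f"
    and eq: "\<And>x. x \<in> S \<Longrightarrow> apply_field S W f x = g x" and p: "p \<in> S"
  shows "apply_field S V (apply_field S W f) p = apply_field S V g p"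
  by (rule apply_field_cong[OF V smooth_apply_field[OF W f] eq p])

lemma H_coord:
  assumes p: "p \<in> S"
  shows "apply_field S H fst p = - fst p" "apply_field S H snd p = - snd p"
    "apply_field S H w1 p = fst (dual_map S p)" "apply_field S H w2 p = snd (dual_map S p)"
proof -
  note c = smooth_on_surface_coord smooth_dual_coord
  show "apply_field S H fst p = - fst p"
    using apply_H[OF c(1) p] apply_field_of[OF X T c(1) T_z(1) p] X_w(2)[OF p] apply_field_zero[OF T X_z(1) p] by simp
  show "apply_field S H snd p = - snd p"
    using apply_H[OF c(2) p] apply_field_of[OF X T c(2) T_z(2) p] X_w(1)[OF p] apply_field_zero[OF T X_z(2) p]
      apply_field_minus[OF X c(3) p] by simp
  show "apply_field S H w1 p = fst (dual_map S p)"
    using apply_H[OF c(3) p] apply_field_of[OF T X c(3) X_w(1) p] T_z(2)[OF p] apply_field_zero[OF X T_w(1) p] by simp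
  show "apply_field S H w2 p = snd (dual_map S p)"
    using apply_H[OF c(4) p] apply_field_of[OF T X c(4) X_w(2) p] T_z(1)[OF p] apply_field_zero[OF X T_w(2) p]
      apply_field_minus[OF T c(1) p] by simp
qed

text \<open>The coefficients of \<open>T\<close> and \<open>H\<close> are found from the action on \<open>z\<^sub>1, z\<^sub>2\<close>, using \<open>z \<cdot> w = 1\<close>; the remainder
kills \<open>z\<^sub>1, z\<^sub>2\<close> and is a multiple of \<open>X\<close>.\<close>

lemma frame:
  assumes p: "p \<in> S" and V: "V \<in> ctangent S p"
  obtains \<alpha> where "\<And>f. smooth_on_surface S f \<Longrightarrow> cdiff S f p V = \<alpha> * apply_field S X f p
      + (snd p * fst (cvec V) - fst p * snd (cvec V)) * apply_field S T f p - cdot (dual_map S p) (cvec V) * apply_field S H f p"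
proof -
  define \<beta> where "\<beta> = snd p * fst (cvec V) - fst p * snd (cvec V)"
  define \<gamma> where "\<gamma> = - cdot (dual_map S p) (cvec V)"
  note TT = field_in_ctangent[OF T p] and HT = field_in_ctangent[OF H p]
  let ?W = "(V + cscale (- \<beta>) (T p)) + cscale (- \<gamma>) (H p)"
  note c1 = ctangent_cscale_add[OF _ p V TT, of _ "- \<beta>"]
  have V1: "V + cscale (- \<beta>) (T p) \<in> ctangent S p" by (rule c1(1)[OF smooth_on_surface_coord(1)])
  note c2 = ctangent_cscale_add[OF _ p V1 HT, of _ "- \<gamma>"]
  have W: "?W \<in> ctangent S p" by (rule c2(1)[OF smooth_on_surface_coord(1)])
  have 2: "fst (dual_map S p) * fst p + snd (dual_map S p) * snd p = 1"
    using cdot_dual_map[OF p] by (simp add: cdot_def)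
  have "fst (cvec V) - \<beta> * snd (dual_map S p) + \<gamma> * fst p = 0"
    "snd (cvec V) + \<beta> * fst (dual_map S p) + \<gamma> * snd p = 0"
    using 2 unfolding \<beta>_def \<gamma>_def cdot_def by algebra+
  then have "cvec ?W = 0"
    using cvec_field[OF T p] cvec_field[OF H p] T_z[OF p] H_coord(1,2)[OF p]
    by (simp add: cvec_simps cmul_def prod_eq_iff)
  then obtain c where c: "?W = cscale c (X p)" using cvec_zero_multiple_X[OF p W] by blast
  show ?thesis
  proof (rule that[of c])
    fix f :: "C2 \<Rightarrow> complex" assume f: "smooth_on_surface S f"
    have "cdiff S f p ?W = c * cdiff S f p (X p)"
      unfolding c by (rule ctangent_cscale_add(4)[OF f p V field_in_ctangent[OF X p]])
    moreover have "cdiff S f p ?W = cdiff S f p V - \<beta> * cdiff S f p (T p) - \<gamma> * cdiff S f p (H p)"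
      using c2(2)[OF f] c1(2)[OF f] by simp
    ultimately have "cdiff S f p V = c * cdiff S f p (X p) + \<beta> * cdiff S f p (T p) + \<gamma> * cdiff S f p (H p)"
      by (simp add: algebra_simps)
    then show "cdiff S f p V = c * apply_field S X f p
      + (snd p * fst (cvec V) - fst p * snd (cvec V)) * apply_field S T f p - cdot (dual_map S p) (cvec V) * apply_field S H f p"
      by (simp add: apply_field_cdiff \<beta>_def \<gamma>_def)
  qed
qed

text \<open>Compare the actions of \<open>[H,T]\<close> on \<open>z\<^sub>1, z\<^sub>2\<close> and on \<open>w\<^sub>1, w\<^sub>2\<close> with \<open>frame\<close>: the first pair
determines the coefficients of \<open>T\<close> and \<open>H\<close>, the second one that of \<open>X\<close>.\<close>

lemma bracket_H_T:
  assumes f: "smooth_on_surface S f" and p: "p \<in> S"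
  shows "apply_field S H (apply_field S T f) p - apply_field S T (apply_field S H f) p = 2 * apply_field S T f p"
proof -
  note c = smooth_on_surface_coord smooth_dual_coord
  define K where "K = bracket S H T"
  have K: "complex_vector_field S K" unfolding K_def by (rule complex_vector_field_bracket[OF smooth H T])
  have apK: "apply_field S K f p = apply_field S H (apply_field S T f) p - apply_field S T (apply_field S H f) p"
    if "smooth_on_surface S f" for f
    unfolding K_def by (rule apply_bracket[OF H T that p smooth])
  have K1: "apply_field S K fst p = 2 * snd (dual_map S p)"
    using apK[OF c(1)] apply_field_of[OF H T c(1) T_z(1) p] apply_field_of[OF T H c(1) H_coord(1) p]
      H_coord(4)[OF p] T_z(1)[OF p] apply_field_minus[OF T c(1) p] by simp
  have K2: "apply_field S K snd p = - 2 * fst (dual_map S p)"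
    using apK[OF c(2)] apply_field_of[OF H T c(2) T_z(2) p] apply_field_of[OF T H c(2) H_coord(2) p]
      H_coord(3)[OF p] T_z(2)[OF p] apply_field_minus[OF T c(2) p] apply_field_minus[OF H c(3) p] by simp
  have K3: "apply_field S K w1 p = 0"
    using apK[OF c(3)] apply_field_zero[OF H T_w(1) p] apply_field_of[OF T H c(3) H_coord(3) p] T_w(1)[OF p] by simp
  have K4: "apply_field S K w2 p = 0"
    using apK[OF c(4)] apply_field_zero[OF H T_w(2) p] apply_field_of[OF T H c(4) H_coord(4) p] T_w(2)[OF p] by simp
  have cv: "cvec (K p) = (2 * snd (dual_map S p), - 2 * fst (dual_map S p))"
    using cvec_field[OF K p] K1 K2 by simp
  have 2: "fst (dual_map S p) * fst p + snd (dual_map S p) * snd p = 1"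
    using cdot_dual_map[OF p] by (simp add: cdot_def)
  have b: "snd p * fst (cvec (K p)) - fst p * snd (cvec (K p)) = 2" using 2 unfolding cv fst_conv snd_conv by algebra
  have g: "cdot (dual_map S p) (cvec (K p)) = 0" by (simp add: cv cdot_def)
  obtain \<alpha> where \<alpha>: "\<And>f. smooth_on_surface S f \<Longrightarrow> apply_field S K f p = \<alpha> * apply_field S X f p + 2 * apply_field S T f p"
    using frame[OF p field_in_ctangent[OF K p]] unfolding b g apply_field_cdiff by (auto simp: apply_field_cdiff)
  have "\<alpha> * snd p = 0" "\<alpha> * fst p = 0"
    using \<alpha>[OF c(3)] \<alpha>[OF c(4)] K3 K4 T_w[OF p] X_w[OF p] by simp_all
  then have "\<alpha> = 0" using 2 by auto
  then show ?thesis using \<alpha>[OF f] apK[OF f] by simp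
qed

lemma bracket_H_X:
  assumes f: "smooth_on_surface S f" and p: "p \<in> S"
  shows "apply_field S H (apply_field S X f) p - apply_field S X (apply_field S H f) p = - 2 * apply_field S X f p"
proof -
  note c = smooth_on_surface_coord smooth_dual_coord
  define K where "K = bracket S H X"
  have K: "complex_vector_field S K" unfolding K_def by (rule complex_vector_field_bracket[OF smooth H X])
  have apK: "apply_field S K f p = apply_field S H (apply_field S X f) p - apply_field S X (apply_field S H f) p"
    if "smooth_on_surface S f" for f
    unfolding K_def by (rule apply_bracket[OF H X that p smooth])
  have K1: "apply_field S K fst p = 0"
    using apK[OF c(1)] apply_field_zero[OF H X_z(1) p] apply_field_of[OF X H c(1) H_coord(1) p]
      X_z(1)[OF p] apply_field_minus[OF X c(1) p] by simp
  have K2: "apply_field S K snd p = 0"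
    using apK[OF c(2)] apply_field_zero[OF H X_z(2) p] apply_field_of[OF X H c(2) H_coord(2) p]
      X_z(2)[OF p] apply_field_minus[OF X c(2) p] by simp
  have K3: "apply_field S K w1 p = - 2 * snd p"
    using apK[OF c(3)] apply_field_of[OF H X c(3) X_w(1) p] apply_field_of[OF X H c(3) H_coord(3) p]
      X_w(1)[OF p] H_coord(2)[OF p] by simp
  have K4: "apply_field S K w2 p = 2 * fst p"
    using apK[OF c(4)] apply_field_of[OF H X c(4) X_w(2) p] apply_field_of[OF X H c(4) H_coord(4) p]
      X_w(2)[OF p] H_coord(1)[OF p] apply_field_minus[OF H c(1) p] by simp
  have cv: "cvec (K p) = 0"
    using cvec_field[OF K p] K1 K2 by (simp add: zero_prod_def)
  obtain \<alpha> where \<alpha>: "\<And>f. smooth_on_surface S f \<Longrightarrow> apply_field S K f p = \<alpha> * apply_field S X f p"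
    using frame[OF p field_in_ctangent[OF K p]] unfolding cv by (auto simp: apply_field_cdiff cdot_simps)
  have "- 2 * snd p = \<alpha> * snd p" "2 * fst p = \<alpha> * - fst p"
    using \<alpha>[OF c(3)] \<alpha>[OF c(4)] K3 K4 X_w[OF p] by metis+
  then have "(\<alpha> + 2) * snd p = 0" "(\<alpha> + 2) * fst p = 0" by algebra+
  moreover have "fst (dual_map S p) * fst p + snd (dual_map S p) * snd p = 1"
    using cdot_dual_map[OF p] by (simp add: cdot_def)
  ultimately have "\<alpha> = - 2" by (auto simp: eq_neg_iff_add_eq_0)
  then show ?thesis using \<alpha>[OF f] apK[OF f] by simp
qed

end

section \<open>The decomposition\<close>

context dual_fields
begin

lemma cdiff_cvec_zero:
  assumes p: "p \<in> S" and V: "V \<in> ctangent S p" and 0: "cvec V = 0"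
    and f: "smooth_on_surface S f" and Xf: "apply_field S X f p = 0"
  shows "cdiff S f p V = 0"
proof -
  obtain c where c: "V = cscale c (X p)" using cvec_zero_multiple_X[OF p V 0] .
  show ?thesis
    unfolding c using ctangent_cscale_add(4)[OF f p V field_in_ctangent[OF X p], of c] Xf
    by (simp add: apply_field_cdiff)
qed

text \<open>\<open>X\<close> is \<open>- J b + i b\<close> with \<open>b\<close> complex tangential, so \<open>X f\<close> is the defect of the Cauchy-Riemann equation in
the direction \<open>b\<close>. Conversely \<open>(- J v, v)\<close> kills \<open>z\<^sub>1, z\<^sub>2\<close> for every complex tangential \<open>v\<close>, hence is a
multiple of \<open>X\<close>.\<close>

lemma CR_iff:
  assumes f: "smooth_on_surface S f"
  shows "CR S f \<longleftrightarrow> (\<forall>p\<in>S. apply_field S X f p = 0)"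
proof (intro iffI ballI)
  fix p assume CR: "CR S f" and p: "p \<in> S"
  have X0: "cvec (X p) = 0" using cvec_field[OF X p] X_z[OF p] by (simp add: zero_prod_def)
  then have a: "fst (X p) = - J (snd (X p))" by (simp add: cvec_def eq_neg_iff_add_eq_0)
  note t = complex_vector_fieldD(3,4)[OF X p]
  have H: "snd (X p) \<in> complex_tangent_space S p"
    using t a by (intro complex_tangentI[OF p]) auto
  then have "surface_diff S f p (J (snd (X p))) = \<i> * surface_diff S f p (snd (X p))"
    using CR p unfolding CR_def by blast
  then show "apply_field S X f p = 0"
    unfolding apply_field_def a using surface_diff_minus(2)[OF f p complex_tangentD(2)[OF p H]] by simp
next
  assume Xf: "\<forall>p\<in>S. apply_field S X f p = 0"
  have "surface_diff S f p (J v) = \<i> * surface_diff S f p v" if p: "p \<in> S" and v: "v \<in> complex_tangent_space S p" for p v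
  proof -
    note t = complex_tangentD[OF p v]
    have "cdiff S f p (- J v, v) = 0"
      by (rule cdiff_cvec_zero[OF p _ _ f]) (use t Xf p in \<open>auto simp: ctangent_def cvec_def\<close>)
    then show ?thesis
      using surface_diff_minus(2)[OF f p t(2)] by (simp add: cdiff_def)
  qed
  then show "CR S f" unfolding CR_def using f by blast
qed

text \<open>With \<open>T = a + i b\<close>, the pairing of \<open>w\<close> with \<open>a + J b = (w\<^sub>2, - w\<^sub>1)\<close> vanishes, so \<open>w \<cdot> a\<close> and \<open>w \<cdot> b\<close> differ by
the factor \<open>- i\<close>. Tangency puts both on the same real line in \<open>\<complex>\<close>, so both are zero.\<close>

lemma T_complex_tangent:
  assumes p: "p \<in> S"
  shows "fst (T p) \<in> complex_tangent_space S p" "snd (T p) \<in> complex_tangent_space S p" "cvec (T p) = \<tau> p"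
proof -
  show cv: "cvec (T p) = \<tau> p" using cvec_field[OF T p] T_z[OF p] by (simp add: \<tau>_def)
  note t = complex_vector_fieldD(3,4)[OF T p]
  let ?a = "cdot (dual_map S p) (fst (T p))" and ?b = "cdot (dual_map S p) (snd (T p))"
  have "cdot (dual_map S p) (cvec (T p)) = 0" unfolding cv by (simp add: \<tau>_def cdot_def)
  then have ab: "?a = - \<i> * ?b" by (simp add: cvec_def cdot_simps add_eq_0_iff2)
  obtain d where d: "d \<noteq> 0" "\<And>v. v \<in> tangent_space S p \<longleftrightarrow> Re (d * cdot (dual_map S p) v) = 0"
    using dual_map_conormal[OF p] by blast
  have "Re (d * ?b) = 0" "Re (d * (- \<i> * ?b)) = 0" using t d(2) ab by auto
  then have "d * ?b = 0" by (simp add: complex_eq_iff algebra_simps)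
  then have "?b = 0" using d(1) by simp
  then show "fst (T p) \<in> complex_tangent_space S p" "snd (T p) \<in> complex_tangent_space S p"
    using ab complex_tangent_space_iff[OF p] by auto
qed

lemma surface_diff_dual_T:
  assumes p: "p \<in> S"
  shows "surface_diff S (dual_map S) p (fst (T p)) = - J (surface_diff S (dual_map S) p (snd (T p)))"
proof -
  note t = complex_vector_fieldD(3,4)[OF T p]
  note l = smooth_on_surface_linear(2)[OF bounded_linear_fst smooth_dual_map p]
    smooth_on_surface_linear(2)[OF bounded_linear_snd smooth_dual_map p]
  show ?thesis
    using T_w[OF p] l(1)[OF t(1)] l(1)[OF t(2)] l(2)[OF t(1)] l(2)[OF t(2)]
    by (simp add: apply_field_def J_def prod_eq_iff eq_neg_iff_add_eq_0)
qed

lemma real_basis_complex: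
  assumes "Re a * Im b - Im a * Re b \<noteq> 0"
  obtains s t :: real where "z = of_real s * a + of_real t * b"
proof
  let ?d = "Re a * Im b - Im a * Re b"
  show "z = of_real ((Re z * Im b - Im z * Re b) / ?d) * a + of_real ((Re a * Im z - Im a * Re z) / ?d) * b"
    using assms by (simp add: complex_eq_iff divide_simps) (simp add: algebra_simps)
qed

lemma surface_diff_dual_inj:
  assumes p: "p \<in> S" shows "inj_on (surface_diff S (dual_map S) p) (complex_tangent_space S p)"
proof (rule inj_onI)
  fix u v assume u: "u \<in> complex_tangent_space S p" and v: "v \<in> complex_tangent_space S p"
    and eq: "surface_diff S (dual_map S) p u = surface_diff S (dual_map S) p v"
  have "surface_diff S (dual_map S) p (u - v) = 0"
    using tangent_linear(2)[OF smooth_dual_map p complex_tangentD(1)[OF p u] complex_tangentD(1)[OF p v], of 1 "-1"] eq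
    by simp
  moreover have "u - v \<in> complex_tangent_space S p"
    using u v unfolding complex_tangent_space_iff[OF p] by (simp add: cdot_simps)
  ultimately show "u = v" using dual_map_immersive[OF C_convex p] by fastforce
qed

text \<open>With \<open>T = a + i b\<close>, the condition \<open>T w\<^sub>1 = T w\<^sub>2 = 0\<close> says that the derivative of the dual map intertwines \<open>J\<close>
with \<open>a \<mapsto> b\<close>, \<open>b \<mapsto> - a\<close>. By injectivity of that derivative on complex tangent vectors, \<open>a\<close> and \<open>b\<close> are
linearly independent over the reals, so they span \<open>H\<^sub>pS\<close> and \<open>J\<^sup>*\<close> is determined.\<close>

lemma Jstar_T_basis:
  assumes p: "p \<in> S" and v: "v \<in> complex_tangent_space S p"
  obtains s t where "v = s *\<^sub>R fst (T p) + t *\<^sub>R snd (T p)" "Jstar S p v = s *\<^sub>R snd (T p) - t *\<^sub>R fst (T p)"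
proof -
  let ?a = "fst (T p)" and ?b = "snd (T p)" and ?W = "surface_diff S (dual_map S) p"
  note H = T_complex_tangent[OF p]
  define c where "c v = fst v * snd p - snd v * fst p" for v :: C2
  have line: "u = cmul (c u) (\<tau> p)" if "u \<in> complex_tangent_space S p" for u
    unfolding c_def by (rule complex_tangent_line[OF p that])
  note t = complex_vector_fieldD(3,4)[OF T p]
  note W = tangent_linear(2)[OF smooth_dual_map p t]
  have aW: "?W ?a = - J (?W ?b)" by (rule surface_diff_dual_T[OF p])
  have tau: "\<tau> p \<noteq> 0"
    using cdot_dual_map[OF p] by (auto simp: \<tau>_def cdot_def zero_prod_def)
  have b0: "?b \<noteq> 0"
  proof
    assume b: "?b = 0"
    then have "?W ?a = 0" using aW surface_diff_zero(2)[OF smooth_dual_map p] by (simp add: J_simps)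
    then have "?a = 0" using dual_map_immersive[OF C_convex p H(1)] by blast
    then show False using H(3) b tau by (simp add: cvec_def J_simps)
  qed
  have indep: "s = 0 \<and> t = 0" if st: "s *\<^sub>R ?a + t *\<^sub>R ?b = 0" for s t
  proof -
    have "?W (s *\<^sub>R ?a + t *\<^sub>R ?b) = 0" unfolding st by (rule surface_diff_zero(2)[OF smooth_dual_map p])
    then have "cmul (of_real t - \<i> * of_real s) (?W ?b) = 0"
      unfolding W aW by (simp add: cmul_def J_def scaleR_conv_of_real prod_eq_iff algebra_simps)
    moreover have "?W ?b \<noteq> 0" using dual_map_immersive[OF C_convex p H(2)] b0 by blast
    ultimately show ?thesis by (simp add: cmul_eq_0 complex_eq_iff)
  qed
  have comb: "r *\<^sub>R ?a + q *\<^sub>R ?b = cmul (of_real r * c ?a + of_real q * c ?b) (\<tau> p)" for r q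
  proof -
    have "r *\<^sub>R cmul (c ?a) (\<tau> p) + q *\<^sub>R cmul (c ?b) (\<tau> p) = cmul (of_real r * c ?a + of_real q * c ?b) (\<tau> p)"
      by (simp add: cmul_def scaleR_conv_of_real algebra_simps)
    then show ?thesis unfolding line[OF H(1), symmetric] line[OF H(2), symmetric] .
  qed
  have "Re (c ?a) * Im (c ?b) - Im (c ?a) * Re (c ?b) \<noteq> 0"
  proof
    assume d: "Re (c ?a) * Im (c ?b) - Im (c ?a) * Re (c ?b) = 0"
    have "of_real (Re (c ?b)) * c ?a + of_real (- Re (c ?a)) * c ?b = 0"
      using d by (simp add: complex_eq_iff algebra_simps)
    then have "Re (c ?b) *\<^sub>R ?a + (- Re (c ?a)) *\<^sub>R ?b = 0" by (simp only: comb cmul_simps)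
    then have 1: "Re (c ?b) = 0 \<and> - Re (c ?a) = 0" by (rule indep)
    have "of_real (Im (c ?b)) * c ?a + of_real (- Im (c ?a)) * c ?b = 0"
      using d by (simp add: complex_eq_iff algebra_simps)
    then have "Im (c ?b) *\<^sub>R ?a + (- Im (c ?a)) *\<^sub>R ?b = 0" by (simp only: comb cmul_simps)
    then have 2: "Im (c ?b) = 0 \<and> - Im (c ?a) = 0" by (rule indep)
    have "c ?b = 0" using 1 2 by (simp add: complex_eq_iff)
    then show False using line[OF H(2)] b0 by (simp add: cmul_simps)
  qed
  then obtain s t where st: "c v = of_real s * c ?a + of_real t * c ?b" by (rule real_basis_complex)
  have v_eq: "v = s *\<^sub>R ?a + t *\<^sub>R ?b" using line[OF v] unfolding comb st .
  let ?u = "s *\<^sub>R ?b - t *\<^sub>R ?a"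
  have u: "?u \<in> complex_tangent_space S p"
    using H(1,2) unfolding complex_tangent_space_iff[OF p] by (simp add: cdot_simps)
  have "?W ?u = (- t) *\<^sub>R ?W ?a + s *\<^sub>R ?W ?b" using W[of "- t" s] by simp
  also have "\<dots> = J (?W v)" unfolding v_eq W aW by (simp add: J_simps)
  finally have "inv_into (complex_tangent_space S p) ?W (J (?W v)) = ?u"
    using inv_into_f_f[OF surface_diff_dual_inj[OF p] u] by simp
  then show ?thesis using that[OF v_eq] by (simp add: Jstar_def)
qed

text \<open>In the real basis \<open>a, b\<close> of \<open>H\<^sub>pS\<close> given by \<open>T = a + i b\<close>, the defect of the dual Cauchy-Riemann equation in
direction \<open>s a + t b\<close> is \<open>- (t + i s) T g\<close>.\<close>

lemma dual_CR_iff: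
  assumes g: "smooth_on_surface S g"
  shows "dual_CR S g \<longleftrightarrow> (\<forall>p\<in>S. apply_field S T g p = 0)"
proof -
  have key: "surface_diff S g p (Jstar S p v) - \<i> * surface_diff S g p v
      = - (of_real t + \<i> * of_real s) * apply_field S T g p"
    if p: "p \<in> S" and st: "v = s *\<^sub>R fst (T p) + t *\<^sub>R snd (T p)" "Jstar S p v = s *\<^sub>R snd (T p) - t *\<^sub>R fst (T p)" for p v s t
  proof -
    note l = tangent_linear(2)[OF g p complex_vector_fieldD(3,4)[OF T p]]
    have ii: "\<i> * (\<i> * z) = - z" for z by (simp flip: mult.assoc)
    have "surface_diff S g p (s *\<^sub>R snd (T p) - t *\<^sub>R fst (T p))
      = (- t) *\<^sub>R surface_diff S g p (fst (T p)) + s *\<^sub>R surface_diff S g p (snd (T p))"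
      using l[of "- t" s] by simp
    then show ?thesis
      unfolding st(2) unfolding st(1) l by (simp add: apply_field_def scaleR_conv_of_real algebra_simps ii)
  qed
  show ?thesis
  proof (intro iffI ballI)
    fix p assume d: "dual_CR S g" and p: "p \<in> S"
    note H = T_complex_tangent[OF p]
    have *: "(of_real t + \<i> * of_real s) * apply_field S T g p = 0"
      if "v \<in> complex_tangent_space S p" "v = s *\<^sub>R fst (T p) + t *\<^sub>R snd (T p)"
        "Jstar S p v = s *\<^sub>R snd (T p) - t *\<^sub>R fst (T p)" for v s t
      using key[OF p that(2,3)] d p that(1) by (auto simp: dual_CR_def)
    show "apply_field S T g p = 0"
    proof (rule ccontr)
      assume nz: "apply_field S T g p \<noteq> 0"
      have zero: "v = 0" if v: "v \<in> complex_tangent_space S p" for v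
      proof -
        obtain s t where st: "v = s *\<^sub>R fst (T p) + t *\<^sub>R snd (T p)" "Jstar S p v = s *\<^sub>R snd (T p) - t *\<^sub>R fst (T p)"
          using Jstar_T_basis[OF p v] .
        from *[OF v st] nz have "of_real t + \<i> * of_real s = (0::complex)" by simp
        then have "t = 0" "s = 0" by (simp_all add: complex_eq_iff)
        then show ?thesis using st by simp
      qed
      have "fst (T p) = 0" "snd (T p) = 0" using zero H(1,2) by blast+
      then show False using nz surface_diff_zero(2)[OF g p] by (simp add: apply_field_def)
    qed
  next
    assume Tg: "\<forall>p\<in>S. apply_field S T g p = 0"
    have "surface_diff S g p (Jstar S p v) = \<i> * surface_diff S g p v"
      if p: "p \<in> S" and v: "v \<in> complex_tangent_space S p" for p v
    proof -
      obtain s t where st: "v = s *\<^sub>R fst (T p) + t *\<^sub>R snd (T p)" "Jstar S p v = s *\<^sub>R snd (T p) - t *\<^sub>R fst (T p)"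
        using Jstar_T_basis[OF p v] .
      from key[OF p st] Tg p show ?thesis by simp
    qed
    then show "dual_CR S g" unfolding dual_CR_def using g by blast
  qed
qed

text \<open>\<open>X T f = H f\<close> for CR functions and \<open>T X g = - H g\<close> for dual-CR functions, and \<open>H\<close> commutes with \<open>X\<close>
and \<open>T\<close> up to multiples of them.\<close>

lemma decomposition_imp_equations:
  assumes f: "CR S f" and g: "dual_CR S g" and u: "smooth_on_surface S u" and eq: "\<And>x. x \<in> S \<Longrightarrow> u x = f x + g x" and p: "p \<in> S"
  shows "apply_field S X (apply_field S X (apply_field S T u)) p = 0"
    "apply_field S T (apply_field S T (apply_field S X u)) p = 0"
proof -
  have sf: "smooth_on_surface S f" and sg: "smooth_on_surface S g" using f g by (auto simp: CR_def dual_CR_def)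
  have Xf: "\<And>x. x \<in> S \<Longrightarrow> apply_field S X f x = 0" using f CR_iff[OF sf] by blast
  have Tg: "\<And>x. x \<in> S \<Longrightarrow> apply_field S T g x = 0" using g dual_CR_iff[OF sg] by blast
  have Tu: "apply_field S T u x = apply_field S T f x" if "x \<in> S" for x
    using apply_field_cong[OF T u eq that] apply_field_add[OF T sf sg that] Tg[OF that] by simp
  have Xu: "apply_field S X u x = apply_field S X g x" if "x \<in> S" for x
    using apply_field_cong[OF X u eq that] apply_field_add[OF X sf sg that] Xf[OF that] by simp
  have XTu: "apply_field S X (apply_field S T u) x = apply_field S H f x" if x: "x \<in> S" for x
    using apply_field_of[OF X T u Tu x] apply_H[OF sf x] apply_field_zero[OF T Xf x] by simp
  have TXu: "apply_field S T (apply_field S X u) x = - apply_field S H g x" if x: "x \<in> S" for x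
    using apply_field_of[OF T X u Xu x] apply_H[OF sg x] apply_field_zero[OF X Tg x] by simp
  have "apply_field S X (apply_field S X (apply_field S T u)) p = apply_field S X (apply_field S H f) p"
    by (rule apply_field_of[OF X X smooth_apply_field[OF T u] XTu p])
  also have "\<dots> = 0" using bracket_H_X[OF sf p] apply_field_zero[OF H Xf p] Xf[OF p] by simp
  finally show "apply_field S X (apply_field S X (apply_field S T u)) p = 0" .
  have "apply_field S T (apply_field S T (apply_field S X u)) p = apply_field S T (\<lambda>x. - apply_field S H g x) p"
    by (rule apply_field_of[OF T T smooth_apply_field[OF X u] TXu p])
  also have "\<dots> = 0"
    using bracket_H_T[OF sg p] apply_field_zero[OF H Tg p] Tg[OF p] apply_field_minus[OF T smooth_apply_field[OF H sg] p]
    by simp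
  finally show "apply_field S T (apply_field S T (apply_field S X u)) p = 0" .
qed

text \<open>\<open>\<eta>\<close> is the one-form that a CR function \<open>f\<close> with \<open>T f = T u\<close> must have as its differential. In the frame,
closedness reduces to \<open>X A = B\<close>, \<open>X B = 0\<close> and \<open>H A = 2 A + T B\<close>. The last identity is \<open>[H,T] u = 2 T u\<close> combined
with \<open>T T X u = 0\<close>.\<close>

lemma equations_imp_decomposition:
  assumes sc: "simply_connected S" and u: "smooth_on_surface S u"
    and XXT: "\<And>p. p \<in> S \<Longrightarrow> apply_field S X (apply_field S X (apply_field S T u)) p = 0"
    and TTX: "\<And>p. p \<in> S \<Longrightarrow> apply_field S T (apply_field S T (apply_field S X u)) p = 0"
  obtains f g where "CR S f" "dual_CR S g" "\<And>p. p \<in> S \<Longrightarrow> u p = f p + g p"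
proof -
  define A where "A = apply_field S T u"
  define B where "B = apply_field S X A"
  have sA: "smooth_on_surface S A" unfolding A_def by (rule smooth_apply_field[OF T u])
  have sB: "smooth_on_surface S B" unfolding B_def by (rule smooth_apply_field[OF X sA])
  have HA: "apply_field S H A p = 2 * A p + apply_field S T B p" if p: "p \<in> S" for p
  proof -
    have "apply_field S T (apply_field S H u) p = apply_field S T (\<lambda>x. B x + - apply_field S T (apply_field S X u) x) p"
      using apply_field_of[OF T H u apply_H[OF u] p] by (simp add: A_def B_def)
    also have "\<dots> = apply_field S T B p"
      using apply_field_add[OF T sB smooth_on_surface_linear(1)[OF bounded_linear_minus[OF bounded_linear_ident]
            smooth_apply_field[OF T smooth_apply_field[OF X u]]] p]
        apply_field_minus[OF T smooth_apply_field[OF T smooth_apply_field[OF X u]] p] TTX[OF p] by simp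
    finally show ?thesis using bracket_H_T[OF u p] by (simp add: A_def algebra_simps)
  qed
  define \<eta> where "\<eta> x v = A x * (snd x * fst v - fst x * snd v) - B x * (w1 x * fst v + w2 x * snd v)" for x v
  note c = smooth_on_surface_coord smooth_dual_coord
  have s\<eta>: "smooth_on_surface S (\<lambda>x. \<eta> x v)"
    and d\<eta>: "p \<in> S \<Longrightarrow> t \<in> tangent_space S p \<Longrightarrow> surface_diff S (\<lambda>x. \<eta> x v) p t
      = surface_diff S A p t * (snd p * fst v - fst p * snd v) + A p * (snd t * fst v - fst t * snd v)
        - surface_diff S B p t * (w1 p * fst v + w2 p * snd v)
        - B p * (surface_diff S w1 p t * fst v + surface_diff S w2 p t * snd v)" for v p t
  proof -
    note lin = smooth_on_surface_linear[OF bounded_linear_mult_left]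
    have 1: "smooth_on_surface S (\<lambda>x. snd x * fst v + fst x * (- snd v))"
      by (intro smooth_on_surface_add lin c)
    have 2: "smooth_on_surface S (\<lambda>x. w1 x * (- fst v) + w2 x * (- snd v))"
      by (intro smooth_on_surface_add lin c)
    have \<eta>: "(\<lambda>x. \<eta> x v) = (\<lambda>x. A x * (snd x * fst v + fst x * (- snd v)) + B x * (w1 x * (- fst v) + w2 x * (- snd v)))"
      by (simp add: \<eta>_def fun_eq_iff algebra_simps)
    show "smooth_on_surface S (\<lambda>x. \<eta> x v)"
      unfolding \<eta> by (intro smooth_on_surface_add smooth_on_surface_mult sA sB 1 2)
    assume p: "p \<in> S" and t: "t \<in> tangent_space S p"
    note pt = p t
    have d1: "surface_diff S (\<lambda>x. snd x * fst v + fst x * (- snd v)) p t = snd t * fst v + fst t * (- snd v)"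
      unfolding smooth_on_surface_add(2)[OF lin(1)[OF c(2)] lin(1)[OF c(1)] pt] lin(2)[OF c(2) pt] lin(2)[OF c(1) pt]
      by (simp add: surface_diff_coord[OF pt])
    have d2: "surface_diff S (\<lambda>x. w1 x * (- fst v) + w2 x * (- snd v)) p t
        = surface_diff S w1 p t * (- fst v) + surface_diff S w2 p t * (- snd v)"
      unfolding smooth_on_surface_add(2)[OF lin(1)[OF c(3)] lin(1)[OF c(4)] pt] lin(2)[OF c(3) pt] lin(2)[OF c(4) pt] ..
    show "surface_diff S (\<lambda>x. \<eta> x v) p t
      = surface_diff S A p t * (snd p * fst v - fst p * snd v) + A p * (snd t * fst v - fst t * snd v)
        - surface_diff S B p t * (w1 p * fst v + w2 p * snd v)
        - B p * (surface_diff S w1 p t * fst v + surface_diff S w2 p t * snd v)"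
      unfolding \<eta> smooth_on_surface_add(2)[OF smooth_on_surface_mult[OF sA 1] smooth_on_surface_mult[OF sB 2] pt]
        surface_diff_mult[OF sA 1 pt] surface_diff_mult[OF sB 2 pt] d1 d2
      by (simp add: algebra_simps)
  qed
  have cl: "surface_diff S (\<lambda>x. \<eta> x v') p v = surface_diff S (\<lambda>x. \<eta> x v) p v'"
    if p: "p \<in> S" and v: "v \<in> tangent_space S p" and v': "v' \<in> tangent_space S p" for p v v'
  proof -
    define \<beta> where "\<beta> v = snd p * fst v - fst p * snd v" for v :: C2
    define \<gamma> where "\<gamma> v = - cdot (dual_map S p) v" for v
    have wz: "w1 p * fst p + w2 p * snd p = 1" using cdot_dual_map[OF p] by (simp add: cdot_def)
    \<comment> \<open>differentials of the ingredients of \<open>\<eta>\<close> in frame coordinates\<close>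
  have fr: "\<exists>\<alpha>. surface_diff S A p v = \<alpha> * B p + \<beta> v * apply_field S T A p + \<gamma> v * (2 * A p + apply_field S T B p) \<and>
      surface_diff S B p v = \<beta> v * apply_field S T B p + \<gamma> v * apply_field S H B p \<and>
      surface_diff S w1 p v = \<alpha> * snd p + \<gamma> v * w1 p \<and> surface_diff S w2 p v = - \<alpha> * fst p + \<gamma> v * w2 p"
      if v: "v \<in> tangent_space S p" for v
    proof -
      have z: "(0::C2) \<in> tangent_space S p" by (rule surface_diff_zero(1)[OF c(1) p])
      have V: "(v, 0) \<in> ctangent S p" using v z by (simp add: ctangent_def)
      have cd: "cdiff S f p (v, 0) = surface_diff S f p v" if "smooth_on_surface S f" for f
        using surface_diff_zero(2)[OF that p] by (simp add: cdiff_def)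
      obtain \<alpha> where \<alpha>: "\<And>f. smooth_on_surface S f \<Longrightarrow> cdiff S f p (v, 0) = \<alpha> * apply_field S X f p
          + \<beta> v * apply_field S T f p + \<gamma> v * apply_field S H f p"
        using frame[OF p V] by (auto simp: cvec_simps \<beta>_def \<gamma>_def)
      show ?thesis
        using \<alpha>[OF sA] \<alpha>[OF sB] \<alpha>[OF c(3)] \<alpha>[OF c(4)] cd[OF sA] cd[OF sB] cd[OF c(3)] cd[OF c(4)]
          HA[OF p] XXT[OF p] X_w[OF p] T_w[OF p] H_coord(3,4)[OF p]
        by (intro exI[of _ \<alpha>]) (simp add: A_def[symmetric] B_def[symmetric])
    qed
    obtain a where a: "surface_diff S A p v = a * B p + \<beta> v * apply_field S T A p + \<gamma> v * (2 * A p + apply_field S T B p)"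
      "surface_diff S B p v = \<beta> v * apply_field S T B p + \<gamma> v * apply_field S H B p"
      "surface_diff S w1 p v = a * snd p + \<gamma> v * w1 p" "surface_diff S w2 p v = - a * fst p + \<gamma> v * w2 p"
      using fr[OF v] by blast
    obtain a' where a': "surface_diff S A p v' = a' * B p + \<beta> v' * apply_field S T A p + \<gamma> v' * (2 * A p + apply_field S T B p)"
      "surface_diff S B p v' = \<beta> v' * apply_field S T B p + \<gamma> v' * apply_field S H B p"
      "surface_diff S w1 p v' = a' * snd p + \<gamma> v' * w1 p" "surface_diff S w2 p v' = - a' * fst p + \<gamma> v' * w2 p"
      using fr[OF v'] by blast
    have coords: "fst v = \<beta> v * w2 p - \<gamma> v * fst p" "snd v = - \<beta> v * w1 p - \<gamma> v * snd p" for v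
      using wz unfolding \<beta>_def \<gamma>_def cdot_def by algebra+
    have wv: "w1 p * fst v + w2 p * snd v = - \<gamma> v" for v by (simp add: \<gamma>_def cdot_def)
    have zv: "snd p * fst v - fst p * snd v = \<beta> v" for v by (simp add: \<beta>_def)
    have det: "snd v * fst v' - fst v * snd v' = \<beta> v * \<gamma> v' - \<gamma> v * \<beta> v'" for v v'
      using coords[of v] coords[of v'] wz by algebra
    have dw: "(a * snd p + \<gamma> v * w1 p) * fst v' + (- a * fst p + \<gamma> v * w2 p) * snd v' = a * \<beta> v' - \<gamma> v * \<gamma> v'" for a v v'
      using wv[of v'] zv[of v'] by algebra
    show ?thesis
      unfolding d\<eta>[OF p v] d\<eta>[OF p v'] a a' wv zv det[of v v'] det[of v' v] dw[of a v v'] dw[of a' v' v]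
      by (simp add: algebra_simps)
  qed
  have lin: "linear (\<eta> p)" for p
    by (rule linearI) (simp_all add: \<eta>_def scaleR_conv_of_real algebra_simps)
  obtain f where f: "smooth_on_surface S f"
    and df: "\<And>p v. p \<in> S \<Longrightarrow> v \<in> tangent_space S p \<Longrightarrow> surface_diff S f p v = \<eta> p v"
    using closed_form_exact[OF smooth sc lin s\<eta> cl] by blast
  have app: "apply_field S V f p = A p * (snd p * apply_field S V fst p - fst p * apply_field S V snd p)
      - B p * (w1 p * apply_field S V fst p + w2 p * apply_field S V snd p)"
    if V: "complex_vector_field S V" and p: "p \<in> S" for V p
  proof -
    note t = complex_vector_fieldD(3,4)[OF V p]
    show ?thesis
      unfolding apply_field_def df[OF p t(1)] df[OF p t(2)] surface_diff_coord[OF p t(1)] surface_diff_coord[OF p t(2)]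
      by (simp add: \<eta>_def algebra_simps)
  qed
  have Xf: "apply_field S X f p = 0" if p: "p \<in> S" for p using app[OF X p] X_z[OF p] by simp
  have Tf: "apply_field S T f p = A p" if p: "p \<in> S" for p
  proof -
    have "w1 p * fst p + w2 p * snd p = 1" using cdot_dual_map[OF p] by (simp add: cdot_def)
    then show ?thesis using app[OF T p] unfolding T_z[OF p] by algebra
  qed
  define g where "g x = u x + - f x" for x
  have smf: "smooth_on_surface S (\<lambda>x. - f x)"
    by (rule smooth_on_surface_linear(1)[OF bounded_linear_minus[OF bounded_linear_ident] f])
  have sg: "smooth_on_surface S g" unfolding g_def[abs_def] by (rule smooth_on_surface_add(1)[OF u smf])
  have Tg: "apply_field S T g p = 0" if p: "p \<in> S" for p
    unfolding g_def[abs_def] using apply_field_add[OF T u smf p] apply_field_minus[OF T f p] Tf[OF p] by (simp add: A_def)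
  show ?thesis
  proof (rule that)
    show "CR S f" using CR_iff[OF f] Xf by blast
    show "dual_CR S g" using dual_CR_iff[OF sg] Tg by blast
  qed (simp add: g_def)
qed

end

theorem theoremA:
  fixes S :: "C2 set" and X T :: "C2 \<Rightarrow> C2 \<times> C2" and z1 z2 w1 w2 u :: "C2 \<Rightarrow> complex"
  assumes "smooth_hypersurface S"
    and "strongly_C_convex S"
    and "simply_connected S"
    and "\<forall>p\<in>S. 0 \<notin> complex_tangent_hyperplane S p"
    and "z1 = fst" and "z2 = snd"
    and "w1 = (\<lambda>p. fst (dual_map S p))" and "w2 = (\<lambda>p. snd (dual_map S p))"
    and "complex_vector_field S X"
    and "\<forall>p\<in>S. apply_field S X z1 p = 0 \<and> apply_field S X z2 p = 0 \<and>
               apply_field S X w1 p = z2 p \<and> apply_field S X w2 p = - z1 p"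
    and "complex_vector_field S T"
    and "\<forall>p\<in>S. apply_field S T z1 p = w2 p \<and> apply_field S T z2 p = - w1 p \<and>
               apply_field S T w1 p = 0 \<and> apply_field S T w2 p = 0"
    and "smooth_on_surface S u"
  shows "(\<exists>f g. CR S f \<and> dual_CR S g \<and> (\<forall>p\<in>S. u p = f p + g p)) \<longleftrightarrow>
         (\<forall>p\<in>S. apply_field S X (apply_field S X (apply_field S T u)) p = 0 \<and>
                apply_field S T (apply_field S T (apply_field S X u)) p = 0)"
proof -
  interpret dual_fields S X T
    by unfold_locales (use assms in auto)
  show ?thesis
  proof
    assume "\<exists>f g. CR S f \<and> dual_CR S g \<and> (\<forall>p\<in>S. u p = f p + g p)"
    then obtain f g where "CR S f" "dual_CR S g" "\<And>p. p \<in> S \<Longrightarrow> u p = f p + g p" by blast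
    from decomposition_imp_equations[OF this(1,2) assms(13) this(3)]
    show "\<forall>p\<in>S. apply_field S X (apply_field S X (apply_field S T u)) p = 0 \<and>
        apply_field S T (apply_field S T (apply_field S X u)) p = 0" by blast
  next
    assume "\<forall>p\<in>S. apply_field S X (apply_field S X (apply_field S T u)) p = 0 \<and>
        apply_field S T (apply_field S T (apply_field S X u)) p = 0"
    then show "\<exists>f g. CR S f \<and> dual_CR S g \<and> (\<forall>p\<in>S. u p = f p + g p)"
      using equations_imp_decomposition[OF assms(3,13)] by metis
  qed
qed

end
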